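(* Let $W:\mathcal{X}\to\mathcal{S}(B)$ be a cq-channel, $\widetilde{\mathcal{X}}=W(\mathcal{X})\subset\mathcal{S}(B)$ and $\sqrt{\widetilde{\mathcal{X}}}=\{\sqrt{\sigma}:\sigma\in\widetilde{\mathcal{X}}\}$. Then for any $\lambda_1,\lambda_2>0$ with $\lambda_1+\lambda_2<1$, \[ \frac14\,\underline{d}_M\!\left(\sqrt{\widetilde{\mathcal{X}}}\right)\le\dot{C}_{\rm DI}(W)\le\liminf_{n\to\infty}\frac{1}{n\log n}\log N_{\rm DI}(n,\lambda_1,\lambda_2)\le\frac12\,\underline{d}_M\!\left(\sqrt{\widetilde{\mathcal{X}}}\right). \]
   Context: A cq-channel is a measurable map $W:\mathcal{X}\to\mathcal{S}(B)$ from a measure space $\mathcal{X}$ to density operators on a finite-dimensional Hilbert space $B$; $W_{x^n}=W_{x_1}\otimes\cdots\otimes W_{x_n}$ for $x^n\in\mathcal{X}^n$. An $(n,N,\lambda_1,\lambda_2)$-DI code for $W$ is a collection $\{(u_j,E_j):j\in[N]\}$ with $u_j\in\mathcal{X}^n$ and operators $0\le E_j\le\mathbb{1}$ on $B^{\otimes n}$ such that for all $j\ne k$: $\operatorname{Tr}W_{u_j}E_j\ge1-\lambda_1$ and $\operatorname{Tr}W_{u_j}E_k\le\lambda_2$. $N_{\rm DI}(n,\lambda_1,\lambda_2)$ is the largest $N$ for which such a code exists. The (pessimistic) slightly superlinear DI capacity is $\dot{C}_{\rm DI}(W)=\inf_{\lambda_1,\lambda_2>0}\liminf_{n\to\infty}\frac{1}{n\log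 n}\log N_{\rm DI}(n,\lambda_1,\lambda_2)$, logs base 2. For a set $F$ of operators on $B$, metrized by the Hilbert–Schmidt norm $\|X\|_2=\sqrt{\operatorname{Tr}X^*X}$, let $\Pi_\delta(F)$ be the maximal number of points of $F$ with pairwise distance at least $\delta$ (equivalently one may use minimal $\delta$-covering numbers); the lower and upper Minkowski dimensions are $\underline{d}_M(F)=\liminf_{\delta\to0}\frac{\log\Pi_\delta(F)}{-\log\delta}$ and $\overline{d}_M(F)=\limsup_{\delta\to0}\frac{\log\Pi_\delta(F)}{-\log\delta}$. *)

theory Defs
  imports "HOL-Analysis.Analysis" "HOL-Library.Liminf_Limsup"
          "Jordan_Normal_Form.Matrix" "Jordan_Normal_Form.Conjugate"
begin

definition mtrace :: "complex mat \<Rightarrow> complex" where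
  "mtrace A = (\<Sum>i<dim_row A. A $$ (i, i))"

definition adj :: "complex mat \<Rightarrow> complex mat" where
  "adj A = mat (dim_col A) (dim_row A) (\<lambda>(i, j). cnj (A $$ (j, i)))"

definition hermitian :: "complex mat \<Rightarrow> bool" where
  "hermitian A \<longleftrightarrow> square_mat A \<and> adj A = A"

definition psd :: "complex mat \<Rightarrow> bool" where
  "psd A \<longleftrightarrow> hermitian A \<and>
     (\<forall>v \<in> carrier_vec (dim_row A). Re (conjugate v \<bullet> (A *\<^sub>v v)) \<ge> 0)"

definition density :: "nat \<Rightarrow> complex mat set" where
  "density d = {\<rho>. \<rho> \<in> carrier_mat d d \<and> psd \<rho> \<and> mtrace \<rho> = 1}"

definition effect :: "nat \<Rightarrow> complex mat \<Rightarrow> bool" where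
  "effect D E \<longleftrightarrow> E \<in> carrier_mat D D \<and> psd E \<and> psd (1\<^sub>m D - E)"

definition msqrt :: "complex mat \<Rightarrow> complex mat" where
  "msqrt A = (THE B. B \<in> carrier_mat (dim_row A) (dim_row A) \<and> psd B \<and> B * B = A)"

definition kron :: "complex mat \<Rightarrow> complex mat \<Rightarrow> complex mat" where
  "kron A B = mat (dim_row A * dim_row B) (dim_col A * dim_col B)
     (\<lambda>(i, j). A $$ (i div dim_row B, j div dim_col B) * B $$ (i mod dim_row B, j mod dim_col B))"

fun tensor_word :: "('a \<Rightarrow> complex mat) \<Rightarrow> 'a list \<Rightarrow> complex mat" where
  "tensor_word W [] = 1\<^sub>m 1"
| "tensor_word W (x # xs) = kron (W x) (tensor_word W xs)"

definition is_DI_code ::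
  "'a set \<Rightarrow> nat \<Rightarrow> ('a \<Rightarrow> complex mat) \<Rightarrow> nat \<Rightarrow> nat \<Rightarrow> real \<Rightarrow> real
     \<Rightarrow> (nat \<Rightarrow> 'a list) \<Rightarrow> (nat \<Rightarrow> complex mat) \<Rightarrow> bool" where
  "is_DI_code X d W n N l1 l2 u E \<longleftrightarrow>
     (\<forall>j<N. set (u j) \<subseteq> X \<and> length (u j) = n \<and> effect (d ^ n) (E j)
            \<and> Re (mtrace (tensor_word W (u j) * E j)) \<ge> 1 - l1) \<and>
     (\<forall>j<N. \<forall>k<N. j \<noteq> k \<longrightarrow> Re (mtrace (tensor_word W (u j) * E k)) \<le> l2)"

definition N_DI ::
  "'a set \<Rightarrow> nat \<Rightarrow> ('a \<Rightarrow> complex mat) \<Rightarrow> nat \<Rightarrow> real \<Rightarrow> real \<Rightarrow> enat" where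
  "N_DI X d W n l1 l2 = Sup {enat N | N. \<exists>u E. is_DI_code X d W n N l1 l2 u E}"

definition DI_rate ::
  "'a set \<Rightarrow> nat \<Rightarrow> ('a \<Rightarrow> complex mat) \<Rightarrow> real \<Rightarrow> real \<Rightarrow> nat \<Rightarrow> ereal" where
  "DI_rate X d W l1 l2 n =
     (case N_DI X d W n l1 l2 of
        enat N \<Rightarrow> ereal (log 2 (real N) / (real n * log 2 (real n)))
      | \<infinity> \<Rightarrow> \<infinity>)"

definition C_DI_dot :: "'a set \<Rightarrow> nat \<Rightarrow> ('a \<Rightarrow> complex mat) \<Rightarrow> ereal" where
  "C_DI_dot X d W =
     (INF l1 \<in> {0<..}. INF l2 \<in> {0<..}. liminf (DI_rate X d W l1 l2))"

definition hs_norm :: "complex mat \<Rightarrow> real" where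
  "hs_norm A = sqrt (Re (mtrace (adj A * A)))"

definition packing_number :: "real \<Rightarrow> complex mat set \<Rightarrow> enat" where
  "packing_number \<delta> F = Sup {enat (card S) | S. finite S \<and> S \<subseteq> F \<and>
      (\<forall>x\<in>S. \<forall>y\<in>S. x \<noteq> y \<longrightarrow> hs_norm (x - y) \<ge> \<delta>)}"

definition lower_minkowski_dim :: "complex mat set \<Rightarrow> ereal" where
  "lower_minkowski_dim F =
     Liminf (at_right 0) (\<lambda>\<delta>. case packing_number \<delta> F of
        enat P \<Rightarrow> ereal (log 2 (real P) / (- log 2 \<delta>))
      | \<infinity> \<Rightarrow> \<infinity>)"

end

theory Submission
  imports Defs "Jordan_Normal_Form.Schur_Decomposition" "Jordan_Normal_Form.Spectral_Radius"
    "HOL-Real_Asymp.Real_Asymp"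
begin

text \<open>Upper bound: the square roots of two product states satisfy
  \<open>Tr S\<^sub>u S\<^sub>v = \<Prod>\<^sub>i (1 - h\<^sub>i\<^sup>2 / 2)\<close>, where \<open>h\<^sub>i\<close> is the Hilbert--Schmidt distance of the
  \<open>i\<close>-th letters, so two words that agree after quantising the alphabet at scale
  \<open>\<delta> = c / sqrt n\<close> have output states too close for any code. Hence
  \<open>N \<le> \<Pi>\<^sub>\<delta>\<^sup>n\<close>, and \<open>log n\<close> is about \<open>2 (- log \<delta>)\<close>.

  Lower bound: at scale \<open>\<delta> = n powr (- (1 - s) / 4)\<close>, take words over a \<open>\<delta>\<close>-packing with pairwise
  Hamming distance at least a small fraction of \<open>n\<close>, all with nearly the same output entropy. Test
  for a word with the projection onto those eigenvectors of its output state whose eigenvalue is not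
  atypically small. In the joint distribution of two eigenbases the false
  acceptance probability is at most \<open>exp (O (sqrt n)) Tr S\<^sub>u S\<^sub>v\<close>, and
  \<open>Tr S\<^sub>u S\<^sub>v \<le> exp (- \<Omega> (n \<delta>\<^sup>2))\<close> beats this since \<open>n \<delta>\<^sup>2\<close> is of larger order than \<open>sqrt n\<close>.\<close>

unbundle no inner_syntax
unbundle no vec_syntax

section \<open>The spectral theorem for Hermitian matrices\<close>

text \<open>The obstacle in the lower bound is that an infinite alphabet may have arbitrarily small
  eigenvalues. Chebyshev's inequality still applies, since the variance of \<open>ln\<close> of an
  eigenvalue drawn from a state is at most \<open>4 * d\<close> for every state; thresholds of order
  \<open>sqrt n\<close> suffice. This fluctuation scale is what puts the packing scale near the
  power -1/4 of \<open>n\<close>, against -1/2 in the upper bound, where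
  \<open>n * \<delta>\<^sup>2\<close> is only a small constant. Square roots of states are the right
  points to pack because they are unit vectors whose inner products multiply over tensor factors.

  The two limits are coupled in opposite directions. In the lower bound \<open>\<delta>\<close> is a
  function of \<open>n\<close>, so a property of all small \<open>\<delta>\<close> holds at all
  large \<open>n\<close>; in the upper bound \<open>n\<close> is the integer part of
  \<open>\<kappa> / \<delta>\<^sup>2\<close>, so every small real \<open>\<delta>\<close> is
  reached. The lower bound holds for each pair of positive errors and therefore survives the
  infimum; \<open>l1 + l2 < 1\<close> supplies the slack of the upper bound.\<close>

lemma adj_carrier [simp]: "A \<in> carrier_mat n m \<Longrightarrow> adj A \<in> carrier_mat m n"
  by (auto simp: adj_def)

lemma adj_dim [simp]: "dim_row (adj A) = dim_col A" "dim_col (adj A) = dim_row A"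
  by (auto simp: adj_def)

lemma adj_index [simp]: "i < dim_col A \<Longrightarrow> j < dim_row A \<Longrightarrow> adj A $$ (i, j) = cnj (A $$ (j, i))"
  by (auto simp: adj_def)

lemma adj_adj [simp]: "adj (adj A) = A"
  by (rule eq_matI) auto

lemma adj_mult:
  "dim_col A = dim_row B \<Longrightarrow> adj (A * B) = adj B * adj A"
  by (rule eq_matI) (auto simp: scalar_prod_def intro!: sum.cong)

lemma adj_minus:
  "dim_row A = dim_row B \<Longrightarrow> dim_col A = dim_col B \<Longrightarrow> adj (A - B) = adj A - adj B"
  by (rule eq_matI) auto

lemma adj_one [simp]: "adj (1\<^sub>m n) = 1\<^sub>m n"
  by (rule eq_matI) auto

lemma hermitian_iff: "A \<in> carrier_mat n n \<Longrightarrow> hermitian A \<longleftrightarrow> adj A = A"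
  by (auto simp: hermitian_def)

abbreviation rdiag :: "nat \<Rightarrow> (nat \<Rightarrow> real) \<Rightarrow> complex mat" where
  "rdiag n f \<equiv> mat_diag n (\<lambda>i. complex_of_real (f i))"

lemma mat_diag_dims [simp]: "dim_row (mat_diag n f) = n" "dim_col (mat_diag n f) = n"
  by (simp_all add: mat_diag_def)

lemma adj_rdiag [simp]: "adj (rdiag n f) = rdiag n f"
  by (rule eq_matI) (auto simp: mat_diag_def)

lemma mtrace_eq: "A \<in> carrier_mat n m \<Longrightarrow> mtrace A = (\<Sum>i<n. A $$ (i, i))"
  by (auto simp: mtrace_def)

lemma mtrace_mult:
  assumes "A \<in> carrier_mat n m" "B \<in> carrier_mat m n"
  shows "mtrace (A * B) = (\<Sum>i<n. \<Sum>k<m. A $$ (i, k) * B $$ (k, i))"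
  using assms by (auto simp: mtrace_def scalar_prod_def lessThan_atLeast0 intro!: sum.cong)

lemma mtrace_comm:
  assumes "A \<in> carrier_mat n m" "B \<in> carrier_mat m n"
  shows "mtrace (A * B) = mtrace (B * A)"
  unfolding mtrace_mult[OF assms] mtrace_mult[OF assms(2,1)]
  by (subst sum.swap) (simp add: mult.commute)

lemma mtrace_minus:
  "A \<in> carrier_mat n n \<Longrightarrow> B \<in> carrier_mat n n \<Longrightarrow> mtrace (A - B) = mtrace A - mtrace B"
  by (simp add: mtrace_def sum_subtractf)

lemma mtrace_one [simp]: "mtrace (1\<^sub>m n) = of_nat n"
  by (simp add: mtrace_def)

lemma mtrace_rdiag: "mtrace (rdiag n f) = of_real (\<Sum>i<n. f i)"
  by (simp add: mtrace_def mat_diag_def)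

lemma mtrace_adj_mult_self:
  assumes "A \<in> carrier_mat n m"
  shows "mtrace (adj A * A) = of_real (\<Sum>i<n. \<Sum>j<m. (cmod (A $$ (i, j)))\<^sup>2)"
proof -
  have "mtrace (adj A * A) = (\<Sum>j<m. \<Sum>i<n. adj A $$ (j, i) * A $$ (i, j))"
    by (rule mtrace_mult) (use assms in auto)
  also have "\<dots> = (\<Sum>j<m. \<Sum>i<n. of_real ((cmod (A $$ (i, j)))\<^sup>2))"
    using assms by (intro sum.cong refl) (simp add: complex_norm_square mult.commute del: of_real_power)
  finally show ?thesis by (subst sum.swap) simp
qed

lemma mtrace_adj_mult_self_eq_0:
  assumes A: "A \<in> carrier_mat n m" and "mtrace (adj A * A) = 0"
  shows "A = 0\<^sub>m n m"
proof -
  have "complex_of_real (\<Sum>i<n. \<Sum>j<m. (cmod (A $$ (i, j)))\<^sup>2) = 0"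
    using assms(2) mtrace_adj_mult_self[OF A] by (simp only:)
  then have "(\<Sum>i<n. \<Sum>j<m. (cmod (A $$ (i, j)))\<^sup>2) = 0"
    using of_real_eq_0_iff by blast
  then have "\<forall>i<n. \<forall>j<m. A $$ (i, j) = 0"
    by (simp add: sum_nonneg_eq_0_iff sum_nonneg)
  then show ?thesis
    using A by (intro eq_matI) auto
qed

section \<open>Eigenvectors of Hermitian matrices\<close>

text \<open>If all eigenvalues were zero, the Schur form \<open>B\<close> would be strictly upper
  triangular and \<open>B * B\<close> would have trace 0. By similarity
  \<open>A * A = adj A * A\<close> would have trace 0 too; but that trace is the sum of the squared
  moduli of the entries of \<open>A\<close>.\<close>

lemma hermitian_nonzero_eigenvalue:
  assumes A: "A \<in> carrier_mat n n" and herm: "adj A = A" and nz: "A \<noteq> 0\<^sub>m n n"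
  obtains e v where "e \<noteq> 0" "v \<in> carrier_vec n" "v \<noteq> 0\<^sub>v n" "A *\<^sub>v v = e \<cdot>\<^sub>v v"
proof -
  obtain es where es: "char_poly A = (\<Prod>a\<leftarrow>es. [:- a, 1:])" "length es = n"
    using char_poly_factorized[OF A] by auto
  obtain B P Q where BPQ: "schur_decomposition A es = (B, P, Q)"
    by (cases "schur_decomposition A es") auto
  have sim: "similar_mat_wit A B P Q" and ut: "upper_triangular B" and dg: "diag_mat B = es"
    using schur_decomposition[OF A es(1) BPQ] by auto
  note w = similar_mat_witD2[OF A sim]
  have "\<exists>e\<in>set es. e \<noteq> 0"
  proof (rule ccontr)
    assume "\<not> (\<exists>e\<in>set es. e \<noteq> 0)"
    then have z: "B $$ (i, j) = 0" if "i < n" "j \<le> i" for i j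
      using ut dg w(5) that by (cases "i = j") (auto simp: upper_triangular_def diag_mat_def)
    have "mtrace (B * B) = (\<Sum>i<n. \<Sum>k<n. B $$ (i, k) * B $$ (k, i))"
      by (rule mtrace_mult) (use w in auto)
    also have "\<dots> = 0"
    proof (intro sum.neutral ballI)
      fix i k assume "i \<in> {..<n}" "k \<in> {..<n}"
      then show "B $$ (i, k) * B $$ (k, i) = 0"
        by (cases "k \<le> i") (auto simp: z)
    qed
    finally have "mtrace (B * B) = 0" .
    have "A * A = P * B * Q * (P * B * Q)" using w(3) by simp
    also have "\<dots> = P * (B * (Q * P) * B * Q)"
      using w(4-7) by (simp add: assoc_mult_mat[where n\<^sub>1=n and n\<^sub>2=n and n\<^sub>3=n and n\<^sub>4=n])
    also have "\<dots> = P * (B * B * Q)" using w(2,5) by simp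
    finally have "mtrace (A * A) = mtrace (P * (B * B * Q))" by simp
    also have "\<dots> = mtrace (B * B * Q * P)"
      by (rule mtrace_comm) (use w in auto)
    also have "B * B * Q * P = B * B * (Q * P)"
      using w(4-7) by (simp add: assoc_mult_mat[where n\<^sub>1=n and n\<^sub>2=n and n\<^sub>3=n and n\<^sub>4=n])
    also have "\<dots> = B * B" using w by simp
    finally have "mtrace (adj A * A) = 0" using herm \<open>mtrace (B * B) = 0\<close> by simp
    then show False using mtrace_adj_mult_self_eq_0[OF A] nz by simp
  qed
  then obtain e where e: "e \<in> set es" "e \<noteq> 0" by auto
  have "poly (char_poly A) e = 0"
    unfolding es(1) using e(1) by (induction es) auto
  then have "eigenvalue A e" using eigenvalue_root_char_poly[OF A] by simp
  then obtain v where "v \<in> carrier_vec n" "v \<noteq> 0\<^sub>v n" "A *\<^sub>v v = e \<cdot>\<^sub>v v"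
    using A by (auto simp: eigenvalue_def eigenvector_def)
  with that e(2) show ?thesis by blast
qed

lemma unit_vec_normalize:
  assumes v: "v \<in> carrier_vec n" "v \<noteq> 0\<^sub>v n"
  obtains c :: complex where "(\<Sum>i<n. cnj ((c \<cdot>\<^sub>v v) $ i) * (c \<cdot>\<^sub>v v) $ i) = 1"
proof -
  define s where "s = (\<Sum>i<n. (cmod (v $ i))\<^sup>2)"
  have "s \<noteq> 0"
  proof
    assume "s = 0"
    then have "\<forall>i<n. v $ i = 0" by (simp add: s_def sum_nonneg_eq_0_iff)
    then have "v = 0\<^sub>v n" using v(1) by (intro eq_vecI) auto
    with v(2) show False by simp
  qed
  moreover have "s \<ge> 0" by (simp add: s_def sum_nonneg)
  ultimately have s: "s > 0" by simp
  let ?c = "complex_of_real (1 / sqrt s)"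
  have "(\<Sum>i<n. cnj ((?c \<cdot>\<^sub>v v) $ i) * (?c \<cdot>\<^sub>v v) $ i) = (\<Sum>i<n. of_real ((cmod (v $ i))\<^sup>2 / s))"
  proof (intro sum.cong refl)
    fix i assume "i \<in> {..<n}"
    then have "(?c \<cdot>\<^sub>v v) $ i = ?c * v $ i" using v by simp
    then have "cnj ((?c \<cdot>\<^sub>v v) $ i) * (?c \<cdot>\<^sub>v v) $ i = of_real ((cmod (?c * v $ i))\<^sup>2)"
      by (metis complex_norm_square mult.commute)
    also have "(cmod (?c * v $ i))\<^sup>2 = (cmod (v $ i))\<^sup>2 / s"
      using s by (simp add: norm_mult power_mult_distrib power_divide norm_divide)
    finally show "cnj ((?c \<cdot>\<^sub>v v) $ i) * (?c \<cdot>\<^sub>v v) $ i = of_real ((cmod (v $ i))\<^sup>2 / s)" .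
  qed
  also have "\<dots> = of_real (\<Sum>i<n. (cmod (v $ i))\<^sup>2 / s)" by simp
  also have "(\<Sum>i<n. (cmod (v $ i))\<^sup>2 / s) = 1"
    using s by (simp add: sum_divide_distrib[symmetric] s_def)
  finally show ?thesis using that by simp
qed

lemma adj_mult_self_index:
  assumes "U \<in> carrier_mat n k" "i < k" "j < k"
  shows "(adj U * U) $$ (i, j) = (\<Sum>r<n. cnj (U $$ (r, i)) * U $$ (r, j))"
  using assms by (auto simp: scalar_prod_def lessThan_atLeast0 intro!: sum.cong)

lemma mult_mat_vec_index:
  assumes "A \<in> carrier_mat n m" "v \<in> carrier_vec m" "i < n"
  shows "(A *\<^sub>v v) $ i = (\<Sum>r<m. A $$ (i, r) * v $ r)"
  using assms by (auto simp: scalar_prod_def lessThan_atLeast0 intro!: sum.cong)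

text \<open>The projection \<open>P\<close> onto the orthogonal complement of the columns of
  \<open>U\<close> commutes with \<open>A\<close>, so \<open>B = A * P\<close> is Hermitian. An
  eigenvector of \<open>B\<close> with nonzero eigenvalue lies in the range of \<open>P\<close> and
  is one of \<open>A\<close>; if \<open>B = 0\<close>, every nonzero column of \<open>P\<close> is
  an eigenvector of \<open>A\<close> for the eigenvalue 0.\<close>

lemma hermitian_eigenfamily_extend:
  assumes A: "A \<in> carrier_mat n n" and herm: "adj A = A"
    and U: "U \<in> carrier_mat n k" and ortho: "adj U * U = 1\<^sub>m k"
    and eig: "A * U = U * mat_diag k l" and k: "k < n"
  obtains e v where "v \<in> carrier_vec n" "v \<noteq> 0\<^sub>v n" "adj U *\<^sub>v v = 0\<^sub>v k" "A *\<^sub>v v = e \<cdot>\<^sub>v v"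
proof -
  define P where "P = 1\<^sub>m n - U * adj U"
  have aU: "adj U \<in> carrier_mat k n" using U by simp
  have UU: "U * adj U \<in> carrier_mat n n" using U aU by auto
  have P: "P \<in> carrier_mat n n" unfolding P_def by (rule minus_carrier_mat[OF UU])
  have adjP: "adj P = P"
    unfolding P_def by (subst adj_minus) (use U in \<open>auto simp: adj_mult\<close>)
  have "adj U * (U * adj U) = (adj U * U) * adj U"
    using U aU by (simp add: assoc_mult_mat[where n\<^sub>1=k and n\<^sub>2=n and n\<^sub>3=k and n\<^sub>4=n])
  also have "\<dots> = adj U" using ortho U by simp
  finally have UP: "adj U * P = 0\<^sub>m k n"
    unfolding P_def using aU UU by (subst mult_minus_distrib_mat[of _ k n _ n]) auto
  define D where "D = mat_diag k l"
  have D: "D \<in> carrier_mat k k" by (simp add: D_def)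
  \<comment> \<open>\<open>D\<close> is a compression of a Hermitian matrix, hence self-adjoint: the
    entries of \<open>l\<close> are real. So \<open>U * D * adj U\<close> is self-adjoint, and
    taking adjoints in \<open>AUU\<close> shows that \<open>U * adj U\<close> commutes with
    \<open>A\<close>.\<close>
  have "adj U * (A * U) = D"
    unfolding eig D_def[symmetric] using U aU D ortho
    by (simp add: assoc_mult_mat[symmetric, where n\<^sub>1=k and n\<^sub>2=n and n\<^sub>3=k and n\<^sub>4=k])
  moreover have "adj (adj U * (A * U)) = adj U * (A * U)"
    using A U aU herm by (simp add: adj_mult assoc_mult_mat[where n\<^sub>1=k and n\<^sub>2=n and n\<^sub>3=n and n\<^sub>4=k])
  ultimately have adjD: "adj D = D" by simp
  have AUU: "A * (U * adj U) = U * D * adj U"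
    using A U aU by (simp add: assoc_mult_mat[symmetric, where n\<^sub>1=n and n\<^sub>2=n and n\<^sub>3=k and n\<^sub>4=n] eig D_def)
  have "U * adj U * A = adj (A * (U * adj U))"
    using A U aU herm by (simp add: adj_mult)
  also have "\<dots> = U * D * adj U"
    unfolding AUU using U aU D by (simp add: adj_mult adjD assoc_mult_mat[where n\<^sub>1=n and n\<^sub>2=k and n\<^sub>3=k and n\<^sub>4=n])
  finally have comm: "U * adj U * A = A * (U * adj U)" using AUU by simp
  define B where "B = A * P"
  have B: "B \<in> carrier_mat n n" using A P by (simp add: B_def)
  have PA: "P * A = A * P"
    unfolding P_def using A UU comm
    by (simp add: minus_mult_distrib_mat[of _ n n _ _ n] mult_minus_distrib_mat[of _ n n _ n])
  have adjB: "adj B = B"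
    using A P by (simp add: B_def adj_mult herm adjP PA)
  have mult_vec: "adj U *\<^sub>v (P *\<^sub>v w) = 0\<^sub>v k" if "w \<in> carrier_vec n" for w
  proof -
    have "adj U *\<^sub>v (P *\<^sub>v w) = (adj U * P) *\<^sub>v w"
      by (rule assoc_mult_mat_vec[symmetric, OF aU P that])
    then show ?thesis using that unfolding UP by (auto intro!: eq_vecI simp: scalar_prod_def)
  qed
  show ?thesis
  proof (cases "B = 0\<^sub>m n n")
    case False
    then obtain e v where ev: "e \<noteq> 0" "v \<in> carrier_vec n" "v \<noteq> 0\<^sub>v n" "B *\<^sub>v v = e \<cdot>\<^sub>v v"
      using hermitian_nonzero_eigenvalue[OF B adjB] by metis
    have "v = (1 / e) \<cdot>\<^sub>v (e \<cdot>\<^sub>v v)" using ev by (simp add: smult_smult_assoc)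
    also have "\<dots> = (1 / e) \<cdot>\<^sub>v (P *\<^sub>v (A *\<^sub>v v))"
      using ev(2,4) A P by (simp add: B_def PA[symmetric] assoc_mult_mat_vec[of _ n n _ n])
    also have "\<dots> = P *\<^sub>v ((1 / e) \<cdot>\<^sub>v (A *\<^sub>v v))"
      using A P ev(2) by (simp add: mult_mat_vec[of _ n n])
    finally have vP: "v = P *\<^sub>v ((1 / e) \<cdot>\<^sub>v (A *\<^sub>v v))" .
    have Uv: "adj U *\<^sub>v v = 0\<^sub>v k"
      by (subst vP, rule mult_vec) (use A ev(2) in auto)
    have "P *\<^sub>v v = v - U *\<^sub>v (adj U *\<^sub>v v)"
      unfolding P_def using U aU UU ev(2)
      by (simp add: minus_mult_distrib_mat_vec[of _ n n] assoc_mult_mat_vec[of _ n k _ n])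
    also have "\<dots> = v" using Uv ev(2) U by (auto intro!: eq_vecI simp: scalar_prod_def)
    finally have Pv: "P *\<^sub>v v = v" .
    have "A *\<^sub>v v = A *\<^sub>v (P *\<^sub>v v)" by (simp add: Pv)
    also have "\<dots> = e \<cdot>\<^sub>v v"
      using ev(2,4) A P by (simp add: B_def assoc_mult_mat_vec[of _ n n _ n])
    finally show ?thesis using that ev Uv by blast
  next
    case True
    \<comment> \<open>The trace of \<open>P\<close> is \<open>n - k > 0\<close>, which provides a
      nonzero diagonal entry and with it a nonzero column.\<close>
    have "mtrace P = of_nat n - mtrace (U * adj U)"
      unfolding P_def using UU by (simp add: mtrace_minus[of _ n])
    also have "mtrace (U * adj U) = of_nat k"
      using mtrace_comm[OF U aU] ortho by simp
    finally have "mtrace P \<noteq> 0" using k by simp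
    then obtain j where j: "j < n" "P $$ (j, j) \<noteq> 0"
      using P by (auto simp: mtrace_def dest: sum.not_neutral_contains_not_neutral)
    define v where "v = P *\<^sub>v unit_vec n j"
    have v: "v \<in> carrier_vec n" using P by (simp add: v_def)
    have "v $ j = P $$ (j, j)" using P j by (simp add: v_def)
    then have "v \<noteq> 0\<^sub>v n" using j by auto
    moreover have "adj U *\<^sub>v v = 0\<^sub>v k" unfolding v_def by (rule mult_vec) simp
    moreover have "A *\<^sub>v v = B *\<^sub>v unit_vec n j"
      unfolding v_def B_def using A P by (simp add: assoc_mult_mat_vec[of _ n n _ n])
    moreover have "B *\<^sub>v unit_vec n j = 0 \<cdot>\<^sub>v v"
      using True v by (auto intro!: eq_vecI)
    ultimately show ?thesis using that v by metis
  qed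
qed

text \<open>Orthonormal eigenvectors are collected one column at a time inside the fixed space, so
  that no compression of \<open>A\<close> to a smaller space has to be formed.\<close>

lemma hermitian_eigenfamily:
  assumes A: "A \<in> carrier_mat n n" and herm: "adj A = A" and "k \<le> n"
  shows "\<exists>U l. U \<in> carrier_mat n k \<and> adj U * U = 1\<^sub>m k \<and> A * U = U * mat_diag k l"
  using \<open>k \<le> n\<close>
proof (induction k)
  case 0
  show ?case
    by (rule exI[of _ "0\<^sub>m n 0"], rule exI[of _ "\<lambda>_. 0"]) (use A in \<open>auto intro!: eq_matI\<close>)
next
  case (Suc k)
  then obtain U l where U: "U \<in> carrier_mat n k" and ortho: "adj U * U = 1\<^sub>m k"
    and eig: "A * U = U * mat_diag k l" by auto
  have "k < n" using Suc.prems by simp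
  from hermitian_eigenfamily_extend[OF A herm U ortho eig this]
  obtain e v where ev: "v \<in> carrier_vec n" "v \<noteq> 0\<^sub>v n" "adj U *\<^sub>v v = 0\<^sub>v k" "A *\<^sub>v v = e \<cdot>\<^sub>v v"
    by metis
  obtain c where c: "(\<Sum>i<n. cnj ((c \<cdot>\<^sub>v v) $ i) * (c \<cdot>\<^sub>v v) $ i) = 1"
    using unit_vec_normalize[OF ev(1,2)] by metis
  define w where "w = c \<cdot>\<^sub>v v"
  have w: "w \<in> carrier_vec n" using ev by (simp add: w_def)
  have wn: "(\<Sum>i<n. cnj (w $ i) * w $ i) = 1" using c by (simp add: w_def)
  have "adj U *\<^sub>v w = 0\<^sub>v k"
    unfolding w_def using ev U by (auto simp: mult_mat_vec[of _ k n] intro!: eq_vecI)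
  then have Uw: "(\<Sum>r<n. cnj (U $$ (r, i)) * w $ r) = 0" if "i < k" for i
    using mult_mat_vec_index[of "adj U" k n w i] U w that by simp
  have wU: "(\<Sum>r<n. cnj (w $ r) * U $$ (r, i)) = 0" if "i < k" for i
    using arg_cong[OF Uw[OF that], of cnj] by (simp add: mult.commute)
  have "A *\<^sub>v w = e \<cdot>\<^sub>v w"
    unfolding w_def using ev A by (simp add: mult_mat_vec[of _ n n] smult_smult_assoc mult.commute)
  then have Aw: "(\<Sum>r<n. A $$ (i, r) * w $ r) = e * w $ i" if "i < n" for i
    using mult_mat_vec_index[OF A w that] that w by simp
  define U' where "U' = Matrix.mat n (Suc k) (\<lambda>(i, j). if j < k then U $$ (i, j) else w $ i)"
  define l' where "l' = l(k := e)"
  have U': "U' \<in> carrier_mat n (Suc k)" by (simp add: U'_def)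
  have o: "adj U' * U' = 1\<^sub>m (Suc k)"
  proof (rule eq_matI)
    fix i j assume "i < dim_row (1\<^sub>m (Suc k))" "j < dim_col (1\<^sub>m (Suc k))"
    then have ij: "i < Suc k" "j < Suc k" by auto
    have "(adj U' * U') $$ (i, j) = (\<Sum>r<n. cnj (U' $$ (r, i)) * U' $$ (r, j))"
      by (rule adj_mult_self_index[OF U' ij])
    also have "\<dots> = (\<Sum>r<n. cnj (if i < k then U $$ (r, i) else w $ r) * (if j < k then U $$ (r, j) else w $ r))"
      using ij by (intro sum.cong refl) (simp add: U'_def)
    also have "\<dots> = 1\<^sub>m (Suc k) $$ (i, j)"
      using ij Uw[of i] wU[of j] wn adj_mult_self_index[OF U, of i j] ortho
      by (cases "i < k"; cases "j < k") auto
    finally show "(adj U' * U') $$ (i, j) = 1\<^sub>m (Suc k) $$ (i, j)" .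
  qed (use U' in auto)
  have "A * U' = U' * mat_diag (Suc k) l'"
  proof (rule eq_matI)
    fix i j assume "i < dim_row (U' * mat_diag (Suc k) l')" "j < dim_col (U' * mat_diag (Suc k) l')"
    then have ij: "i < n" "j < Suc k" using U' by auto
    have "(A * U') $$ (i, j) = (\<Sum>r<n. A $$ (i, r) * U' $$ (r, j))"
      using A U' ij by (auto simp: scalar_prod_def lessThan_atLeast0 intro!: sum.cong)
    also have "\<dots> = (\<Sum>r<n. A $$ (i, r) * (if j < k then U $$ (r, j) else w $ r))"
      using ij by (intro sum.cong refl) (simp add: U'_def)
    also have "\<dots> = (if j < k then (A * U) $$ (i, j) else e * w $ i)"
      using A U ij Aw by (auto simp: scalar_prod_def lessThan_atLeast0 intro!: sum.cong)
    also have "\<dots> = (if j < k then U $$ (i, j) * l j else e * w $ i)"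
      using ij U unfolding eig by (simp add: mat_diag_mult_right[OF U])
    also have "\<dots> = (U' * mat_diag (Suc k) l') $$ (i, j)"
      unfolding mat_diag_mult_right[OF U'] using ij by (auto simp: U'_def l'_def)
    finally show "(A * U') $$ (i, j) = (U' * mat_diag (Suc k) l') $$ (i, j)" .
  qed (use A U' in auto)
  with U' o show ?case by blast
qed

definition unitary_mat :: "nat \<Rightarrow> complex mat \<Rightarrow> bool" where
  "unitary_mat n U \<longleftrightarrow> U \<in> carrier_mat n n \<and> adj U * U = 1\<^sub>m n \<and> U * adj U = 1\<^sub>m n"

text \<open>For unitary \<open>U\<close> this is the Hermitian matrix whose eigenbasis is the
  columns of \<open>U\<close> and whose eigenvalue list is \<open>f\<close>. With \<open>f\<close>
  explicit, products, square roots and spectral projections in one basis become pointwise operations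
  on \<open>f\<close>.\<close>

definition conj_diag :: "nat \<Rightarrow> complex mat \<Rightarrow> (nat \<Rightarrow> real) \<Rightarrow> complex mat" where
  "conj_diag n U f = U * (rdiag n f * adj U)"

lemma hermitian_spectral:
  assumes A: "A \<in> carrier_mat n n" and herm: "adj A = A"
  obtains U f where "unitary_mat n U" "A = conj_diag n U f"
proof -
  obtain U l where U: "U \<in> carrier_mat n n" and ortho: "adj U * U = 1\<^sub>m n"
    and eig: "A * U = U * mat_diag n l"
    using hermitian_eigenfamily[OF A herm, of n] by auto
  have aU: "adj U \<in> carrier_mat n n" using U by simp
  have UU: "U * adj U = 1\<^sub>m n" by (rule mat_mult_left_right_inverse[OF aU U ortho])
  have D: "mat_diag n l = adj U * (A * U)"
    unfolding eig using U aU ortho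
    by (simp add: assoc_mult_mat[symmetric, where n\<^sub>1=n and n\<^sub>2=n and n\<^sub>3=n and n\<^sub>4=n])
  have "adj (mat_diag n l) = mat_diag n l"
    unfolding D using A U aU herm
    by (simp add: adj_mult assoc_mult_mat[where n\<^sub>1=n and n\<^sub>2=n and n\<^sub>3=n and n\<^sub>4=n])
  then have cl: "cnj (l i) = l i" if "i < n" for i
    using that adj_index[of i "mat_diag n l" i] by (simp add: mat_diag_def)
  have "l i = complex_of_real (Re (l i))" if "i < n" for i
    using cl[OF that] by (simp add: complex_eq_iff)
  then have "mat_diag n l = rdiag n (\<lambda>i. Re (l i))"
    by (intro eq_matI) (auto simp: mat_diag_def)
  moreover have "A = U * (mat_diag n l * adj U)"
  proof -
    have "U * (mat_diag n l * adj U) = (A * U) * adj U"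
      unfolding eig using U aU by (simp add: assoc_mult_mat[where n\<^sub>1=n and n\<^sub>2=n and n\<^sub>3=n and n\<^sub>4=n])
    also have "\<dots> = A * (U * adj U)" using A U aU by (simp add: assoc_mult_mat[where n\<^sub>1=n and n\<^sub>2=n and n\<^sub>3=n and n\<^sub>4=n])
    also have "\<dots> = A" using UU A by simp
    finally show ?thesis by simp
  qed
  ultimately show ?thesis
    using that[of U "\<lambda>i. Re (l i)"] U ortho UU by (simp add: unitary_mat_def conj_diag_def)
qed

section \<open>Matrices diagonal in a unitary basis, and square roots\<close>

lemma scalar_prod_sum: "dim_vec w = n \<Longrightarrow> v \<bullet> w = (\<Sum>i<n. v $ i * w $ i)"
  by (simp add: scalar_prod_def lessThan_atLeast0)

lemma mat_assoc:
  fixes A B C :: "complex mat"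
  shows "dim_col A = dim_row B \<Longrightarrow> dim_col B = dim_row C \<Longrightarrow> A * B * C = A * (B * C)"
  by (rule assoc_mult_mat[of _ "dim_row A" "dim_col A" _ "dim_col B" _ "dim_col C"]) auto

lemma one_mult_mat:
  fixes A :: "complex mat"
  shows "dim_row A = n \<Longrightarrow> 1\<^sub>m n * A = A" "dim_col A = n \<Longrightarrow> A * 1\<^sub>m n = A"
  by (auto intro: left_mult_one_mat right_mult_one_mat)

lemma unitary_matD:
  assumes "unitary_mat n U"
  shows "U \<in> carrier_mat n n" "adj U * U = 1\<^sub>m n" "U * adj U = 1\<^sub>m n" "dim_row U = n" "dim_col U = n"
  using assms by (auto simp: unitary_mat_def)

lemma unitary_cancel:
  assumes "unitary_mat n U" "dim_row X = n"
  shows "adj U * (U * X) = X" "U * (adj U * X) = X"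
  using assms unitary_matD[OF assms(1)] by (simp_all add: mat_assoc[symmetric] one_mult_mat)

lemma conj_diag_dims [simp]:
  "dim_row (conj_diag n U f) = dim_row U" "dim_col (conj_diag n U f) = dim_row U"
  by (auto simp: conj_diag_def)

lemma conj_diag_carrier [simp]: "U \<in> carrier_mat n n \<Longrightarrow> conj_diag n U f \<in> carrier_mat n n"
  by (auto intro!: carrier_matI)

lemma conj_diag_mult:
  assumes "unitary_mat n U"
  shows "conj_diag n U f * conj_diag n U g = conj_diag n U (\<lambda>i. f i * g i)"
proof -
  note u = unitary_matD[OF assms]
  have "conj_diag n U f * conj_diag n U g = U * ((rdiag n f * rdiag n g) * adj U)"
    unfolding conj_diag_def using u by (simp add: mat_assoc unitary_cancel[OF assms] del: mat_diag_diag)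
  also have "\<dots> = conj_diag n U (\<lambda>i. f i * g i)" by (simp add: conj_diag_def)
  finally show ?thesis .
qed

lemma adj_conj_diag [simp]: "U \<in> carrier_mat n n \<Longrightarrow> adj (conj_diag n U f) = conj_diag n U f"
  by (auto simp: conj_diag_def adj_mult mat_assoc)

lemma conj_diag_one: "unitary_mat n U \<Longrightarrow> conj_diag n U (\<lambda>_. 1) = 1\<^sub>m n"
  using unitary_matD[of n U] by (simp add: conj_diag_def one_mult_mat)

lemma conj_diag_index:
  assumes U: "U \<in> carrier_mat n n" and "i < n" "j < n"
  shows "conj_diag n U f $$ (i, j) = (\<Sum>k<n. U $$ (i, k) * of_real (f k) * cnj (U $$ (j, k)))"
proof -
  have aU: "adj U \<in> carrier_mat n n" using U by simp
  show ?thesis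
    unfolding conj_diag_def mat_diag_mult_left[OF aU] using assms
    by (auto simp: scalar_prod_def lessThan_atLeast0 mult.assoc intro!: sum.cong)
qed

lemma conj_diag_minus:
  assumes U: "U \<in> carrier_mat n n"
  shows "conj_diag n U f - conj_diag n U g = conj_diag n U (\<lambda>i. f i - g i)"
proof (rule eq_matI)
  fix i j assume "i < dim_row (conj_diag n U (\<lambda>i. f i - g i))" "j < dim_col (conj_diag n U (\<lambda>i. f i - g i))"
  then have ij: "i < n" "j < n" using U by (auto simp: conj_diag_def)
  then show "(conj_diag n U f - conj_diag n U g) $$ (i, j) = conj_diag n U (\<lambda>i. f i - g i) $$ (i, j)"
    using U by (simp add: conj_diag_index[OF U] sum_subtractf[symmetric] algebra_simps)
qed (use U in \<open>auto simp: conj_diag_def\<close>)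

text \<open>The inner sum is the coordinate of \<open>v\<close> along column \<open>k\<close> of
  \<open>U\<close>, and the form is diagonal in these coordinates. Positivity can then be read off
  from \<open>f\<close>.\<close>

lemma conj_diag_form:
  assumes U: "U \<in> carrier_mat n n" and v: "v \<in> carrier_vec n"
  shows "conjugate v \<bullet> (conj_diag n U f *\<^sub>v v)
    = of_real (\<Sum>k<n. f k * (cmod (\<Sum>i<n. cnj (U $$ (i, k)) * v $ i))\<^sup>2)"
proof -
  have C: "conj_diag n U f \<in> carrier_mat n n" using U by simp
  have "conjugate v \<bullet> (conj_diag n U f *\<^sub>v v) = (\<Sum>i<n. cnj (v $ i) * (\<Sum>j<n. conj_diag n U f $$ (i, j) * v $ j))"
    using v U by (subst scalar_prod_sum[of _ n]) (auto simp: mult_mat_vec_index[OF C v] simp del: index_mult_mat_vec)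
  also have "\<dots> = (\<Sum>i<n. \<Sum>j<n. \<Sum>k<n. of_real (f k) * (cnj (cnj (U $$ (i, k)) * v $ i) * (cnj (U $$ (j, k)) * v $ j)))"
  proof (intro sum.cong refl)
    fix i assume "i \<in> {..<n}"
    then have "(\<Sum>j<n. conj_diag n U f $$ (i, j) * v $ j)
        = (\<Sum>j<n. \<Sum>k<n. U $$ (i, k) * of_real (f k) * cnj (U $$ (j, k)) * v $ j)"
      by (intro sum.cong refl) (simp add: conj_diag_index[OF U] sum_distrib_right)
    then show "cnj (v $ i) * (\<Sum>j<n. conj_diag n U f $$ (i, j) * v $ j)
        = (\<Sum>j<n. \<Sum>k<n. of_real (f k) * (cnj (cnj (U $$ (i, k)) * v $ i) * (cnj (U $$ (j, k)) * v $ j)))"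
      by (simp add: sum_distrib_left) (intro sum.cong refl, simp add: mult_ac)
  qed
  also have "\<dots> = (\<Sum>i<n. \<Sum>k<n. \<Sum>j<n. of_real (f k) * (cnj (cnj (U $$ (i, k)) * v $ i) * (cnj (U $$ (j, k)) * v $ j)))"
    by (intro sum.cong refl sum.swap)
  also have "\<dots> = (\<Sum>k<n. \<Sum>i<n. \<Sum>j<n. of_real (f k) * (cnj (cnj (U $$ (i, k)) * v $ i) * (cnj (U $$ (j, k)) * v $ j)))"
    by (rule sum.swap)
  also have "\<dots> = (\<Sum>k<n. of_real (f k) * (cnj (\<Sum>i<n. cnj (U $$ (i, k)) * v $ i) * (\<Sum>j<n. cnj (U $$ (j, k)) * v $ j)))"
    unfolding cnj_sum sum_product by (simp only: sum_distrib_left)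
  also have "\<dots> = (\<Sum>k<n. of_real (f k * (cmod (\<Sum>i<n. cnj (U $$ (i, k)) * v $ i))\<^sup>2))"
    by (intro sum.cong refl) (simp add: complex_norm_square mult.commute del: of_real_power)
  finally show ?thesis by simp
qed

lemma psd_conj_diag:
  assumes U: "U \<in> carrier_mat n n" and f: "\<And>i. i < n \<Longrightarrow> f i \<ge> 0"
  shows "psd (conj_diag n U f)"
proof -
  have C: "conj_diag n U f \<in> carrier_mat n n" using U by simp
  then show ?thesis
    using U f unfolding psd_def
    by (auto simp: hermitian_iff[OF C] conj_diag_form intro!: sum_nonneg)
qed

text \<open>Evaluating the quadratic form at column \<open>k\<close> of the eigenbasis returns
  \<open>f k\<close>, which positivity makes nonnegative.\<close>

lemma psd_spectral:
  assumes A: "A \<in> carrier_mat n n" and psd: "psd A"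
  obtains U f where "unitary_mat n U" "A = conj_diag n U f" "\<And>i. i < n \<Longrightarrow> f i \<ge> 0"
proof -
  have "adj A = A" using psd A by (auto simp: psd_def hermitian_def)
  then obtain U f where U: "unitary_mat n U" and Af: "A = conj_diag n U f"
    using hermitian_spectral[OF A] by metis
  note u = unitary_matD[OF U]
  have "f k \<ge> 0" if k: "k < n" for k
  proof -
    have "(\<Sum>i<n. cnj (U $$ (i, j)) * col U k $ i) = (if j = k then 1 else 0)" if "j < n" for j
      using adj_mult_self_index[OF u(1), of j k] u k that by simp
    then have "conjugate (col U k) \<bullet> (A *\<^sub>v col U k) = of_real (\<Sum>j<n. f j * (cmod (if j = k then 1 else 0))\<^sup>2)"
      unfolding Af by (subst conj_diag_form[OF u(1)]) (use u in \<open>auto intro!: sum.cong\<close>)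
    also have "\<dots> = of_real (\<Sum>j<n. if j = k then f j else 0)"
      by (intro arg_cong[where f=of_real] sum.cong) auto
    also have "\<dots> = of_real (f k)" using k by simp
    finally have "Re (conjugate (col U k) \<bullet> (A *\<^sub>v col U k)) = f k" by simp
    moreover have "col U k \<in> carrier_vec (dim_row A)" using A u by auto
    ultimately show ?thesis using psd by (auto simp: psd_def)
  qed
  then show ?thesis using that U Af by blast
qed

text \<open>If \<open>C = V diag(c) V\<^sup>*\<close> and \<open>B = U diag(b) U\<^sup>*\<close> have the same square, then
  \<open>c\<^sub>i\<^sup>2 M\<^sub>i\<^sub>j = M\<^sub>i\<^sub>j b\<^sub>j\<^sup>2\<close> for \<open>M = V\<^sup>* U\<close>; nonnegativity removes the squares.\<close>

lemma psd_sqrt_unique: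
  assumes B: "B \<in> carrier_mat n n" "psd B" and C: "C \<in> carrier_mat n n" "psd C" and eq: "B * B = C * C"
  shows "B = C"
proof -
  obtain U b where U: "unitary_mat n U" and Bb: "B = conj_diag n U b" and b: "\<And>i. i < n \<Longrightarrow> b i \<ge> 0"
    using psd_spectral[OF B] by metis
  obtain V c where V: "unitary_mat n V" and Cc: "C = conj_diag n V c" and c: "\<And>i. i < n \<Longrightarrow> c i \<ge> 0"
    using psd_spectral[OF C] by metis
  note u = unitary_matD[OF U] and v = unitary_matD[OF V]
  define M where "M = adj V * U"
  have M: "M \<in> carrier_mat n n" using u v by (auto simp: M_def)
  have sandwichU: "adj V * (conj_diag n U f * U) = M * rdiag n f" for f
    unfolding conj_diag_def M_def using u v by (simp add: mat_assoc one_mult_mat)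
  have sandwichV: "adj V * (conj_diag n V f * U) = rdiag n f * M" for f
    unfolding conj_diag_def M_def using u v by (simp add: mat_assoc unitary_cancel[OF V])
  have "M * rdiag n (\<lambda>i. b i * b i) = rdiag n (\<lambda>i. c i * c i) * M"
    unfolding sandwichU[symmetric] sandwichV[symmetric] conj_diag_mult[OF U, symmetric] conj_diag_mult[OF V, symmetric]
    using eq by (simp add: Bb Cc)
  then have eqs: "(M * rdiag n (\<lambda>i. b i * b i)) $$ (i, j) = (rdiag n (\<lambda>i. c i * c i) * M) $$ (i, j)" for i j
    by simp
  have sq: "M $$ (i, j) * of_real (b j * b j) = of_real (c i * c i) * M $$ (i, j)" if "i < n" "j < n" for i j
    using eqs[of i j] that unfolding mat_diag_mult_left[OF M] mat_diag_mult_right[OF M] by simp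
  have "M $$ (i, j) * of_real (b j) = of_real (c i) * M $$ (i, j)" if ij: "i < n" "j < n" for i j
  proof (cases "M $$ (i, j) = 0")
    case False
    then have "complex_of_real (b j * b j) = of_real (c i * c i)"
      using sq[OF ij] by simp
    then have "b j * b j = c i * c i" by (simp only: of_real_eq_iff)
    then have "b j = c i" using power2_eq_iff_nonneg[OF b[OF ij(2)] c[OF ij(1)]]
      by (simp add: power2_eq_square)
    then show ?thesis by simp
  qed simp
  then have "M * rdiag n b = rdiag n c * M"
    unfolding mat_diag_mult_left[OF M] mat_diag_mult_right[OF M] by (intro eq_matI) auto
  then have "adj V * (B * U) = adj V * (C * U)"
    unfolding Bb Cc sandwichU sandwichV .
  then have "V * (adj V * (B * U)) * adj U = V * (adj V * (C * U)) * adj U" by simp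
  moreover have "V * (adj V * (X * U)) * adj U = X" if "X \<in> carrier_mat n n" for X
    using u v that by (simp add: mat_assoc one_mult_mat unitary_cancel[OF V])
  ultimately show ?thesis using B C by simp
qed

text \<open>\<open>msqrt\<close> is a definite description, so uniqueness of the positive root is
  what gives it a value; from here on, exhibiting one positive root identifies it.\<close>

lemma msqrt_eqI:
  assumes "B \<in> carrier_mat n n" "psd B" "B * B = A"
  shows "msqrt A = B"
proof -
  have n: "dim_row A = n" using assms(1,3) by auto
  show ?thesis
    unfolding msqrt_def n
  proof (rule the_equality)
    show "B \<in> carrier_mat n n \<and> psd B \<and> B * B = A" using assms by simp
    fix C assume "C \<in> carrier_mat n n \<and> psd C \<and> C * C = A"
    then show "C = B" by (intro psd_sqrt_unique[of C n B]) (simp_all add: assms)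
  qed
qed

lemma msqrt_conj_diag:
  assumes U: "unitary_mat n U" and f: "\<And>i. i < n \<Longrightarrow> f i \<ge> 0"
  shows "msqrt (conj_diag n U f) = conj_diag n U (\<lambda>i. sqrt (f i))"
proof (rule msqrt_eqI)
  note u = unitary_matD[OF U]
  show "conj_diag n U (\<lambda>i. sqrt (f i)) \<in> carrier_mat n n" using u by simp
  show "psd (conj_diag n U (\<lambda>i. sqrt (f i)))" using u f by (intro psd_conj_diag) auto
  have "rdiag n (\<lambda>i. sqrt (f i) * sqrt (f i)) = rdiag n f"
    using f by (intro eq_matI) (auto simp: mat_diag_def simp flip: of_real_mult)
  then show "conj_diag n U (\<lambda>i. sqrt (f i)) * conj_diag n U (\<lambda>i. sqrt (f i)) = conj_diag n U f"
    unfolding conj_diag_mult[OF U] by (simp add: conj_diag_def)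
qed

lemma mtrace_conj_diag:
  assumes "unitary_mat n U"
  shows "mtrace (conj_diag n U f) = of_real (\<Sum>i<n. f i)"
proof -
  note u = unitary_matD[OF assms]
  have "mtrace (conj_diag n U f) = mtrace (rdiag n f * adj U * U)"
    unfolding conj_diag_def by (rule mtrace_comm[of _ n n]) (use u in auto)
  also have "rdiag n f * adj U * U = rdiag n f"
    using u by (simp add: mat_assoc one_mult_mat)
  finally show ?thesis by (simp add: mtrace_rdiag)
qed

lemma density_spectral:
  assumes "\<rho> \<in> density d"
  obtains U p where "unitary_mat d U" "\<rho> = conj_diag d U p" "\<And>i. i < d \<Longrightarrow> p i \<ge> 0" "(\<Sum>i<d. p i) = 1"
proof -
  have "\<rho> \<in> carrier_mat d d" "psd \<rho>" "mtrace \<rho> = 1" using assms by (auto simp: density_def)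
  then obtain U p where U: "unitary_mat d U" and p: "\<rho> = conj_diag d U p" "\<And>i. i < d \<Longrightarrow> p i \<ge> 0"
    using psd_spectral by metis
  have "complex_of_real (\<Sum>i<d. p i) = 1"
    using mtrace_conj_diag[OF U, of p] p \<open>mtrace \<rho> = 1\<close> by simp
  then have "(\<Sum>i<d. p i) = 1" using of_real_eq_1_iff by blast
  then show ?thesis using that U p by blast
qed

lemma msqrt_density:
  assumes "\<rho> \<in> density d"
  shows "msqrt \<rho> \<in> carrier_mat d d" "adj (msqrt \<rho>) = msqrt \<rho>" "msqrt \<rho> * msqrt \<rho> = \<rho>"
proof -
  obtain U p where U: "unitary_mat d U" and p: "\<rho> = conj_diag d U p" "\<And>i. i < d \<Longrightarrow> p i \<ge> 0"
    using density_spectral[OF assms] by metis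
  have m: "msqrt \<rho> = conj_diag d U (\<lambda>i. sqrt (p i))" unfolding p(1) by (rule msqrt_conj_diag[OF U p(2)])
  note u = unitary_matD[OF U]
  show "msqrt \<rho> \<in> carrier_mat d d" "adj (msqrt \<rho>) = msqrt \<rho>" using u by (auto simp: m)
  have "rdiag d (\<lambda>i. sqrt (p i) * sqrt (p i)) = rdiag d p"
    using p by (intro eq_matI) (auto simp: mat_diag_def simp flip: of_real_mult)
  then show "msqrt \<rho> * msqrt \<rho> = \<rho>"
    unfolding m conj_diag_mult[OF U] by (simp add: conj_diag_def p(1))
qed

text \<open>The overlaps \<open>|\<langle>a|b\<rangle>|\<^sup>2\<close> of the two eigenbases turn quantum traces into sums over pairs of
  eigenvalues (the Nussbaum--Szkola distributions).\<close>

lemma mtrace_conj_diag_mult: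
  assumes U: "unitary_mat n U" and V: "unitary_mat n V"
  shows "mtrace (conj_diag n U f * conj_diag n V g)
    = of_real (\<Sum>a<n. \<Sum>b<n. f a * g b * (cmod ((adj U * V) $$ (a, b)))\<^sup>2)"
proof -
  note u = unitary_matD[OF U] and v = unitary_matD[OF V]
  define M where "M = adj U * V"
  have M: "M \<in> carrier_mat n n" using u v by (auto simp: M_def)
  have aM: "adj M = adj V * U" using u v by (simp add: M_def adj_mult)
  have "conj_diag n U f * conj_diag n V g = U * (rdiag n f * (M * (rdiag n g * adj V)))"
    unfolding conj_diag_def M_def using u v by (simp add: mat_assoc)
  also have "mtrace \<dots> = mtrace (rdiag n f * (M * (rdiag n g * adj V)) * U)"
    by (rule mtrace_comm[of _ n n]) (use u v M in \<open>auto intro!: carrier_matI\<close>)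
  also have "rdiag n f * (M * (rdiag n g * adj V)) * U = (rdiag n f * M) * (rdiag n g * adj M)"
    unfolding aM unfolding M_def using u v by (simp add: mat_assoc)
  also have "mtrace \<dots> = (\<Sum>a<n. \<Sum>b<n. (rdiag n f * M) $$ (a, b) * (rdiag n g * adj M) $$ (b, a))"
    by (rule mtrace_mult) (use M in auto)
  also have "\<dots> = (\<Sum>a<n. \<Sum>b<n. of_real (f a * g b * (cmod (M $$ (a, b)))\<^sup>2))"
  proof (intro sum.cong refl)
    fix a b assume "a \<in> {..<n}" "b \<in> {..<n}"
    then have "(rdiag n f * M) $$ (a, b) = of_real (f a) * M $$ (a, b)"
      "(rdiag n g * adj M) $$ (b, a) = of_real (g b) * cnj (M $$ (a, b))"
      using M by (auto simp: mat_diag_mult_left[OF M] mat_diag_mult_left[OF adj_carrier[OF M]])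
    moreover have "(of_real (f a) * M $$ (a, b)) * (of_real (g b) * cnj (M $$ (a, b)))
        = of_real (f a) * of_real (g b) * (M $$ (a, b) * cnj (M $$ (a, b)))"
      by (simp only: mult_ac)
    ultimately show "(rdiag n f * M) $$ (a, b) * (rdiag n g * adj M) $$ (b, a) = of_real (f a * g b * (cmod (M $$ (a, b)))\<^sup>2)"
      by (simp only: of_real_mult complex_norm_square)
  qed
  finally show ?thesis by (simp add: M_def)
qed

text \<open>\<open>adj U * V\<close> is unitary, so its rows are unit vectors. The overlaps thus
  form a conditional distribution of the second index given the first, and summing out the second
  index returns the first spectrum.\<close>

lemma unitary_overlap_sum:
  assumes U: "unitary_mat n U" and V: "unitary_mat n V" and a: "a < n"
  shows "(\<Sum>b<n. (cmod ((adj U * V) $$ (a, b)))\<^sup>2) = 1"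
proof -
  note u = unitary_matD[OF U] and v = unitary_matD[OF V]
  define N where "N = adj V * U"
  have N: "N \<in> carrier_mat n n" using u v by (auto simp: N_def)
  have M: "adj U * V = adj N" using u v by (simp add: N_def adj_mult)
  have "adj N * N = 1\<^sub>m n"
    unfolding M[symmetric] unfolding N_def using u v by (simp add: mat_assoc unitary_cancel[OF V])
  then have "(\<Sum>b<n. cnj (N $$ (b, a)) * N $$ (b, a)) = 1"
    using adj_mult_self_index[OF N a a] a by simp
  moreover have "(\<Sum>b<n. cnj (N $$ (b, a)) * N $$ (b, a)) = of_real (\<Sum>b<n. (cmod (adj N $$ (a, b)))\<^sup>2)"
    using N a by (simp add: complex_norm_square mult.commute del: of_real_power)
  ultimately have "complex_of_real (\<Sum>b<n. (cmod (adj N $$ (a, b)))\<^sup>2) = 1" by simp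
  then show ?thesis unfolding M using of_real_eq_1_iff by blast
qed

section \<open>Tensor words\<close>

text \<open>An index of a Kronecker product is a pair, encoded as quotient and remainder. Reading
  sums through this bijection is what factorises traces, products and spectra of tensor
  words.\<close>

lemma sum_lessThan_div_mod:
  fixes f :: "nat \<Rightarrow> nat \<Rightarrow> 'b::comm_monoid_add"
  shows "(\<Sum>k<b * m. f (k div m) (k mod m)) = (\<Sum>i<b. \<Sum>j<m. f i j)"
proof -
  have "(\<Sum>k<b * m. f (k div m) (k mod m)) = (\<Sum>i<b. \<Sum>k=i * m..<i * m + m. f (k div m) (k mod m))"
    by (rule sum.nat_group[symmetric])
  also have "\<dots> = (\<Sum>i<b. \<Sum>j<m. f i j)"
  proof (rule sum.cong[OF refl])
    fix i
    have "(\<Sum>k=i * m..<i * m + m. f (k div m) (k mod m)) = (\<Sum>j<m. f ((i * m + j) div m) ((i * m + j) mod m))"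
      by (rule sum.reindex_bij_witness[of _ "\<lambda>j. i * m + j" "\<lambda>k. k - i * m"]) auto
    also have "\<dots> = (\<Sum>j<m. f i j)" by (intro sum.cong refl) auto
    finally show "(\<Sum>k=i * m..<i * m + m. f (k div m) (k mod m)) = (\<Sum>j<m. f i j)" .
  qed
  finally show ?thesis .
qed

lemma div_mod_less:
  fixes i :: nat assumes "i < a * m" shows "i div m < a" "i mod m < m"
proof -
  have "m > 0" using assms by (cases m) auto
  then show "i mod m < m" by simp
  show "i div m < a" using assms by (simp add: less_mult_imp_div_less)
qed

lemma kron_carrier [simp]:
  "A \<in> carrier_mat a b \<Longrightarrow> B \<in> carrier_mat a' b' \<Longrightarrow> kron A B \<in> carrier_mat (a * a') (b * b')"
  by (auto simp: kron_def)

lemma kron_index: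
  assumes "A \<in> carrier_mat a b" "B \<in> carrier_mat a' b'" "i < a * a'" "j < b * b'"
  shows "kron A B $$ (i, j) = A $$ (i div a', j div b') * B $$ (i mod a', j mod b')"
  using assms by (auto simp: kron_def)

lemma kron_mult:
  assumes A: "A \<in> carrier_mat a b" and B: "B \<in> carrier_mat a' b'"
    and C: "C \<in> carrier_mat b c" and D: "D \<in> carrier_mat b' c'"
  shows "kron A B * kron C D = kron (A * C) (B * D)"
proof (rule eq_matI)
  fix i j assume "i < dim_row (kron (A * C) (B * D))" "j < dim_col (kron (A * C) (B * D))"
  then have ij: "i < a * a'" "j < c * c'" using A B C D by (auto simp: kron_def)
  note dm = div_mod_less[OF ij(1)] div_mod_less[OF ij(2)]
  have K: "kron A B \<in> carrier_mat (a * a') (b * b')" "kron C D \<in> carrier_mat (b * b') (c * c')"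
    using A B C D by auto
  have AC: "A * C \<in> carrier_mat a c" and BD: "B * D \<in> carrier_mat a' c'" using A B C D by auto
  have "(kron A B * kron C D) $$ (i, j) = (\<Sum>k<b * b'. kron A B $$ (i, k) * kron C D $$ (k, j))"
    using K ij by (auto simp: scalar_prod_def lessThan_atLeast0 intro!: sum.cong)
  also have "\<dots> = (\<Sum>k<b * b'. (A $$ (i div a', k div b') * C $$ (k div b', j div c'))
      * (B $$ (i mod a', k mod b') * D $$ (k mod b', j mod c')))"
    using ij by (intro sum.cong refl) (simp add: kron_index[OF A B] kron_index[OF C D])
  also have "\<dots> = (\<Sum>k<b. A $$ (i div a', k) * C $$ (k, j div c')) * (\<Sum>l<b'. B $$ (i mod a', l) * D $$ (l, j mod c'))"
    by (subst sum_lessThan_div_mod[of "\<lambda>k l. (A $$ (i div a', k) * C $$ (k, j div c')) * (B $$ (i mod a', l) * D $$ (l, j mod c'))"])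
      (simp add: sum_product)
  also have "(\<Sum>k<b. A $$ (i div a', k) * C $$ (k, j div c')) = (A * C) $$ (i div a', j div c')"
    using A C dm by (auto simp: scalar_prod_def lessThan_atLeast0 intro!: sum.cong)
  also have "(\<Sum>l<b'. B $$ (i mod a', l) * D $$ (l, j mod c')) = (B * D) $$ (i mod a', j mod c')"
    using B D dm by (auto simp: scalar_prod_def lessThan_atLeast0 intro!: sum.cong)
  finally show "(kron A B * kron C D) $$ (i, j) = kron (A * C) (B * D) $$ (i, j)"
    by (simp add: kron_index[OF AC BD ij])
qed (use A B C D in \<open>auto simp: kron_def\<close>)

lemma adj_kron: "adj (kron A B) = kron (adj A) (adj B)"
proof (rule eq_matI)
  fix i j assume "i < dim_row (kron (adj A) (adj B))" "j < dim_col (kron (adj A) (adj B))"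
  then have ij: "i < dim_col A * dim_col B" "j < dim_row A * dim_row B" by (auto simp: kron_def)
  then show "adj (kron A B) $$ (i, j) = kron (adj A) (adj B) $$ (i, j)"
    using div_mod_less[OF ij(1)] div_mod_less[OF ij(2)] by (simp add: kron_def adj_def)
qed (auto simp: kron_def)

lemma mtrace_kron:
  assumes A: "A \<in> carrier_mat a a" and B: "B \<in> carrier_mat b b"
  shows "mtrace (kron A B) = mtrace A * mtrace B"
proof -
  have "mtrace (kron A B) = (\<Sum>k<a * b. A $$ (k div b, k div b) * B $$ (k mod b, k mod b))"
    unfolding mtrace_eq[OF kron_carrier[OF A B]]
    by (intro sum.cong refl) (simp add: kron_index[OF A B])
  also have "\<dots> = mtrace A * mtrace B"
    by (subst sum_lessThan_div_mod[of "\<lambda>k l. A $$ (k, k) * B $$ (l, l)"])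
      (use A B in \<open>simp add: sum_product mtrace_def\<close>)
  finally show ?thesis .
qed

lemma kron_mat_diag:
  "kron (mat_diag n f) (mat_diag m g) = mat_diag (n * m) (\<lambda>i. f (i div m) * g (i mod m))"
proof (rule eq_matI)
  fix i j assume "i < dim_row (mat_diag (n * m) (\<lambda>i. f (i div m) * g (i mod m)))"
    "j < dim_col (mat_diag (n * m) (\<lambda>i. f (i div m) * g (i mod m)))"
  then have ij: "i < n * m" "j < n * m" by auto
  have "i = j \<longleftrightarrow> i div m = j div m \<and> i mod m = j mod m"
    by (metis div_mult_mod_eq)
  then show "kron (mat_diag n f) (mat_diag m g) $$ (i, j) = mat_diag (n * m) (\<lambda>i. f (i div m) * g (i mod m)) $$ (i, j)"
    using ij div_mod_less[OF ij(1)] div_mod_less[OF ij(2)] by (auto simp: kron_def mat_diag_def)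
qed (auto simp: kron_def)

lemma kron_one: "kron (1\<^sub>m n) (1\<^sub>m m) = 1\<^sub>m (n * m)"
  unfolding mat_diag_one[symmetric] kron_mat_diag by simp

lemma tensor_word_carrier:
  "(\<And>x. x \<in> set xs \<Longrightarrow> W x \<in> carrier_mat d d) \<Longrightarrow> tensor_word W xs \<in> carrier_mat (d ^ length xs) (d ^ length xs)"
  by (induction xs) auto

lemma tensor_word_cong:
  "(\<And>x. x \<in> set xs \<Longrightarrow> V x = W x) \<Longrightarrow> tensor_word V xs = tensor_word W xs"
  by (induction xs) auto

lemma adj_tensor_word: "adj (tensor_word W xs) = tensor_word (\<lambda>x. adj (W x)) xs"
  by (induction xs) (auto simp: adj_kron)

lemma tensor_word_mult:
  assumes "\<And>x. x \<in> set xs \<Longrightarrow> V x \<in> carrier_mat d d" "\<And>x. x \<in> set xs \<Longrightarrow> W x \<in> carrier_mat d d"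
  shows "tensor_word V xs * tensor_word W xs = tensor_word (\<lambda>x. V x * W x) xs"
  using assms
proof (induction xs)
  case (Cons x xs)
  let ?m = "d ^ length xs"
  have "kron (V x) (tensor_word V xs) * kron (W x) (tensor_word W xs)
      = kron (V x * W x) (tensor_word V xs * tensor_word W xs)"
    by (rule kron_mult[of _ d d _ ?m ?m _ d _ ?m]) (auto intro!: Cons.prems tensor_word_carrier)
  with Cons show ?case by simp
qed simp

lemma mtrace_tensor_word_mult:
  assumes "length xs = length ys" "\<And>x. x \<in> set xs \<union> set ys \<Longrightarrow> S x \<in> carrier_mat d d"
  shows "mtrace (tensor_word S xs * tensor_word S ys) = prod_list (map2 (\<lambda>x y. mtrace (S x * S y)) xs ys)"
  using assms
proof (induction xs ys rule: list_induct2)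
  case (Cons x xs y ys)
  let ?m = "d ^ length xs"
  have T: "tensor_word S xs \<in> carrier_mat ?m ?m" "tensor_word S ys \<in> carrier_mat ?m ?m"
    using Cons.prems Cons.hyps tensor_word_carrier[of xs S d] tensor_word_carrier[of ys S d] by auto
  have S: "S x \<in> carrier_mat d d" "S y \<in> carrier_mat d d" using Cons.prems by auto
  have "mtrace (kron (S x) (tensor_word S xs) * kron (S y) (tensor_word S ys))
      = mtrace (kron (S x * S y) (tensor_word S xs * tensor_word S ys))"
    using kron_mult[OF S(1) T(1) S(2) T(2)] by simp
  also have "\<dots> = mtrace (S x * S y) * mtrace (tensor_word S xs * tensor_word S ys)"
    by (rule mtrace_kron[of _ d _ ?m]) (use S T in auto)
  finally show ?case using Cons by simp
qed simp

lemma unitary_tensor_word: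
  assumes "\<And>x. x \<in> set xs \<Longrightarrow> unitary_mat d (U x)"
  shows "unitary_mat (d ^ length xs) (tensor_word U xs)"
proof -
  have u: "U x \<in> carrier_mat d d" "adj (U x) \<in> carrier_mat d d" "adj (U x) * U x = 1\<^sub>m d" "U x * adj (U x) = 1\<^sub>m d"
    if "x \<in> set xs" for x using unitary_matD[OF assms[OF that]] by auto
  have one: "tensor_word (\<lambda>_::'a. 1\<^sub>m d) ys = 1\<^sub>m (d ^ length ys)" for ys
    by (induction ys) (auto simp: kron_one)
  have "adj (tensor_word U xs) * tensor_word U xs = tensor_word (\<lambda>x. adj (U x) * U x) xs"
    unfolding adj_tensor_word by (rule tensor_word_mult) (use u in auto)
  moreover have "tensor_word U xs * adj (tensor_word U xs) = tensor_word (\<lambda>x. U x * adj (U x)) xs"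
    unfolding adj_tensor_word by (rule tensor_word_mult) (use u in auto)
  moreover have "tensor_word (\<lambda>x. adj (U x) * U x) xs = 1\<^sub>m (d ^ length xs)"
    by (subst tensor_word_cong[of _ _ "\<lambda>_. 1\<^sub>m d"]) (use u one in auto)
  moreover have "tensor_word (\<lambda>x. U x * adj (U x)) xs = 1\<^sub>m (d ^ length xs)"
    by (subst tensor_word_cong[of _ _ "\<lambda>_. 1\<^sub>m d"]) (use u one in auto)
  ultimately show ?thesis
    using tensor_word_carrier[of xs U d] u(1) by (simp add: unitary_mat_def)
qed

section \<open>Spectra of product states\<close>

text \<open>The index \<open>i\<close> is read as a number in base \<open>d\<close> whose leading
  digit belongs to the first letter, in agreement with \<open>kron\<close>; each digit selects one
  eigenvalue of its letter, and the eigenvalues are multiplied.\<close>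

fun prod_spectrum :: "nat \<Rightarrow> ('a \<Rightarrow> nat \<Rightarrow> real) \<Rightarrow> 'a list \<Rightarrow> nat \<Rightarrow> real" where
  "prod_spectrum d p [] i = 1"
| "prod_spectrum d p (x # xs) i = p x (i div d ^ length xs) * prod_spectrum d p xs (i mod d ^ length xs)"

lemma tensor_word_rdiag:
  "tensor_word (\<lambda>x. rdiag d (p x)) xs = rdiag (d ^ length xs) (prod_spectrum d p xs)"
  by (induction xs) (auto simp: kron_mat_diag simp flip: mat_diag_one)

lemma tensor_word_conj_diag:
  assumes "\<And>x. x \<in> set xs \<Longrightarrow> U x \<in> carrier_mat d d"
  shows "tensor_word (\<lambda>x. conj_diag d (U x) (p x)) xs
    = conj_diag (d ^ length xs) (tensor_word U xs) (prod_spectrum d p xs)"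
proof -
  have m: "rdiag d (p x) * adj (U x) \<in> carrier_mat d d" if "x \<in> set xs" for x
    using assms[OF that] by (auto intro!: mult_carrier_mat[of _ d d])
  show ?thesis
    unfolding conj_diag_def adj_tensor_word tensor_word_rdiag[symmetric] using assms m
    by (simp add: tensor_word_mult[where d = d])
qed

lemma prod_spectrum_sqrt: "prod_spectrum d (\<lambda>x i. sqrt (p x i)) xs i = sqrt (prod_spectrum d p xs i)"
  by (induction xs arbitrary: i) (auto simp: real_sqrt_mult)

lemma prod_spectrum_nonneg:
  assumes "\<And>x i. x \<in> set xs \<Longrightarrow> i < d \<Longrightarrow> p x i \<ge> 0" "i < d ^ length xs"
  shows "prod_spectrum d p xs i \<ge> 0"
  using assms
proof (induction xs arbitrary: i)
  case (Cons x xs)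
  have "i < d * d ^ length xs" using Cons.prems(2) by simp
  note dm = div_mod_less[OF this]
  then show ?case using Cons by simp
qed simp

lemma prod_spectrum_sum:
  assumes "\<And>x. x \<in> set xs \<Longrightarrow> (\<Sum>i<d. p x i) = 1"
  shows "(\<Sum>i<d ^ length xs. prod_spectrum d p xs i) = 1"
  using assms
proof (induction xs)
  case (Cons x xs)
  have "(\<Sum>i<d ^ length (x # xs). prod_spectrum d p (x # xs) i)
      = (\<Sum>i<d. \<Sum>j<d ^ length xs. p x i * prod_spectrum d p xs j)"
    using sum_lessThan_div_mod[where f = "\<lambda>i j. p x i * prod_spectrum d p xs j" and b = d and m = "d ^ length xs"] by simp
  also have "\<dots> = 1" using Cons by (simp flip: sum_product)
  finally show ?case .
qed simp

section \<open>Packing bound on the code size\<close>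

lemma hs_norm_power2: "A \<in> carrier_mat n m \<Longrightarrow> (hs_norm A)\<^sup>2 = (\<Sum>i<n. \<Sum>j<m. (cmod (A $$ (i, j)))\<^sup>2)"
  by (simp add: hs_norm_def mtrace_adj_mult_self sum_nonneg del: of_real_sum)

lemma hs_norm_nonneg [simp]: "hs_norm A \<ge> 0"
proof -
  have "mtrace (adj A * A) = of_real (\<Sum>i<dim_row A. \<Sum>j<dim_col A. (cmod (A $$ (i, j)))\<^sup>2)"
    by (rule mtrace_adj_mult_self) auto
  then show ?thesis by (simp add: hs_norm_def sum_nonneg)
qed

lemma hs_norm_diff_power2:
  assumes "A \<in> carrier_mat n m" "B \<in> carrier_mat n m"
  shows "(hs_norm (A - B))\<^sup>2 = (\<Sum>i<n. \<Sum>j<m. (cmod (A $$ (i, j) - B $$ (i, j)))\<^sup>2)"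
proof -
  have "A - B \<in> carrier_mat n m" by (rule minus_carrier_mat[OF assms(2)])
  then show ?thesis using assms by (simp add: hs_norm_power2)
qed

lemma hs_norm_diff_commute:
  assumes "A \<in> carrier_mat n m" "B \<in> carrier_mat n m"
  shows "hs_norm (A - B) = hs_norm (B - A)"
proof -
  have "(hs_norm (A - B))\<^sup>2 = (hs_norm (B - A))\<^sup>2"
    unfolding hs_norm_diff_power2[OF assms] hs_norm_diff_power2[OF assms(2,1)]
    by (simp add: norm_minus_commute)
  then show ?thesis by (simp add: power2_eq_iff_nonneg)
qed

lemma hs_norm_diff_self: "A \<in> carrier_mat n m \<Longrightarrow> hs_norm (A - A) = 0"
  using hs_norm_diff_power2[of A n m A] by simp

lemma cmod_add_power2_le: "(cmod (x + y))\<^sup>2 \<le> 2 * (cmod x)\<^sup>2 + 2 * (cmod y)\<^sup>2"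
proof -
  have "(cmod (x + y))\<^sup>2 \<le> (cmod x + cmod y)\<^sup>2"
    by (intro power_mono norm_triangle_ineq) auto
  also have "\<dots> \<le> 2 * (cmod x)\<^sup>2 + 2 * (cmod y)\<^sup>2"
    using sum_squares_bound[of "cmod x" "cmod y"] by (simp add: power2_sum)
  finally show ?thesis .
qed

text \<open>A triangle inequality for squares, obtained entry by entry from the bound on the squared
  modulus of a sum. The factor 2 only changes the constant in the blocklength, not the rate.\<close>

lemma hs_norm_diff_via:
  assumes "A \<in> carrier_mat n m" "B \<in> carrier_mat n m" "C \<in> carrier_mat n m"
  shows "(hs_norm (A - C))\<^sup>2 \<le> 2 * (hs_norm (A - B))\<^sup>2 + 2 * (hs_norm (B - C))\<^sup>2"
proof -
  have "(\<Sum>i<n. \<Sum>j<m. (cmod (A $$ (i, j) - C $$ (i, j)))\<^sup>2)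
     \<le> (\<Sum>i<n. \<Sum>j<m. 2 * (cmod (A $$ (i, j) - B $$ (i, j)))\<^sup>2 + 2 * (cmod (B $$ (i, j) - C $$ (i, j)))\<^sup>2)"
  proof (intro sum_mono)
    fix i j
    show "(cmod (A $$ (i, j) - C $$ (i, j)))\<^sup>2
      \<le> 2 * (cmod (A $$ (i, j) - B $$ (i, j)))\<^sup>2 + 2 * (cmod (B $$ (i, j) - C $$ (i, j)))\<^sup>2"
      using cmod_add_power2_le[of "A $$ (i, j) - B $$ (i, j)" "B $$ (i, j) - C $$ (i, j)"] by simp
  qed
  then show ?thesis
    using assms by (simp add: hs_norm_diff_power2[where n = n and m = m] sum.distrib sum_distrib_left)
qed

lemma cnj_mtrace: "A \<in> carrier_mat n n \<Longrightarrow> cnj (mtrace A) = mtrace (adj A)"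
  by (simp add: mtrace_def)

lemma mtrace_hermitian_mult_real:
  assumes "A \<in> carrier_mat n n" "B \<in> carrier_mat n n" "adj A = A" "adj B = B"
  shows "mtrace (A * B) = of_real (Re (mtrace (A * B)))"
proof -
  have "cnj (mtrace (A * B)) = mtrace (adj (A * B))"
    by (rule cnj_mtrace[of _ n]) (use assms in auto)
  also have "\<dots> = mtrace (A * B)"
    using assms mtrace_comm[of B n n A] by (simp add: adj_mult)
  finally show ?thesis by (simp add: complex_eq_iff)
qed

text \<open>Polarisation for two unit vectors of the Hilbert--Schmidt inner product. It translates
  between the distance, in which packings are measured, and the overlap, which is multiplicative
  over tensor factors.\<close>

lemma hs_norm_hermitian_diff:
  assumes A: "A \<in> carrier_mat n n" "adj A = A" and B: "B \<in> carrier_mat n n" "adj B = B"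
    and one: "mtrace (A * A) = 1" "mtrace (B * B) = 1"
  shows "(hs_norm (A - B))\<^sup>2 = 2 - 2 * Re (mtrace (A * B))"
proof -
  have AB: "A - B \<in> carrier_mat n n" by (rule minus_carrier_mat[OF B(1)])
  have m: "A * A \<in> carrier_mat n n" "A * B \<in> carrier_mat n n" "B * A \<in> carrier_mat n n" "B * B \<in> carrier_mat n n"
    using A B by auto
  have "adj (A - B) * (A - B) = (A - B) * (A - B)"
    using A B by (simp add: adj_minus)
  also have "\<dots> = (A * A - B * A) - (A * B - B * B)"
    using A B AB by (simp add: mult_minus_distrib_mat[of _ n n] minus_mult_distrib_mat[of _ n n])
  finally have "mtrace (adj (A - B) * (A - B)) = mtrace (A * A) - mtrace (B * A) - (mtrace (A * B) - mtrace (B * B))"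
    using m by (simp add: mtrace_minus[of _ n] minus_carrier_mat)
  then have "mtrace (adj (A - B) * (A - B)) = 2 - 2 * mtrace (A * B)"
    using one mtrace_comm[OF A(1) B(1)] by simp
  moreover have "(hs_norm (A - B))\<^sup>2 = Re (mtrace (adj (A - B) * (A - B)))"
    using hs_norm_power2[OF AB] mtrace_adj_mult_self[OF AB] by simp
  ultimately show ?thesis by simp
qed

section \<open>Measurements on nearby states\<close>

lemma mtrace_sandwich:
  assumes E: "E \<in> carrier_mat n n" and X: "X \<in> carrier_mat n m"
  shows "mtrace (adj X * (E * X)) = (\<Sum>j<m. \<Sum>i<n. \<Sum>k<n. cnj (X $$ (i, j)) * E $$ (i, k) * X $$ (k, j))"
proof -
  have "mtrace (adj X * (E * X)) = (\<Sum>j<m. \<Sum>i<n. adj X $$ (j, i) * (E * X) $$ (i, j))"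
    by (rule mtrace_mult) (use assms in auto)
  also have "\<dots> = (\<Sum>j<m. \<Sum>i<n. cnj (X $$ (i, j)) * (\<Sum>k<n. E $$ (i, k) * X $$ (k, j)))"
    using assms by (intro sum.cong refl) (auto simp: scalar_prod_def lessThan_atLeast0 intro!: sum.cong)
  finally show ?thesis by (simp add: sum_distrib_left mult.assoc)
qed

text \<open>The trace splits into the values of the quadratic form of \<open>E\<close> at the
  columns of \<open>X\<close>.\<close>

lemma psd_mtrace_sandwich_nonneg:
  assumes E: "E \<in> carrier_mat n n" and X: "X \<in> carrier_mat n m" and psd: "psd E"
  shows "Re (mtrace (adj X * (E * X))) \<ge> 0"
proof -
  have "mtrace (adj X * (E * X)) = (\<Sum>j<m. conjugate (col X j) \<bullet> (E *\<^sub>v col X j))"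
    unfolding mtrace_sandwich[OF E X]
  proof (intro sum.cong refl)
    fix j assume "j \<in> {..<m}"
    then have c: "col X j \<in> carrier_vec n" using X by simp
    have "conjugate (col X j) \<bullet> (E *\<^sub>v col X j) = (\<Sum>i<n. conjugate (col X j) $ i * (E *\<^sub>v col X j) $ i)"
      by (rule scalar_prod_sum) (use E in simp)
    also have "\<dots> = (\<Sum>i<n. cnj (X $$ (i, j)) * (\<Sum>k<n. E $$ (i, k) * X $$ (k, j)))"
      using X c \<open>j \<in> {..<m}\<close> by (intro sum.cong refl) (auto simp: mult_mat_vec_index[OF E c] simp del: index_mult_mat_vec)
    finally show "(\<Sum>i<n. \<Sum>k<n. cnj (X $$ (i, j)) * E $$ (i, k) * X $$ (k, j)) = conjugate (col X j) \<bullet> (E *\<^sub>v col X j)"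
      by (simp add: sum_distrib_left mult.assoc)
  qed
  moreover have "Re (conjugate (col X j) \<bullet> (E *\<^sub>v col X j)) \<ge> 0" for j
    using psd E X by (auto simp: psd_def)
  ultimately show ?thesis by (simp add: sum_nonneg)
qed

text \<open>The weighted parallelogram identity for the form \<open>X \<mapsto> Tr X\<^sup>* E X\<close> replaces Cauchy--Schwarz.\<close>

lemma effect_expectation_le:
  assumes E: "effect n E" and A: "A \<in> carrier_mat n n" "adj A = A" and B: "B \<in> carrier_mat n n" "adj B = B"
    and t: "t > 0"
  shows "Re (mtrace (A * A * E)) \<le> (1 + t) * Re (mtrace (B * B * E)) + (1 + 1 / t) * (hs_norm (A - B))\<^sup>2"
proof -
  have Ec: "E \<in> carrier_mat n n" and Ep: "psd E" and Ep': "psd (1\<^sub>m n - E)"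
    using E by (auto simp: effect_def)
  define r where "r = sqrt t"
  have r: "r > 0" "r * r = t" using t by (auto simp: r_def)
  define C where "C = A - B"
  have C: "C \<in> carrier_mat n n" unfolding C_def by (rule minus_carrier_mat[OF B(1)])
  define Y where "Y = Matrix.mat n n (\<lambda>(i, j). of_real r * B $$ (i, j) - of_real (1 / r) * C $$ (i, j))"
  have Y: "Y \<in> carrier_mat n n" by (simp add: Y_def)
  have cyc: "mtrace (D * D * E) = mtrace (adj D * (E * D))" if "D \<in> carrier_mat n n" "adj D = D" for D
  proof -
    have "D * D * E = D * (D * E)" using that Ec by (simp add: mat_assoc)
    also have "mtrace \<dots> = mtrace (D * E * D)" by (rule mtrace_comm[of _ n n]) (use that Ec in auto)
    also have "D * E * D = adj D * (E * D)" using that Ec by (simp add: mat_assoc)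
    finally show ?thesis .
  qed
  have point: "cnj a * e * a' + cnj (of_real r * b - of_real (1 / r) * c) * e * (of_real r * b' - of_real (1 / r) * c')
      = of_real (1 + t) * (cnj b * e * b') + of_real (1 + 1 / t) * (cnj c * e * c')"
    if "a = b + c" "a' = b' + c'" for a a' b b' c c' e :: complex
  proof -
    have "complex_of_real r * of_real (1 / r) = 1" using r by simp
    moreover have "complex_of_real r * of_real r = of_real t" using r by (simp flip: of_real_mult)
    moreover have "complex_of_real (1 / r) * of_real (1 / r) = of_real (1 / t)" using r by (simp flip: of_real_mult)
    moreover have "cnj (R * b - S * c) * e * (R * b' - S * c')
        = (R * R) * (cnj b * e * b') + (S * S) * (cnj c * e * c') - (R * S) * (cnj b * e * c' + cnj c * e * b')"
      if "cnj R = R" "cnj S = S" for R S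
      using that by (simp add: algebra_simps)
    ultimately show ?thesis unfolding that using r(1) by (simp add: algebra_simps)
  qed
  have "mtrace (adj A * (E * A)) + mtrace (adj Y * (E * Y))
      = of_real (1 + t) * mtrace (adj B * (E * B)) + of_real (1 + 1 / t) * mtrace (adj C * (E * C))"
    unfolding mtrace_sandwich[OF Ec A(1)] mtrace_sandwich[OF Ec B(1)] mtrace_sandwich[OF Ec C] mtrace_sandwich[OF Ec Y]
      sum_distrib_left sum.distrib[symmetric]
  proof (intro sum.cong refl)
    fix j i k assume "j \<in> {..<n}" "i \<in> {..<n}" "k \<in> {..<n}"
    then have ijk: "i < n" "j < n" "k < n" by auto
    have "A $$ (i, j) = B $$ (i, j) + C $$ (i, j)" "A $$ (k, j) = B $$ (k, j) + C $$ (k, j)"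
      using ijk A B by (auto simp: C_def)
    from point[OF this, of "E $$ (i, k)"]
    show "cnj (A $$ (i, j)) * E $$ (i, k) * A $$ (k, j) + cnj (Y $$ (i, j)) * E $$ (i, k) * Y $$ (k, j)
      = of_real (1 + t) * (cnj (B $$ (i, j)) * E $$ (i, k) * B $$ (k, j))
        + of_real (1 + 1 / t) * (cnj (C $$ (i, j)) * E $$ (i, k) * C $$ (k, j))"
      using ijk by (simp add: Y_def)
  qed
  from arg_cong[OF this, of Re]
  have "Re (mtrace (adj A * (E * A))) + Re (mtrace (adj Y * (E * Y)))
      = (1 + t) * Re (mtrace (adj B * (E * B))) + (1 + 1 / t) * Re (mtrace (adj C * (E * C)))"
    by (simp del: of_real_add)
  moreover have "Re (mtrace (adj Y * (E * Y))) \<ge> 0" by (rule psd_mtrace_sandwich_nonneg[OF Ec Y Ep])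
  \<comment> \<open>Here \<open>E \<le> 1\<close> enters: the form of \<open>1 - E\<close> at
    \<open>C\<close> is nonnegative.\<close>
  moreover have "Re (mtrace (adj C * (E * C))) \<le> (hs_norm C)\<^sup>2"
  proof -
    have E1: "1\<^sub>m n - E \<in> carrier_mat n n" by (rule minus_carrier_mat[OF Ec])
    have EC: "E * C \<in> carrier_mat n n" "adj C \<in> carrier_mat n n" using Ec C by auto
    have "(1\<^sub>m n - E) * C = 1\<^sub>m n * C - E * C"
      by (rule minus_mult_distrib_mat[OF _ Ec C]) simp
    also have "1\<^sub>m n * C = C" using C by simp
    also have "adj C * (C - E * C) = adj C * C - adj C * (E * C)"
      by (rule mult_minus_distrib_mat[OF EC(2) C EC(1)])
    finally have "adj C * ((1\<^sub>m n - E) * C) = adj C * C - adj C * (E * C)" .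
    then have "Re (mtrace (adj C * C - adj C * (E * C))) \<ge> 0"
      using psd_mtrace_sandwich_nonneg[OF E1 C Ep'] by (simp only:)
    moreover have "mtrace (adj C * C - adj C * (E * C)) = mtrace (adj C * C) - mtrace (adj C * (E * C))"
      by (rule mtrace_minus[OF mult_carrier_mat[OF EC(2) C] mult_carrier_mat[OF EC(2,1)]])
    ultimately have "Re (mtrace (adj C * (E * C))) \<le> Re (mtrace (adj C * C))" by simp
    also have "\<dots> = (hs_norm C)\<^sup>2" unfolding hs_norm_power2[OF C] mtrace_adj_mult_self[OF C] by simp
    finally show ?thesis .
  qed
  then have "(1 + 1 / t) * Re (mtrace (adj C * (E * C))) \<le> (1 + 1 / t) * (hs_norm C)\<^sup>2"
    using t by (intro mult_left_mono) auto
  ultimately show ?thesis unfolding cyc[OF A] cyc[OF B] C_def[symmetric] by linarith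
qed

lemma mtrace_msqrt_mult:
  assumes "\<rho> \<in> density d" "\<sigma> \<in> density d"
  shows "mtrace (msqrt \<rho> * msqrt \<sigma>) = of_real (1 - (hs_norm (msqrt \<rho> - msqrt \<sigma>))\<^sup>2 / 2)"
proof -
  note r = msqrt_density[OF assms(1)] and s = msqrt_density[OF assms(2)]
  have "mtrace (msqrt \<rho> * msqrt \<rho>) = 1" "mtrace (msqrt \<sigma> * msqrt \<sigma>) = 1"
    using assms r s by (auto simp: density_def)
  then have re: "Re (mtrace (msqrt \<rho> * msqrt \<sigma>)) = 1 - (hs_norm (msqrt \<rho> - msqrt \<sigma>))\<^sup>2 / 2"
    using hs_norm_hermitian_diff[OF r(1,2) s(1,2)] by linarith
  show ?thesis
    by (subst mtrace_hermitian_mult_real[OF r(1) s(1) r(2) s(2)]) (simp only: re)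
qed

lemma prod_list_of_real: "prod_list (map (\<lambda>x. complex_of_real (f x)) xs) = of_real (prod_list (map f xs))"
  by (induction xs) auto

lemma mtrace_tensor_msqrt_mult:
  assumes W: "\<And>x. x \<in> X \<Longrightarrow> W x \<in> density d" and "set u \<subseteq> X" "set v \<subseteq> X" "length u = length v"
  shows "mtrace (tensor_word (\<lambda>x. msqrt (W x)) u * tensor_word (\<lambda>x. msqrt (W x)) v)
    = of_real (\<Prod>(x, y)\<leftarrow>zip u v. 1 - (hs_norm (msqrt (W x) - msqrt (W y)))\<^sup>2 / 2)"
proof -
  have "mtrace (tensor_word (\<lambda>x. msqrt (W x)) u * tensor_word (\<lambda>x. msqrt (W x)) v)
      = prod_list (map2 (\<lambda>x y. mtrace (msqrt (W x) * msqrt (W y))) u v)"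
  proof (rule mtrace_tensor_word_mult[of _ _ _ d])
    fix x assume "x \<in> set u \<union> set v"
    then have "x \<in> X" using assms(2,3) by blast
    then show "msqrt (W x) \<in> carrier_mat d d" by (rule msqrt_density(1)[OF W])
  qed (rule assms(4))
  also have "map2 (\<lambda>x y. mtrace (msqrt (W x) * msqrt (W y))) u v
      = map (\<lambda>z. complex_of_real (1 - (hs_norm (msqrt (W (fst z)) - msqrt (W (snd z))))\<^sup>2 / 2)) (zip u v)"
  proof (rule map_cong[OF refl])
    fix z assume "z \<in> set (zip u v)"
    then have "fst z \<in> set u" "snd z \<in> set v"
      by (metis prod.collapse set_zip_leftD, metis prod.collapse set_zip_rightD)
    then have "fst z \<in> X" "snd z \<in> X" using assms(2,3) by blast+
    then show "(case z of (x, y) \<Rightarrow> mtrace (msqrt (W x) * msqrt (W y)))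
        = complex_of_real (1 - (hs_norm (msqrt (W (fst z)) - msqrt (W (snd z))))\<^sup>2 / 2)"
      by (simp only: case_prod_unfold mtrace_msqrt_mult[OF W W])
  qed
  finally show ?thesis unfolding prod_list_of_real by (simp only: case_prod_unfold)
qed

lemma tensor_msqrt_hermitian:
  assumes W: "\<And>x. x \<in> X \<Longrightarrow> W x \<in> density d" and u: "set u \<subseteq> X"
  defines "S \<equiv> tensor_word (\<lambda>x. msqrt (W x)) u"
  shows "S \<in> carrier_mat (d ^ length u) (d ^ length u)" "adj S = S" "S * S = tensor_word W u"
proof -
  have m: "msqrt (W x) \<in> carrier_mat d d" "adj (msqrt (W x)) = msqrt (W x)" "msqrt (W x) * msqrt (W x) = W x"
    if "x \<in> set u" for x using msqrt_density[OF W] u that by auto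
  show "S \<in> carrier_mat (d ^ length u) (d ^ length u)"
    unfolding S_def by (rule tensor_word_carrier) (rule m(1))
  show "adj S = S" unfolding S_def adj_tensor_word by (rule tensor_word_cong) (rule m(2))
  have "S * S = tensor_word (\<lambda>x. msqrt (W x) * msqrt (W x)) u"
    unfolding S_def by (rule tensor_word_mult) (rule m(1), assumption)+
  also have "\<dots> = tensor_word W u" by (rule tensor_word_cong) (rule m(3))
  finally show "S * S = tensor_word W u" .
qed

lemma prod_list_ge_Bernoulli:
  assumes "\<And>z. z \<in> set zs \<Longrightarrow> 1 - \<eta> \<le> f z" "0 \<le> \<eta>" "\<eta> \<le> 1"
  shows "1 - real (length zs) * \<eta> \<le> prod_list (map f zs)"
proof -
  have "(1 - \<eta>) ^ length zs \<le> prod_list (map f zs)"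
    using assms(1)
  proof (induction zs)
    case (Cons z zs)
    then have "(1 - \<eta>) * (1 - \<eta>) ^ length zs \<le> f z * prod_list (map f zs)"
      using assms(2,3) order_trans[of 0 "1 - \<eta>" "f z"] by (intro mult_mono) auto
    then show ?case by simp
  qed simp
  moreover have "1 + real (length zs) * (- \<eta>) \<le> (1 + (- \<eta>)) ^ length zs"
    by (rule Bernoulli_inequality) (use assms in auto)
  ultimately show ?thesis by simp
qed

text \<open>The overlap of the two roots is a product of \<open>n\<close> factors, each at least
  \<open>1 - \<eta>\<close>, hence at least \<open>1 - n * \<eta>\<close>. The squared distance
  therefore grows at most linearly in \<open>n\<close>, which is the source of the scale
  \<open>1 / sqrt n\<close>.\<close>

lemma hs_norm_tensor_msqrt_diff:
  assumes W: "\<And>x. x \<in> X \<Longrightarrow> W x \<in> density d" and uv: "set u \<subseteq> X" "set v \<subseteq> X" "length u = n" "length v = n"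
    and near: "\<And>x y. (x, y) \<in> set (zip u v) \<Longrightarrow> (hs_norm (msqrt (W x) - msqrt (W y)))\<^sup>2 \<le> 2 * \<eta>"
    and \<eta>: "0 \<le> \<eta>" "\<eta> \<le> 1"
  shows "(hs_norm (tensor_word (\<lambda>x. msqrt (W x)) u - tensor_word (\<lambda>x. msqrt (W x)) v))\<^sup>2 \<le> 2 * real n * \<eta>"
proof -
  have self: "mtrace (tensor_word (\<lambda>x. msqrt (W x)) w * tensor_word (\<lambda>x. msqrt (W x)) w) = 1" if "set w \<subseteq> X" for w
  proof -
    have "map (\<lambda>(x, y). 1 - (hs_norm (msqrt (W x) - msqrt (W y)))\<^sup>2 / 2) (zip w w) = map (\<lambda>_. 1) w"
      using that msqrt_density(1)[OF W] by (auto simp: zip_same_conv_map hs_norm_diff_self[of _ d d])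
    moreover have "prod_list (map (\<lambda>_. 1 :: real) w) = 1" by (induction w) auto
    ultimately show ?thesis using mtrace_tensor_msqrt_mult[OF W that that refl] by simp
  qed
  note U = tensor_msqrt_hermitian[OF W uv(1), unfolded uv(3)]
    and V = tensor_msqrt_hermitian[OF W uv(2), unfolded uv(4)]
  have "1 - real (length (zip u v)) * \<eta>
      \<le> (\<Prod>(x, y)\<leftarrow>zip u v. 1 - (hs_norm (msqrt (W x) - msqrt (W y)))\<^sup>2 / 2)"
    by (rule prod_list_ge_Bernoulli[OF _ \<eta>]) (use near in fastforce)
  also have "\<dots> = Re (mtrace (tensor_word (\<lambda>x. msqrt (W x)) u * tensor_word (\<lambda>x. msqrt (W x)) v))"
    using uv by (subst mtrace_tensor_msqrt_mult[OF W]) auto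
  finally show ?thesis
    using hs_norm_hermitian_diff[OF U(1,2) V(1,2) self[OF uv(1)] self[OF uv(2)]] uv(3,4) by simp
qed

text \<open>\<open>c\<close> quantises letters. If two codewords had the same quantised word, the
  test of the first would accept the second with probability above \<open>l2\<close>, by
  \<open>gap\<close>. So quantisation is injective on codewords, and there are only
  \<open>card S ^ n\<close> quantised words.\<close>

lemma DI_code_size_le:
  assumes W: "\<And>x. x \<in> X \<Longrightarrow> W x \<in> density d"
    and code: "is_DI_code X d W n N l1 l2 u E"
    and S: "finite S" "\<And>x. x \<in> X \<Longrightarrow> c x \<in> S"
    and near: "\<And>x y. x \<in> X \<Longrightarrow> y \<in> X \<Longrightarrow> c x = c y \<Longrightarrow> (hs_norm (msqrt (W x) - msqrt (W y)))\<^sup>2 \<le> 2 * \<eta>"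
    and \<eta>: "0 \<le> \<eta>" "\<eta> \<le> 1" and t: "t > 0"
    and gap: "(1 + t) * l2 + (1 + 1 / t) * (2 * real n * \<eta>) < 1 - l1"
  shows "N \<le> card S ^ n"
proof -
  have w: "set (u j) \<subseteq> X" "length (u j) = n" "effect (d ^ n) (E j)"
    "Re (mtrace (tensor_word W (u j) * E j)) \<ge> 1 - l1" if "j < N" for j
    using code that by (auto simp: is_DI_code_def)
  have "inj_on (\<lambda>j. map c (u j)) {..<N}"
  proof (rule inj_onI, rule ccontr)
    fix j k assume jk: "j \<in> {..<N}" "k \<in> {..<N}" "map c (u j) = map c (u k)" "j \<noteq> k"
    then have j: "j < N" and k: "k < N" by auto
    have near': "(hs_norm (msqrt (W x) - msqrt (W y)))\<^sup>2 \<le> 2 * \<eta>" if xy: "(x, y) \<in> set (zip (u j) (u k))" for x y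
    proof -
      obtain i where i: "i < n" "x = u j ! i" "y = u k ! i"
        using xy w(2)[OF j] w(2)[OF k] by (auto simp: set_zip)
      have "c x = c y"
        using arg_cong[OF jk(3), of "\<lambda>l. l ! i"] i w(2)[OF j] w(2)[OF k] by simp
      moreover have "x \<in> X" "y \<in> X"
        using i w[OF j] w[OF k] by (auto dest: nth_mem)
      ultimately show ?thesis by (intro near)
    qed
    have close: "(hs_norm (tensor_word (\<lambda>x. msqrt (W x)) (u j) - tensor_word (\<lambda>x. msqrt (W x)) (u k)))\<^sup>2 \<le> 2 * real n * \<eta>"
      by (rule hs_norm_tensor_msqrt_diff[OF W w(1)[OF j] w(1)[OF k] w(2)[OF j] w(2)[OF k] near' \<eta>])
    note U = tensor_msqrt_hermitian[OF W w(1)[OF j], unfolded w(2)[OF j]]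
      and V = tensor_msqrt_hermitian[OF W w(1)[OF k], unfolded w(2)[OF k]]
    have "1 - l1 \<le> Re (mtrace (tensor_word W (u j) * E j))" by (rule w(4)[OF j])
    also have "\<dots> \<le> (1 + t) * Re (mtrace (tensor_word W (u k) * E j))
        + (1 + 1 / t) * (hs_norm (tensor_word (\<lambda>x. msqrt (W x)) (u j) - tensor_word (\<lambda>x. msqrt (W x)) (u k)))\<^sup>2"
      using effect_expectation_le[OF w(3)[OF j] U(1,2) V(1,2) t] U(3) V(3) by simp
    also have "\<dots> \<le> (1 + t) * l2 + (1 + 1 / t) * (2 * real n * \<eta>)"
      using code j k jk(4) close t by (intro add_mono mult_left_mono) (auto simp: is_DI_code_def)
    finally show False using gap by simp
  qed
  then have "card {..<N} \<le> card {xs. set xs \<subseteq> S \<and> length xs = n}"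
    by (rule card_inj_on_le) (use w S in \<open>auto simp: finite_lists_length_eq\<close>, blast)
  then show ?thesis using S(1) by (simp add: card_lists_length_eq)
qed

section \<open>Maximal packings and quantisation of the alphabet\<close>

text \<open>A nonempty set of extended naturals with a finite supremum is finite, so the supremum is
  a maximum; the empty packing provides nonemptiness.\<close>

lemma packing_number_attained:
  assumes "packing_number \<delta> F = enat P"
  obtains S where "finite S" "S \<subseteq> F" "\<And>x y. x \<in> S \<Longrightarrow> y \<in> S \<Longrightarrow> x \<noteq> y \<Longrightarrow> hs_norm (x - y) \<ge> \<delta>" "card S = P"
    "\<And>T. finite T \<Longrightarrow> T \<subseteq> F \<Longrightarrow> (\<And>x y. x \<in> T \<Longrightarrow> y \<in> T \<Longrightarrow> x \<noteq> y \<Longrightarrow> hs_norm (x - y) \<ge> \<delta>) \<Longrightarrow> card T \<le> P"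
proof -
  define A where "A = {enat (card S) | S. finite S \<and> S \<subseteq> F \<and> (\<forall>x\<in>S. \<forall>y\<in>S. x \<noteq> y \<longrightarrow> hs_norm (x - y) \<ge> \<delta>)}"
  have Sup: "Sup A = enat P" using assms by (simp add: packing_number_def A_def)
  have "enat 0 \<in> A" unfolding A_def by (auto intro!: exI[of _ "{}"])
  then have "A \<noteq> {}" by auto
  with Sup have "finite A" "Max A = enat P" by (auto simp: Sup_enat_def split: if_splits)
  with \<open>A \<noteq> {}\<close> have "enat P \<in> A" using Max_in[of A] by auto
  then obtain S where S: "finite S" "S \<subseteq> F" "\<forall>x\<in>S. \<forall>y\<in>S. x \<noteq> y \<longrightarrow> hs_norm (x - y) \<ge> \<delta>" "card S = P"
    unfolding A_def mem_Collect_eq by (metis enat.inject)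
  have max: "card T \<le> P" if "finite T" "T \<subseteq> F" "\<And>x y. x \<in> T \<Longrightarrow> y \<in> T \<Longrightarrow> x \<noteq> y \<Longrightarrow> hs_norm (x - y) \<ge> \<delta>" for T
  proof -
    have "enat (card T) \<in> A"
      unfolding A_def mem_Collect_eq by (intro exI[of _ T] conjI refl ballI impI that)
    then have "enat (card T) \<le> enat P" unfolding Sup[symmetric] by (rule Sup_upper)
    then show ?thesis by simp
  qed
  show ?thesis by (rule that[OF S(1,2) _ S(4) max]) (use S(3) in blast)
qed

text \<open>A point at distance at least \<open>\<delta>\<close> from every point of a largest
  packing could be added to it.\<close>

lemma packing_number_covering:
  assumes F: "F \<subseteq> carrier_mat n n" and P: "packing_number \<delta> F = enat P" and \<delta>: "\<delta> > 0"
  obtains S where "finite S" "card S = P" "S \<subseteq> F" "\<And>x. x \<in> F \<Longrightarrow> \<exists>s\<in>S. hs_norm (x - s) < \<delta>"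
proof -
  obtain S where S: "finite S" "S \<subseteq> F" "\<And>x y. x \<in> S \<Longrightarrow> y \<in> S \<Longrightarrow> x \<noteq> y \<Longrightarrow> hs_norm (x - y) \<ge> \<delta>" "card S = P"
    and max: "\<And>T. finite T \<Longrightarrow> T \<subseteq> F \<Longrightarrow> (\<And>x y. x \<in> T \<Longrightarrow> y \<in> T \<Longrightarrow> x \<noteq> y \<Longrightarrow> hs_norm (x - y) \<ge> \<delta>) \<Longrightarrow> card T \<le> P"
    using packing_number_attained[OF P] by metis
  have "\<exists>s\<in>S. hs_norm (x - s) < \<delta>" if x: "x \<in> F" for x
  proof (rule ccontr)
    assume "\<not> (\<exists>s\<in>S. hs_norm (x - s) < \<delta>)"
    then have far: "\<And>s. s \<in> S \<Longrightarrow> hs_norm (x - s) \<ge> \<delta>" by force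
    have "hs_norm (x - x) < \<delta>" using x F \<delta> by (subst hs_norm_diff_self[of _ n n]) auto
    then have "x \<notin> S" using far by fastforce
    have "hs_norm (y - z) \<ge> \<delta>" if yz: "y \<in> insert x S" "z \<in> insert x S" "y \<noteq> z" for y z
    proof -
      have "y \<in> carrier_mat n n" "z \<in> carrier_mat n n" using yz x S(2) F by auto
      then show ?thesis using yz far S(3) hs_norm_diff_commute[of y n n z] by (metis insert_iff)
    qed
    then have "card (insert x S) \<le> P" using S x by (intro max) auto
    then show False using \<open>x \<notin> S\<close> S by simp
  qed
  then show ?thesis using that S by blast
qed

lemma N_DI_le_packing_number:
  assumes W: "\<And>x. x \<in> X \<Longrightarrow> W x \<in> density d"
    and P: "packing_number \<delta> (msqrt ` W ` X) = enat P" and \<delta>: "\<delta> > 0" "2 * \<delta>\<^sup>2 \<le> 1"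
    and t: "t > 0" and gap: "(1 + t) * l2 + (1 + 1 / t) * (4 * real n * \<delta>\<^sup>2) < 1 - l1"
  shows "N_DI X d W n l1 l2 \<le> enat (P ^ n)"
proof -
  have F: "msqrt ` W ` X \<subseteq> carrier_mat d d" using msqrt_density(1)[OF W] by auto
  obtain S where S: "finite S" "card S = P" "S \<subseteq> msqrt ` W ` X"
    and cov: "\<And>x. x \<in> msqrt ` W ` X \<Longrightarrow> \<exists>s\<in>S. hs_norm (x - s) < \<delta>"
    using packing_number_covering[OF F P \<delta>(1)] by metis
  have "\<forall>x\<in>X. \<exists>s. s \<in> S \<and> hs_norm (msqrt (W x) - s) < \<delta>" using cov by blast
  then obtain c where c: "\<And>x. x \<in> X \<Longrightarrow> c x \<in> S" "\<And>x. x \<in> X \<Longrightarrow> hs_norm (msqrt (W x) - c x) < \<delta>"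
    by metis
  \<comment> \<open>Two letters with a common centre are each within \<open>\<delta>\<close> of it,
    so their squared distance is at most \<open>4 * \<delta>\<^sup>2\<close>. The parameter
    \<open>\<eta>\<close> of the size bound is therefore
    \<open>2 * \<delta>\<^sup>2\<close>.\<close>
  have near: "(hs_norm (msqrt (W x) - msqrt (W y)))\<^sup>2 \<le> 2 * (2 * \<delta>\<^sup>2)" if xy: "x \<in> X" "y \<in> X" "c x = c y" for x y
  proof -
    have m: "msqrt (W x) \<in> carrier_mat d d" "msqrt (W y) \<in> carrier_mat d d" "c y \<in> carrier_mat d d"
      using xy(1,2) msqrt_density(1)[OF W] c(1)[OF xy(2)] S(3) F by blast+
    have "(hs_norm (msqrt (W x) - c y))\<^sup>2 \<le> \<delta>\<^sup>2" "(hs_norm (c y - msqrt (W y)))\<^sup>2 \<le> \<delta>\<^sup>2"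
      using c(2)[OF xy(1)] c(2)[OF xy(2)] xy(3) hs_norm_diff_commute[OF m(2,3)] by (auto intro!: power_mono)
    then show ?thesis using hs_norm_diff_via[OF m(1,3,2)] by simp
  qed
  have "N \<le> P ^ n" if code: "is_DI_code X d W n N l1 l2 u E" for N u E
  proof -
    have "(1 + t) * l2 + (1 + 1 / t) * (2 * real n * (2 * \<delta>\<^sup>2)) < 1 - l1"
      using gap by (simp add: mult.assoc)
    with DI_code_size_le[OF W code S(1) c(1) near _ \<delta>(2) t] show ?thesis
      unfolding S(2) by fastforce
  qed
  then show ?thesis unfolding N_DI_def by (intro Sup_least) auto
qed

section \<open>Entropy of product spectra\<close>

definition shannon :: "nat \<Rightarrow> (nat \<Rightarrow> real) \<Rightarrow> real" where
  "shannon d q = - (\<Sum>i<d. q i * ln (q i))"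

text \<open>The variance of the information content \<open>- ln (q i)\<close> when \<open>i\<close>
  is drawn from \<open>q\<close>; its mean is \<open>shannon d q\<close>.\<close>

definition info_variance :: "nat \<Rightarrow> (nat \<Rightarrow> real) \<Rightarrow> real" where
  "info_variance d q = (\<Sum>i<d. q i * (ln (q i) + shannon d q)\<^sup>2)"

lemma prob_weight_bounds:
  fixes q :: "nat \<Rightarrow> real"
  assumes "\<And>i. i < d \<Longrightarrow> q i \<ge> 0" "(\<Sum>i<d. q i) = 1" "i < d"
  shows "q i \<le> 1" "q i * ln (q i) \<le> 0"
proof -
  have "q i \<le> (\<Sum>i<d. q i)" by (rule member_le_sum) (use assms in auto)
  then show "q i \<le> 1" using assms by simp
  then show "q i * ln (q i) \<le> 0"
    using assms(1)[OF assms(3)] by (cases "q i = 0") (auto intro!: mult_nonneg_nonpos)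
qed

text \<open>Each summand is at most 1 because \<open>ln (1 / q) \<le> 1 / q - 1\<close>. The result
  is weaker than \<open>ln d\<close>, but it only controls the number of entropy windows, which may
  be any polynomial in \<open>n\<close>.\<close>

lemma shannon_bounds:
  assumes "\<And>i. i < d \<Longrightarrow> q i \<ge> 0" "(\<Sum>i<d. q i) = 1"
  shows "0 \<le> shannon d q" "shannon d q \<le> real d"
proof -
  show "0 \<le> shannon d q"
    unfolding shannon_def using sum_nonpos[of "{..<d}" "\<lambda>i. q i * ln (q i)"] prob_weight_bounds(2)[OF assms] by simp
  have "- (q i * ln (q i)) \<le> 1" if "i < d" for i
  proof (cases "q i = 0")
    case False
    then have pos: "q i > 0" using assms(1)[OF that] by simp
    have "ln (1 / q i) \<le> 1 / q i - 1" using pos by (intro ln_le_minus_one) simp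
    then have "- ln (q i) \<le> 1 / q i - 1" using pos by (simp add: ln_div)
    then have "q i * (- ln (q i)) \<le> q i * (1 / q i - 1)" using pos by (intro mult_left_mono) auto
    also have "\<dots> = 1 - q i" using pos by (simp add: field_simps)
    finally show ?thesis using pos by simp
  qed simp
  then have "(\<Sum>i<d. - (q i * ln (q i))) \<le> (\<Sum>i<d. 1)" by (intro sum_mono) auto
  then show "shannon d q \<le> real d" by (simp add: shannon_def sum_negf)
qed

text \<open>The variance is at most the second moment, each summand of which is at most 4. The bound
  does not involve the smallest eigenvalue, so it is uniform over all output states.\<close>

lemma info_variance_le:
  assumes q: "\<And>i. i < d \<Longrightarrow> q i \<ge> 0" "(\<Sum>i<d. q i) = 1"
  shows "info_variance d q \<le> 4 * real d"
proof -
  define h where "h = shannon d q"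
  have e: "(\<Sum>i<d. q i * ln (q i)) = - h" by (simp add: h_def shannon_def)
  have "info_variance d q = (\<Sum>i<d. q i * (ln (q i))\<^sup>2 + 2 * h * (q i * ln (q i)) + h\<^sup>2 * q i)"
    unfolding info_variance_def h_def[symmetric]
    by (intro sum.cong refl) (simp add: power2_eq_square algebra_simps)
  also have "\<dots> = (\<Sum>i<d. q i * (ln (q i))\<^sup>2) + 2 * h * (\<Sum>i<d. q i * ln (q i)) + h\<^sup>2 * (\<Sum>i<d. q i)"
    by (simp only: sum.distrib sum_distrib_left)
  also have "\<dots> = (\<Sum>i<d. q i * (ln (q i))\<^sup>2) - h\<^sup>2" unfolding e q(2) by (simp add: power2_eq_square)
  also have "\<dots> \<le> (\<Sum>i<d. q i * (ln (q i))\<^sup>2)" by simp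
  also have "\<dots> \<le> (\<Sum>i<d. 4)"
  proof (rule sum_mono)
    fix i assume "i \<in> {..<d}"
    then have i: "i < d" by simp
    show "q i * (ln (q i))\<^sup>2 \<le> 4"
    proof (cases "q i = 0")
      case False
      then have pos: "q i > 0" using q(1)[OF i] by simp
      \<comment> \<open>Applying the linear bound on \<open>ln\<close> to \<open>1 / sqrt q\<close>
        gives \<open>- ln q \<le> 2 / sqrt q\<close>; the square of the right side times
        \<open>q\<close> is exactly 4.\<close>
      define r where "r = sqrt (q i)"
      have r: "r > 0" "r * r = q i" using pos by (auto simp: r_def)
      have "ln (1 / r) \<le> 1 / r - 1" using r by (intro ln_le_minus_one) simp
      then have "- ln r \<le> 1 / r" using r by (simp add: ln_div)
      moreover have "ln (q i) = 2 * ln r" using r by (simp flip: r(2) add: ln_mult)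
      ultimately have le: "- ln (q i) \<le> 2 / r" by simp
      have "ln (q i) \<le> 0" using prob_weight_bounds(1)[OF q i] pos by simp
      then have "(- ln (q i))\<^sup>2 \<le> (2 / r)\<^sup>2" using le by (intro power_mono) auto
      then have "q i * (ln (q i))\<^sup>2 \<le> q i * (2 / r)\<^sup>2" using pos by (intro mult_left_mono) auto
      also have "\<dots> = 4" using r by (simp flip: r(2) add: power2_eq_square)
      finally show ?thesis .
    qed simp
  qed
  finally show ?thesis by simp
qed

definition word_entropy :: "nat \<Rightarrow> ('a \<Rightarrow> nat \<Rightarrow> real) \<Rightarrow> 'a list \<Rightarrow> real" where
  "word_entropy d p xs = (\<Sum>x\<leftarrow>xs. shannon d (p x))"

text \<open>Since \<open>ln 0 = 0\<close>, the logarithm of a product need not split when a factor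
  vanishes. In that case the weight in front is zero, so the weighted identity always holds.\<close>

lemma prod_spectrum_ln:
  "prod_spectrum d p (x # xs) i * f (ln (prod_spectrum d p (x # xs) i))
    = prod_spectrum d p (x # xs) i * f (ln (p x (i div d ^ length xs)) + ln (prod_spectrum d p xs (i mod d ^ length xs)))"
  if "p x (i div d ^ length xs) \<ge> 0" "prod_spectrum d p xs (i mod d ^ length xs) \<ge> 0" for f :: "real \<Rightarrow> real"
  using that by (cases "p x (i div d ^ length xs) = 0 \<or> prod_spectrum d p xs (i mod d ^ length xs) = 0") (auto simp: ln_mult)

lemma sum_prod_spectrum_Cons:
  fixes f :: "real \<Rightarrow> real"
  assumes "\<And>y i. y \<in> set (x # xs) \<Longrightarrow> i < d \<Longrightarrow> p y i \<ge> 0"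
  shows "(\<Sum>i<d ^ length (x # xs). prod_spectrum d p (x # xs) i * f (ln (prod_spectrum d p (x # xs) i)))
    = (\<Sum>i<d. \<Sum>j<d ^ length xs. (p x i * prod_spectrum d p xs j) * f (ln (p x i) + ln (prod_spectrum d p xs j)))"
proof -
  let ?m = "d ^ length xs"
  have "(\<Sum>i<d ^ length (x # xs). prod_spectrum d p (x # xs) i * f (ln (prod_spectrum d p (x # xs) i)))
    = (\<Sum>i<d * ?m. (p x (i div ?m) * prod_spectrum d p xs (i mod ?m)) * f (ln (p x (i div ?m)) + ln (prod_spectrum d p xs (i mod ?m))))"
  proof (rule sum.cong)
    fix i assume "i \<in> {..<d * ?m}"
    then have i: "i < d * ?m" by simp
    have "p x (i div ?m) \<ge> 0" "prod_spectrum d p xs (i mod ?m) \<ge> 0"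
      using assms div_mod_less[OF i] prod_spectrum_nonneg[of xs d p "i mod ?m"] by auto
    from prod_spectrum_ln[of p x i d xs f, OF this]
    show "prod_spectrum d p (x # xs) i * f (ln (prod_spectrum d p (x # xs) i))
      = (p x (i div ?m) * prod_spectrum d p xs (i mod ?m)) * f (ln (p x (i div ?m)) + ln (prod_spectrum d p xs (i mod ?m)))"
      by simp
  qed simp
  then show ?thesis
    using sum_lessThan_div_mod[where f = "\<lambda>i j. (p x i * prod_spectrum d p xs j) * f (ln (p x i) + ln (prod_spectrum d p xs j))"
        and b = d and m = ?m] by simp
qed

lemma word_entropy_eq:
  assumes "\<And>x i. x \<in> set xs \<Longrightarrow> i < d \<Longrightarrow> p x i \<ge> 0" "\<And>x. x \<in> set xs \<Longrightarrow> (\<Sum>i<d. p x i) = 1"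
  shows "(\<Sum>i<d ^ length xs. prod_spectrum d p xs i * ln (prod_spectrum d p xs i)) = - word_entropy d p xs"
  using assms
proof (induction xs)
  case Nil then show ?case by (simp add: word_entropy_def)
next
  case (Cons x xs)
  let ?m = "d ^ length xs" and ?q = "prod_spectrum d p xs"
  have q1: "(\<Sum>j<?m. ?q j) = 1" by (rule prod_spectrum_sum) (use Cons.prems in auto)
  have p1: "(\<Sum>i<d. p x i) = 1" using Cons.prems by simp
  have "(\<Sum>i<d ^ length (x # xs). prod_spectrum d p (x # xs) i * ln (prod_spectrum d p (x # xs) i))
      = (\<Sum>i<d. \<Sum>j<?m. (p x i * ?q j) * (ln (p x i) + ln (?q j)))"
    using sum_prod_spectrum_Cons[of x xs d p "\<lambda>z. z"] Cons.prems by auto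
  also have "\<dots> = (\<Sum>i<d. \<Sum>j<?m. (p x i * ln (p x i)) * ?q j) + (\<Sum>i<d. \<Sum>j<?m. p x i * (?q j * ln (?q j)))"
    unfolding sum.distrib[symmetric] by (intro sum.cong refl) (simp add: algebra_simps)
  also have "\<dots> = (\<Sum>i<d. p x i * ln (p x i)) * (\<Sum>j<?m. ?q j) + (\<Sum>i<d. p x i) * (\<Sum>j<?m. ?q j * ln (?q j))"
    by (simp only: sum_product)
  also have "\<dots> = - shannon d (p x) - word_entropy d p xs"
    unfolding q1 p1 using Cons by (simp add: shannon_def)
  finally show ?case by (simp add: word_entropy_def)
qed

text \<open>Additivity of variance for independent summands: the log-eigenvalue of a product state
  is the sum of those of its letters. After centring, the mixed term factors into the two means
  \<open>p2\<close> and \<open>q2\<close>, both zero.\<close>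

lemma word_info_variance:
  assumes "\<And>x i. x \<in> set xs \<Longrightarrow> i < d \<Longrightarrow> p x i \<ge> 0" "\<And>x. x \<in> set xs \<Longrightarrow> (\<Sum>i<d. p x i) = 1"
  shows "(\<Sum>i<d ^ length xs. prod_spectrum d p xs i * (ln (prod_spectrum d p xs i) + word_entropy d p xs)\<^sup>2)
    = (\<Sum>x\<leftarrow>xs. info_variance d (p x))"
  using assms
proof (induction xs)
  case Nil then show ?case by (simp add: word_entropy_def)
next
  case (Cons x xs)
  let ?m = "d ^ length xs" and ?q = "prod_spectrum d p xs"
  define H where "H = word_entropy d p xs"
  define h where "h = shannon d (p x)"
  have q1: "(\<Sum>j<?m. ?q j) = 1" by (rule prod_spectrum_sum) (use Cons.prems in auto)
  have p1: "(\<Sum>i<d. p x i) = 1" using Cons.prems by simp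
  have q2: "(\<Sum>j<?m. ?q j * (ln (?q j) + H)) = 0"
    using word_entropy_eq[of xs d p] Cons.prems q1
    by (simp add: distrib_left sum.distrib H_def sum_distrib_right[symmetric])
  have p2: "(\<Sum>i<d. p x i * (ln (p x i) + h)) = 0"
  proof -
    have "(\<Sum>i<d. p x i * (ln (p x i) + h)) = (\<Sum>i<d. p x i * ln (p x i)) + (\<Sum>i<d. p x i) * h"
      by (simp only: distrib_left sum.distrib sum_distrib_right)
    then show ?thesis unfolding p1 h_def shannon_def by simp
  qed
  have "(\<Sum>i<d ^ length (x # xs). prod_spectrum d p (x # xs) i * (ln (prod_spectrum d p (x # xs) i) + word_entropy d p (x # xs))\<^sup>2)
      = (\<Sum>i<d. \<Sum>j<?m. (p x i * ?q j) * (ln (p x i) + ln (?q j) + word_entropy d p (x # xs))\<^sup>2)"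
    using sum_prod_spectrum_Cons[of x xs d p "\<lambda>z. (z + word_entropy d p (x # xs))\<^sup>2"] Cons.prems by auto
  also have "\<dots> = (\<Sum>i<d. \<Sum>j<?m. (p x i * (ln (p x i) + h)\<^sup>2) * ?q j)
      + (\<Sum>i<d. \<Sum>j<?m. p x i * (?q j * (ln (?q j) + H)\<^sup>2))
      + 2 * (\<Sum>i<d. \<Sum>j<?m. (p x i * (ln (p x i) + h)) * (?q j * (ln (?q j) + H)))"
    unfolding sum.distrib[symmetric] sum_distrib_left
    by (intro sum.cong refl) (simp add: word_entropy_def h_def H_def power2_eq_square algebra_simps)
  also have "\<dots> = (\<Sum>i<d. p x i * (ln (p x i) + h)\<^sup>2) * (\<Sum>j<?m. ?q j)
      + (\<Sum>i<d. p x i) * (\<Sum>j<?m. ?q j * (ln (?q j) + H)\<^sup>2)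
      + 2 * ((\<Sum>i<d. p x i * (ln (p x i) + h)) * (\<Sum>j<?m. ?q j * (ln (?q j) + H)))"
    by (simp only: sum_product)
  also have "\<dots> = info_variance d (p x) + (\<Sum>x\<leftarrow>xs. info_variance d (p x))"
    unfolding q1 p1 q2 p2 using Cons by (simp add: info_variance_def h_def H_def)
  finally show ?case by simp
qed

text \<open>Chebyshev's inequality for the log-eigenvalue of a word. Vanishing eigenvalues carry no
  weight, so the deviation is demanded only of the others.\<close>

lemma word_info_deviation:
  assumes p: "\<And>x i. x \<in> set xs \<Longrightarrow> i < d \<Longrightarrow> p x i \<ge> 0" "\<And>x. x \<in> set xs \<Longrightarrow> (\<Sum>i<d. p x i) = 1"
    and a: "a > 0" and B: "\<And>i. i \<in> B \<Longrightarrow> i < d ^ length xs"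
      "\<And>i. i \<in> B \<Longrightarrow> prod_spectrum d p xs i \<noteq> 0 \<Longrightarrow> \<bar>ln (prod_spectrum d p xs i) + word_entropy d p xs\<bar> \<ge> a"
  shows "(\<Sum>i\<in>B. prod_spectrum d p xs i) \<le> 4 * real d * real (length xs) / a\<^sup>2"
proof -
  let ?q = "prod_spectrum d p xs" and ?Z = "\<lambda>i. (ln (prod_spectrum d p xs i) + word_entropy d p xs)\<^sup>2"
  have q0: "?q i \<ge> 0" if "i < d ^ length xs" for i by (rule prod_spectrum_nonneg) (use p that in auto)
  have "(\<Sum>i\<in>B. ?q i) \<le> (\<Sum>i\<in>B. ?q i * ?Z i / a\<^sup>2)"
  proof (rule sum_mono)
    fix i assume i: "i \<in> B"
    show "?q i \<le> ?q i * ?Z i / a\<^sup>2"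
    proof (cases "?q i = 0")
      case False
      have "a\<^sup>2 \<le> ?Z i" using power_mono[OF B(2)[OF i False], of 2] a by simp
      then have "?q i * 1 \<le> ?q i * (?Z i / a\<^sup>2)"
        using a q0[OF B(1)[OF i]] by (intro mult_left_mono) auto
      then show ?thesis by simp
    qed simp
  qed
  also have "\<dots> \<le> (\<Sum>i<d ^ length xs. ?q i * ?Z i / a\<^sup>2)"
    using B(1) q0 by (intro sum_mono2) auto
  also have "\<dots> = (\<Sum>x\<leftarrow>xs. info_variance d (p x)) / a\<^sup>2"
    using word_info_variance[of xs d p] p by (simp add: sum_divide_distrib[symmetric])
  also have "(\<Sum>x\<leftarrow>xs. info_variance d (p x)) \<le> (\<Sum>x\<leftarrow>xs. 4 * real d)"
    by (rule sum_list_mono) (use p info_variance_le in auto)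
  also have "(\<Sum>x\<leftarrow>xs. 4 * real d) = 4 * real d * real (length xs)" by (simp add: sum_list_triv)
  finally show ?thesis using a by (simp add: divide_right_mono)
qed

lemma word_entropy_bounds:
  assumes "\<And>x i. x \<in> set xs \<Longrightarrow> i < d \<Longrightarrow> p x i \<ge> 0" "\<And>x. x \<in> set xs \<Longrightarrow> (\<Sum>i<d. p x i) = 1"
  shows "0 \<le> word_entropy d p xs" "word_entropy d p xs \<le> real d * real (length xs)"
proof -
  have "0 \<le> shannon d (p x) \<and> shannon d (p x) \<le> real d" if "x \<in> set xs" for x
    using shannon_bounds[of d "p x"] assms that by simp
  then have "0 \<le> word_entropy d p xs \<and> word_entropy d p xs \<le> real d * real (length xs)"
    unfolding word_entropy_def by (induction xs) (auto simp: algebra_simps intro: add_mono)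
  then show "0 \<le> word_entropy d p xs" "word_entropy d p xs \<le> real d * real (length xs)" by auto
qed

section \<open>Codes in the Hamming metric\<close>

definition hamming :: "'a list \<Rightarrow> 'a list \<Rightarrow> nat" where
  "hamming u v = length (filter (\<lambda>(x, y). x \<noteq> y) (zip u v))"

lemma hamming_Cons [simp]: "hamming (x # u) (y # v) = (if x = y then hamming u v else Suc (hamming u v))"
  by (simp add: hamming_def)

lemma hamming_refl [simp]: "hamming u u = 0"
  by (induction u) (auto simp: hamming_def)

lemma hamming_commute: "length u = length v \<Longrightarrow> hamming u v = hamming v u"
  by (induction u v rule: list_induct2) auto

text \<open>Either the first letter is kept and the radius stays, or it is replaced in at most
  \<open>card Y\<close> ways and the radius drops by one. Both branches satisfy the same bound, so
  each letter doubles it. The factor \<open>2 ^ n\<close> costs \<open>n\<close> bits, negligible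
  against \<open>n * log n\<close>.\<close>

lemma hamming_ball_card:
  assumes Y: "finite Y" "Y \<noteq> {}"
  shows "card {v. set v \<subseteq> Y \<and> length v = length w \<and> hamming w v \<le> r} \<le> 2 ^ length w * card Y ^ r"
proof (induction w arbitrary: r)
  case Nil
  have "{v. set v \<subseteq> Y \<and> length v = length [] \<and> hamming [] v \<le> r} = {[]}" by (auto simp: hamming_def)
  moreover have "1 \<le> card Y ^ r" using Y by (simp add: Suc_le_eq card_gt_0_iff)
  ultimately show ?case by simp
next
  case (Cons x w)
  define Ball where "Ball r = {v. set v \<subseteq> Y \<and> length v = length w \<and> hamming w v \<le> r}" for r
  define Ball' where "Ball' = {v. set v \<subseteq> Y \<and> length v = length (x # w) \<and> hamming (x # w) v \<le> r}"
  have fin: "finite (Ball r)" for r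
    by (rule finite_subset[OF _ finite_lists_length_eq[OF Y(1), of "length w"]]) (auto simp: Ball_def)
  have IH: "card (Ball r) \<le> 2 ^ length w * card Y ^ r" for r
    using Cons.IH by (simp add: Ball_def)
  show ?case
  proof (cases r)
    case 0
    have "Ball' \<subseteq> (#) x ` Ball 0"
      by (auto simp: Ball'_def Ball_def 0 length_Suc_conv split: if_splits)
    then have "card Ball' \<le> card (Ball 0)"
      using card_mono[OF finite_imageI[OF fin]] card_image_le[OF fin] le_trans by blast
    also have "\<dots> \<le> 2 ^ length w * card Y ^ 0" by (rule IH)
    finally show ?thesis by (simp add: Ball'_def 0)
  next
    case (Suc r')
    have "Ball' \<subseteq> (#) x ` Ball r \<union> (\<Union>y\<in>Y. (#) y ` Ball r')"
      by (auto simp: Ball'_def Ball_def Suc length_Suc_conv split: if_splits)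
    then have "card Ball' \<le> card ((#) x ` Ball r \<union> (\<Union>y\<in>Y. (#) y ` Ball r'))"
      by (rule card_mono[rotated]) (use fin Y in auto)
    also have "\<dots> \<le> card ((#) x ` Ball r) + card (\<Union>y\<in>Y. (#) y ` Ball r')" by (rule card_Un_le)
    also have "card (\<Union>y\<in>Y. (#) y ` Ball r') \<le> (\<Sum>y\<in>Y. card ((#) y ` Ball r'))" by (rule card_UN_le[OF Y(1)])
    also have "\<dots> \<le> (\<Sum>y\<in>Y. 2 ^ length w * card Y ^ r')"
      by (rule sum_mono) (use card_image_le[OF fin] IH le_trans in blast)
    also have "\<dots> = 2 ^ length w * card Y ^ r" by (simp add: Suc)
    also have "card ((#) x ` Ball r) \<le> 2 ^ length w * card Y ^ r"
      using card_image_le[OF fin] IH le_trans by blast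
    finally show ?thesis by (simp add: Ball'_def)
  qed
qed

text \<open>The Gilbert--Varshamov bound: the balls around a maximal code cover everything.\<close>

lemma hamming_code_exists:
  assumes Y: "finite Y" "Y \<noteq> {}"
  obtains C where "finite C" "\<And>u. u \<in> C \<Longrightarrow> set u \<subseteq> Y \<and> length u = n"
    "\<And>u v. u \<in> C \<Longrightarrow> v \<in> C \<Longrightarrow> u \<noteq> v \<Longrightarrow> hamming u v > r"
    "card Y ^ n \<le> card C * (2 ^ n * card Y ^ r)"
proof -
  define A where "A = {v. set v \<subseteq> Y \<and> length v = n}"
  have finA: "finite A" unfolding A_def by (rule finite_lists_length_eq[OF Y(1)])
  have cardA: "card A = card Y ^ n" unfolding A_def by (rule card_lists_length_eq[OF Y(1)])
  define code where "code C \<longleftrightarrow> C \<subseteq> A \<and> (\<forall>u\<in>C. \<forall>v\<in>C. u \<noteq> v \<longrightarrow> hamming u v > r)" for C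
  have "finite {C. code C}"
    by (rule finite_subset[of _ "Pow A"]) (use finA in \<open>auto simp: code_def\<close>)
  moreover have "{C. code C} \<noteq> {}" by (auto simp: code_def intro!: exI[of _ "{}"])
  ultimately obtain C where C: "code C" and max: "\<And>B. code B \<Longrightarrow> C \<subseteq> B \<Longrightarrow> C = B"
    using finite_has_maximal[of "{C. code C}"] by auto
  have CA: "C \<subseteq> A" and sep: "\<And>u v. u \<in> C \<Longrightarrow> v \<in> C \<Longrightarrow> u \<noteq> v \<Longrightarrow> hamming u v > r"
    using C by (auto simp: code_def)
  have finC: "finite C" using CA finA by (rule finite_subset)
  have "A \<subseteq> (\<Union>c\<in>C. {v. set v \<subseteq> Y \<and> length v = length c \<and> hamming c v \<le> r})"
  proof
    fix v assume v: "v \<in> A"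
    have "\<exists>c\<in>C. hamming c v \<le> r"
    proof (cases "v \<in> C")
      case False
      show ?thesis
      proof (rule ccontr)
        assume "\<not> (\<exists>c\<in>C. hamming c v \<le> r)"
        then have far: "hamming c v > r" if "c \<in> C" for c using that by auto
        have far': "hamming v c > r" if "c \<in> C" for c
        proof -
          have "length v = length c" using v that CA by (auto simp: A_def)
          then show ?thesis using far[OF that] hamming_commute by metis
        qed
        have "code (insert v C)"
          using CA v sep far far' by (auto simp: code_def)
        then have "C = insert v C" by (rule max) auto
        then show False using False by blast
      qed
    qed (auto intro!: bexI[of _ v])
    then show "v \<in> (\<Union>c\<in>C. {v. set v \<subseteq> Y \<and> length v = length c \<and> hamming c v \<le> r})"
      using v CA by (fastforce simp: A_def)
  qed
  then have "card A \<le> card (\<Union>c\<in>C. {v. set v \<subseteq> Y \<and> length v = length c \<and> hamming c v \<le> r})"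
    by (rule card_mono[rotated]) (use finC finite_lists_length_eq[OF Y(1)] in \<open>auto intro: rev_finite_subset\<close>)
  also have "\<dots> \<le> (\<Sum>c\<in>C. card {v. set v \<subseteq> Y \<and> length v = length c \<and> hamming c v \<le> r})"
    by (rule card_UN_le[OF finC])
  also have "\<dots> \<le> (\<Sum>c\<in>C. 2 ^ n * card Y ^ r)"
  proof (rule sum_mono)
    fix c assume "c \<in> C"
    then have "length c = n" using CA by (auto simp: A_def)
    then show "card {v. set v \<subseteq> Y \<and> length v = length c \<and> hamming c v \<le> r} \<le> 2 ^ n * card Y ^ r"
      using hamming_ball_card[OF Y, of c r] by simp
  qed
  finally have "card Y ^ n \<le> card C * (2 ^ n * card Y ^ r)" by (simp add: cardA)
  then show ?thesis using that[OF finC _ sep] CA by (auto simp: A_def)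
qed

section \<open>Typicality tests\<close>

text \<open>In the two eigenbases the trace is a sum of products of roots of eigenvalues and squared
  overlaps. Nonnegativity of the one-letter overlaps is what allows their upper bounds to be
  multiplied along a word.\<close>

lemma mtrace_msqrt_mult_nonneg:
  assumes "\<rho> \<in> density d" "\<sigma> \<in> density d"
  shows "Re (mtrace (msqrt \<rho> * msqrt \<sigma>)) \<ge> 0"
proof -
  obtain U p where U: "unitary_mat d U" "\<rho> = conj_diag d U p" "\<And>i. i < d \<Longrightarrow> p i \<ge> 0"
    using density_spectral[OF assms(1)] by metis
  obtain V q where V: "unitary_mat d V" "\<sigma> = conj_diag d V q" "\<And>i. i < d \<Longrightarrow> q i \<ge> 0"
    using density_spectral[OF assms(2)] by metis
  have "msqrt \<rho> = conj_diag d U (\<lambda>i. sqrt (p i))" "msqrt \<sigma> = conj_diag d V (\<lambda>i. sqrt (q i))"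
    unfolding U(2) V(2) by (rule msqrt_conj_diag[OF U(1)], rule U(3), assumption,
      rule msqrt_conj_diag[OF V(1)], rule V(3))
  then have "mtrace (msqrt \<rho> * msqrt \<sigma>)
      = of_real (\<Sum>i<d. \<Sum>j<d. sqrt (p i) * sqrt (q j) * (cmod ((adj U * V) $$ (i, j)))\<^sup>2)"
    by (simp only: mtrace_conj_diag_mult[OF U(1) V(1)])
  then have "Re (mtrace (msqrt \<rho> * msqrt \<sigma>))
      = (\<Sum>i<d. \<Sum>j<d. sqrt (p i) * sqrt (q j) * (cmod ((adj U * V) $$ (i, j)))\<^sup>2)"
    by (simp only: Re_complex_of_real)
  also have "\<dots> \<ge> 0" by (intro sum_nonneg mult_nonneg_nonneg) (use U(3) V(3) in auto)
  finally show ?thesis .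
qed

text \<open>Each position where the words differ contributes a factor of at most
  \<open>1 - \<delta>\<^sup>2 / 2 \<le> exp (- \<delta>\<^sup>2 / 2)\<close>; the other positions
  contribute at most 1.\<close>

lemma hs_overlap_le:
  assumes W: "\<And>x. x \<in> X \<Longrightarrow> W x \<in> density d" and Y: "Y \<subseteq> X" and uv: "set u \<subseteq> Y" "set v \<subseteq> Y" "length u = length v"
    and sep: "\<And>x y. x \<in> Y \<Longrightarrow> y \<in> Y \<Longrightarrow> x \<noteq> y \<Longrightarrow> hs_norm (msqrt (W x) - msqrt (W y)) \<ge> \<delta>" and \<delta>: "\<delta> \<ge> 0"
  shows "Re (mtrace (tensor_word (\<lambda>x. msqrt (W x)) u * tensor_word (\<lambda>x. msqrt (W x)) v))
    \<le> exp (- (real (hamming u v) * \<delta>\<^sup>2 / 2))"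
proof -
  let ?f = "\<lambda>(x, y). 1 - (hs_norm (msqrt (W x) - msqrt (W y)))\<^sup>2 / 2"
  have f0: "1 - (hs_norm (msqrt (W x) - msqrt (W y)))\<^sup>2 / 2 \<ge> 0" if "x \<in> Y" "y \<in> Y" for x y
    using mtrace_msqrt_mult_nonneg[OF W W, of x y] mtrace_msqrt_mult[OF W W, of x y] that Y by auto
  have f1: "1 - (hs_norm (msqrt (W x) - msqrt (W y)))\<^sup>2 / 2 \<le> exp (- (\<delta>\<^sup>2 / 2))" if "x \<in> Y" "y \<in> Y" "x \<noteq> y" for x y
  proof -
    have "\<delta>\<^sup>2 \<le> (hs_norm (msqrt (W x) - msqrt (W y)))\<^sup>2" using sep[OF that] \<delta> by (intro power_mono)
    then have "1 - (hs_norm (msqrt (W x) - msqrt (W y)))\<^sup>2 / 2 \<le> 1 + (- (\<delta>\<^sup>2 / 2))" by simp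
    also have "\<dots> \<le> exp (- (\<delta>\<^sup>2 / 2))" by (rule exp_ge_add_one_self)
    finally show ?thesis .
  qed
  have "0 \<le> prod_list (map ?f (zip u v)) \<and> prod_list (map ?f (zip u v)) \<le> exp (- (real (hamming u v) * \<delta>\<^sup>2 / 2))"
    using uv(3,1,2)
  proof (induction u v rule: list_induct2)
    case Nil then show ?case by (simp add: hamming_def)
  next
    case (Cons x u y v)
    then have xy: "x \<in> Y" "y \<in> Y"
      and IH: "0 \<le> prod_list (map ?f (zip u v))" "prod_list (map ?f (zip u v)) \<le> exp (- (real (hamming u v) * \<delta>\<^sup>2 / 2))"
      by auto
    have "1 - (hs_norm (msqrt (W x) - msqrt (W y)))\<^sup>2 / 2 \<le> (if x = y then 1 else exp (- (\<delta>\<^sup>2 / 2)))"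
      using f1[OF xy] by auto
    then have "(1 - (hs_norm (msqrt (W x) - msqrt (W y)))\<^sup>2 / 2) * prod_list (map ?f (zip u v))
       \<le> (if x = y then 1 else exp (- (\<delta>\<^sup>2 / 2))) * exp (- (real (hamming u v) * \<delta>\<^sup>2 / 2))"
      using IH f0[OF xy] by (intro mult_mono) auto
    also have "\<dots> = exp (- (real (hamming (x # u) (y # v)) * \<delta>\<^sup>2 / 2))"
    proof (cases "x = y")
      case False
      have "- (\<delta>\<^sup>2 / 2) + - (real (hamming u v) * \<delta>\<^sup>2 / 2) = - (real (Suc (hamming u v)) * \<delta>\<^sup>2 / 2)"
        by (simp add: algebra_simps add_divide_distrib)
      then show ?thesis using False by (simp only: mult_exp_exp hamming_Cons if_False)
    qed simp
    finally show ?case using f0[OF xy] IH(1) by simp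
  qed
  moreover have "set u \<subseteq> X" "set v \<subseteq> X" using uv Y by auto
  ultimately show ?thesis
    using mtrace_tensor_msqrt_mult[OF W _ _ uv(3)] by simp
qed

section \<open>Tests for words and their error probabilities\<close>

text \<open>One eigenbasis and one eigenvalue list are fixed per letter, so every product state
  comes with an explicit eigenbasis, the tensor product of the chosen ones.\<close>

locale spectral_channel =
  fixes X :: "'a set" and d :: nat and W U :: "'a \<Rightarrow> complex mat" and p :: "'a \<Rightarrow> nat \<Rightarrow> real"
  assumes U: "x \<in> X \<Longrightarrow> unitary_mat d (U x)"
    and W_eq: "x \<in> X \<Longrightarrow> W x = conj_diag d (U x) (p x)"
    and p_nonneg: "x \<in> X \<Longrightarrow> i < d \<Longrightarrow> p x i \<ge> 0"
    and p_sum: "x \<in> X \<Longrightarrow> (\<Sum>i<d. p x i) = 1"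
begin

abbreviation spec :: "'a list \<Rightarrow> nat \<Rightarrow> real" where "spec \<equiv> prod_spectrum d p"
abbreviation entropy :: "'a list \<Rightarrow> real" where "entropy \<equiv> word_entropy d p"

text \<open>The cutoff is one-sided: large eigenvalues are accepted, since the bound on false
  acceptance uses only a lower bound on the accepted eigenvalues.\<close>

definition typ_test :: "real \<Rightarrow> 'a list \<Rightarrow> complex mat" where
  "typ_test a u = conj_diag (d ^ length u) (tensor_word U u)
     (\<lambda>i. if spec u i \<ge> exp (- (entropy u + a)) then 1 else 0)"

lemma unitary_word: "set u \<subseteq> X \<Longrightarrow> unitary_mat (d ^ length u) (tensor_word U u)"
  by (rule unitary_tensor_word) (use U in blast)

lemma spec_nonneg: "set u \<subseteq> X \<Longrightarrow> i < d ^ length u \<Longrightarrow> spec u i \<ge> 0"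
  by (rule prod_spectrum_nonneg) (use p_nonneg in blast)+

lemma spec_sum: "set u \<subseteq> X \<Longrightarrow> (\<Sum>i<d ^ length u. spec u i) = 1"
  by (rule prod_spectrum_sum) (use p_sum in blast)

lemma tensor_word_W:
  assumes "set u \<subseteq> X"
  shows "tensor_word W u = conj_diag (d ^ length u) (tensor_word U u) (spec u)"
proof -
  have "tensor_word W u = tensor_word (\<lambda>x. conj_diag d (U x) (p x)) u"
    by (rule tensor_word_cong) (use assms W_eq in blast)
  also have "\<dots> = conj_diag (d ^ length u) (tensor_word U u) (spec u)"
    by (rule tensor_word_conj_diag) (use assms U unitary_matD(1) in blast)
  finally show ?thesis .
qed

lemma tensor_word_msqrt_W:
  assumes "set u \<subseteq> X"
  shows "tensor_word (\<lambda>x. msqrt (W x)) u = conj_diag (d ^ length u) (tensor_word U u) (\<lambda>i. sqrt (spec u i))"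
proof -
  have "msqrt (W x) = conj_diag d (U x) (\<lambda>i. sqrt (p x i))" if "x \<in> set u" for x
  proof -
    have x: "x \<in> X" using assms that by auto
    show ?thesis unfolding W_eq[OF x] by (rule msqrt_conj_diag[OF U[OF x] p_nonneg[OF x]])
  qed
  then have "tensor_word (\<lambda>x. msqrt (W x)) u = tensor_word (\<lambda>x. conj_diag d (U x) (\<lambda>i. sqrt (p x i))) u"
    by (rule tensor_word_cong)
  also have "\<dots> = conj_diag (d ^ length u) (tensor_word U u) (prod_spectrum d (\<lambda>x i. sqrt (p x i)) u)"
    by (rule tensor_word_conj_diag) (use assms U unitary_matD(1) in blast)
  also have "prod_spectrum d (\<lambda>x i. sqrt (p x i)) u = (\<lambda>i. sqrt (spec u i))"
    by (rule ext) (rule prod_spectrum_sqrt)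
  finally show ?thesis .
qed

lemma typ_test_effect:
  assumes "set u \<subseteq> X"
  shows "effect (d ^ length u) (typ_test a u)"
proof -
  let ?D = "d ^ length u" and ?V = "tensor_word U u"
  let ?g = "\<lambda>i. if spec u i \<ge> exp (- (entropy u + a)) then 1 else 0 :: real"
  note V = unitary_word[OF assms]
  note v = unitary_matD[OF V]
  have "1\<^sub>m ?D - conj_diag ?D ?V ?g = conj_diag ?D ?V (\<lambda>i. 1 - ?g i)"
    unfolding conj_diag_one[OF V, symmetric] by (rule conj_diag_minus[OF v(1)])
  moreover have "psd (conj_diag ?D ?V ?g)" "psd (conj_diag ?D ?V (\<lambda>i. 1 - ?g i))"
    by (rule psd_conj_diag[OF v(1)]; simp)+
  ultimately show ?thesis
    using v(1) by (simp add: effect_def typ_test_def)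
qed

lemma deviation:
  assumes u: "set u \<subseteq> X" and a: "a > 0" and B: "\<And>i. i \<in> B \<Longrightarrow> i < d ^ length u"
    "\<And>i. i \<in> B \<Longrightarrow> spec u i > 0 \<Longrightarrow> \<bar>ln (spec u i) + entropy u\<bar> \<ge> a"
  shows "(\<Sum>i\<in>B. spec u i) \<le> 4 * real d * real (length u) / a\<^sup>2"
proof (rule word_info_deviation[OF _ _ a B(1)])
  fix i assume "i \<in> B" "spec u i \<noteq> 0"
  then show "\<bar>ln (spec u i) + entropy u\<bar> \<ge> a"
    using spec_nonneg[OF u B(1)] B(2) by fastforce
qed (use u p_nonneg p_sum in blast)+

text \<open>State and test are diagonal in the same basis, so the rejected mass is exactly the lower
  tail of the spectrum, to which the deviation bound applies.\<close>

lemma typ_test_self: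
  assumes u: "set u \<subseteq> X" and a: "a > 0"
  shows "Re (mtrace (tensor_word W u * typ_test a u)) \<ge> 1 - 4 * real d * real (length u) / a\<^sup>2"
proof -
  let ?D = "d ^ length u"
  let ?g = "\<lambda>i. if spec u i \<ge> exp (- (entropy u + a)) then 1 else 0 :: real"
  define B where "B = {i. i < ?D \<and> spec u i < exp (- (entropy u + a))}"
  note V = unitary_word[OF u]
  have "Re (mtrace (tensor_word W u * typ_test a u)) = (\<Sum>i<?D. spec u i * ?g i)"
    unfolding tensor_word_W[OF u] typ_test_def conj_diag_mult[OF V] mtrace_conj_diag[OF V] by (simp only: Re_complex_of_real)
  also have "\<dots> = (\<Sum>i<?D. spec u i) - (\<Sum>i<?D. spec u i * (1 - ?g i))"
    by (simp only: sum_subtractf[symmetric]) (simp add: algebra_simps)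
  also have "(\<Sum>i<?D. spec u i * (1 - ?g i)) = (\<Sum>i\<in>B. spec u i)"
    by (rule sum.mono_neutral_cong_right) (auto simp: B_def)
  finally have eq: "Re (mtrace (tensor_word W u * typ_test a u)) = 1 - (\<Sum>i\<in>B. spec u i)"
    unfolding spec_sum[OF u] .
  have "(\<Sum>i\<in>B. spec u i) \<le> 4 * real d * real (length u) / a\<^sup>2"
  proof (rule deviation[OF u a])
    fix i assume i: "i \<in> B" "spec u i > 0"
    then have "ln (spec u i) < ln (exp (- (entropy u + a)))"
      by (subst ln_less_cancel_iff) (auto simp: B_def)
    then show "\<bar>ln (spec u i) + entropy u\<bar> \<ge> a" by simp
  qed (simp add: B_def)
  then show ?thesis unfolding eq by simp
qed

text \<open>Pairs of eigenvectors carry the weights \<open>spec v i * q i j\<close>. Where the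
  eigenvalue of \<open>v\<close> is atypically large, Chebyshev bounds the mass. Elsewhere
  acceptance forces \<open>sqrt (spec v i) \<le> c * sqrt (spec u j)\<close>, so the weight is at
  most \<open>c\<close> times the corresponding term of the overlap of the two roots.\<close>

lemma typ_test_cross:
  assumes u: "set u \<subseteq> X" and v: "set v \<subseteq> X" and len: "length v = length u" and a: "a > 0"
  shows "Re (mtrace (tensor_word W v * typ_test a u))
    \<le> 4 * real d * real (length u) / a\<^sup>2 + exp ((entropy u - entropy v) / 2 + a)
        * Re (mtrace (tensor_word (\<lambda>x. msqrt (W x)) v * tensor_word (\<lambda>x. msqrt (W x)) u))"
proof -
  define D where "D = d ^ length u"
  define g where "g i = (if spec u i \<ge> exp (- (entropy u + a)) then 1 else 0 :: real)" for i
  define q where "q i j = (cmod ((adj (tensor_word U v) * tensor_word U u) $$ (i, j)))\<^sup>2" for i j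
  \<comment> \<open>The ratio of the square roots of the two thresholds: the upper one
    \<open>exp (- (entropy v - a))\<close> for \<open>v\<close> over the lower one
    \<open>exp (- (entropy u + a))\<close> for \<open>u\<close>.\<close>
  define c where "c = exp ((entropy u - entropy v) / 2 + a)"
  define B where "B = {i. i < D \<and> spec v i > exp (- (entropy v - a))}"
  note Uu = unitary_word[OF u, folded D_def] and Uv = unitary_word[OF v, unfolded len, folded D_def]
  have q0: "q i j \<ge> 0" for i j by (simp add: q_def)
  have su: "spec u i \<ge> 0" if "i < D" for i using spec_nonneg[OF u] that by (simp add: D_def)
  have sv: "spec v i \<ge> 0" if "i < D" for i using spec_nonneg[OF v] that by (simp add: D_def len)
  have point: "spec v i * g j * q i j \<le> (if i \<in> B then spec v i * q i j else 0) + c * (sqrt (spec v i) * sqrt (spec u j) * q i j)"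
    if ij: "i < D" "j < D" for i j
  proof -
    have nn: "0 \<le> c * (sqrt (spec v i) * sqrt (spec u j) * q i j)"
      using su[OF ij(2)] sv[OF ij(1)] q0 by (simp add: c_def)
    have "g j = 0 \<or> g j = 1" by (simp add: g_def)
    then consider "i \<in> B" | "g j = 0" | "i \<notin> B" "g j = 1" by blast
    then show ?thesis
    proof cases
      case 1
      have "spec v i * g j * q i j \<le> spec v i * 1 * q i j"
        using sv[OF ij(1)] q0 by (intro mult_right_mono mult_left_mono) (auto simp: g_def)
      then show ?thesis using 1 nn by simp
    next
      case 2
      then show ?thesis using nn sv[OF ij(1)] q0 by simp
    next
      case 3
      have lo: "spec u j \<ge> exp (- (entropy u + a))" using 3 by (auto simp: g_def split: if_splits)
      have hi: "spec v i \<le> exp (- (entropy v - a))" using 3 ij by (auto simp: B_def)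
      have "sqrt (spec v i) \<le> sqrt (exp (- (entropy v - a)))" using hi by simp
      also have "sqrt (exp (- (entropy v - a))) = exp (- (entropy v - a) / 2)"
        by (rule real_sqrt_unique) (auto simp: power2_eq_square mult_exp_exp)
      also have "\<dots> = c * exp (- (entropy u + a) / 2)"
        unfolding c_def mult_exp_exp by (rule arg_cong[where f = exp]) (simp add: field_simps)
      also have "exp (- (entropy u + a) / 2) = sqrt (exp (- (entropy u + a)))"
        by (rule real_sqrt_unique[symmetric]) (auto simp: power2_eq_square mult_exp_exp)
      also have "c * sqrt (exp (- (entropy u + a))) \<le> c * sqrt (spec u j)"
        using lo by (intro mult_left_mono) (auto simp: c_def)
      finally have "sqrt (spec v i) \<le> c * sqrt (spec u j)" .
      then have "sqrt (spec v i) * sqrt (spec v i) \<le> sqrt (spec v i) * (c * sqrt (spec u j))"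
        using sv[OF ij(1)] by (intro mult_left_mono) auto
      then have "spec v i * q i j \<le> sqrt (spec v i) * (c * sqrt (spec u j)) * q i j"
        using sv[OF ij(1)] q0 by (intro mult_right_mono) auto
      then show ?thesis using 3 by (simp add: mult_ac)
    qed
  qed
  have test: "typ_test a u = conj_diag D (tensor_word U u) g"
    by (simp add: typ_test_def D_def g_def[abs_def])
  have "Re (mtrace (tensor_word W v * typ_test a u)) = (\<Sum>i<D. \<Sum>j<D. spec v i * g j * q i j)"
    unfolding tensor_word_W[OF v] len test D_def[symmetric] mtrace_conj_diag_mult[OF Uv Uu] q_def
    by (simp only: Re_complex_of_real)
  also have "\<dots> \<le> (\<Sum>i<D. \<Sum>j<D. (if i \<in> B then spec v i * q i j else 0) + c * (sqrt (spec v i) * sqrt (spec u j) * q i j))"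
    by (intro sum_mono point) auto
  also have "\<dots> = (\<Sum>i<D. \<Sum>j<D. if i \<in> B then spec v i * q i j else 0)
      + c * (\<Sum>i<D. \<Sum>j<D. sqrt (spec v i) * sqrt (spec u j) * q i j)"
    by (simp only: sum.distrib sum_distrib_left)
  also have "(\<Sum>i<D. \<Sum>j<D. sqrt (spec v i) * sqrt (spec u j) * q i j)
      = Re (mtrace (tensor_word (\<lambda>x. msqrt (W x)) v * tensor_word (\<lambda>x. msqrt (W x)) u))"
    unfolding tensor_word_msqrt_W[OF v] tensor_word_msqrt_W[OF u] len D_def[symmetric] mtrace_conj_diag_mult[OF Uv Uu] q_def
    by (simp only: Re_complex_of_real)
  also have "(\<Sum>i<D. \<Sum>j<D. if i \<in> B then spec v i * q i j else 0) = (\<Sum>i\<in>B. spec v i)"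
  proof -
    \<comment> \<open>Summing out \<open>j\<close> removes the overlaps, so the exceptional mass is
      computed from the spectrum of \<open>v\<close> alone.\<close>
    have "(\<Sum>j<D. if i \<in> B then spec v i * q i j else 0) = (if i \<in> B then spec v i else 0)" if "i < D" for i
      using unitary_overlap_sum[OF Uv Uu that] by (simp add: q_def sum_distrib_left[symmetric])
    then have "(\<Sum>i<D. \<Sum>j<D. if i \<in> B then spec v i * q i j else 0) = (\<Sum>i<D. if i \<in> B then spec v i else 0)"
      by (intro sum.cong) auto
    also have "\<dots> = (\<Sum>i\<in>B. spec v i)" by (rule sum.mono_neutral_cong_right) (auto simp: B_def)
    finally show ?thesis .
  qed
  also have "(\<Sum>i\<in>B. spec v i) \<le> 4 * real d * real (length v) / a\<^sup>2"
  proof (rule deviation[OF v a])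
    fix i assume i: "i \<in> B" "spec v i > 0"
    then have "ln (exp (- (entropy v - a))) < ln (spec v i)"
      by (subst ln_less_cancel_iff) (auto simp: B_def)
    then show "\<bar>ln (spec v i) + entropy v\<bar> \<ge> a" by simp
  qed (simp add: B_def D_def len)
  finally show ?thesis by (simp add: c_def len)
qed

text \<open>Codewords are kept only from one entropy window of width \<open>sqrt n\<close>, which costs a
  polynomial factor and makes the tests of any two codewords comparable.\<close>

lemma DI_code_exists:
  assumes W: "\<And>x. x \<in> X \<Longrightarrow> W x \<in> density d"
    and Y: "finite Y" "Y \<noteq> {}" "Y \<subseteq> X" and n: "n > 0"
    and sep: "\<And>x y. x \<in> Y \<Longrightarrow> y \<in> Y \<Longrightarrow> x \<noteq> y \<Longrightarrow> hs_norm (msqrt (W x) - msqrt (W y)) \<ge> \<delta>" and \<delta>: "\<delta> \<ge> 0"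
    and a: "a > 0" and e1: "4 * real d * real n / a\<^sup>2 \<le> l1"
    and e2: "4 * real d * real n / a\<^sup>2 + exp (sqrt (real n) / 2 + a - real r * \<delta>\<^sup>2 / 2) \<le> l2"
  obtains N u E where "is_DI_code X d W n N l1 l2 u E" "card Y ^ n \<le> N * (n * d + 1) * (2 ^ n * card Y ^ r)"
proof -
  obtain C where C: "finite C" "\<And>u. u \<in> C \<Longrightarrow> set u \<subseteq> Y \<and> length u = n"
    "\<And>u v. u \<in> C \<Longrightarrow> v \<in> C \<Longrightarrow> u \<noteq> v \<Longrightarrow> hamming u v > r" "card Y ^ n \<le> card C * (2 ^ n * card Y ^ r)"
    using hamming_code_exists[OF Y(1,2), of n r] by metis
  define w where "w u = nat \<lfloor>entropy u / sqrt (real n)\<rfloor>" for u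
  have ent: "0 \<le> entropy u" "entropy u \<le> real d * real n" if "u \<in> C" for u
    using word_entropy_bounds[of u d p] p_nonneg p_sum C(2)[OF that] Y(3) by blast+
  have "w u \<le> n * d" if "u \<in> C" for u
  proof -
    have "1 \<le> sqrt (real n)" using n by simp
    then have "entropy u / sqrt (real n) \<le> entropy u / 1" using ent[OF that] by (intro divide_left_mono) auto
    then have "entropy u / sqrt (real n) \<le> real (n * d)" using ent[OF that] by (simp add: mult.commute)
    then show ?thesis unfolding w_def by linarith
  qed
  then have "w \<in> C \<rightarrow> {..n * d}" by auto
  \<comment> \<open>Entropies lie between 0 and \<open>n * d\<close> and a window has width at least
    1, so there are at most \<open>n * d + 1\<close> windows; one of them keeps at least the average
    share of the code.\<close>
  from pigeonhole_card[OF this C(1)] obtain k where k: "card C \<le> card (w -` {k} \<inter> C) * card {..n * d}"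
    by auto
  define C' where "C' = w -` {k} \<inter> C"
  have C': "finite C'" "C' \<subseteq> C" using C(1) by (auto simp: C'_def)
  have window: "entropy u - entropy v \<le> sqrt (real n)" if uv: "u \<in> C'" "v \<in> C'" for u v
  proof -
    have "w u = w v" using uv by (simp add: C'_def)
    moreover have "0 \<le> entropy u / sqrt (real n)" "0 \<le> entropy v / sqrt (real n)" using ent uv C'(2) by auto
    ultimately have "entropy u / sqrt (real n) - entropy v / sqrt (real n) \<le> 1"
      unfolding w_def by linarith
    then show ?thesis using n by (simp add: diff_divide_distrib[symmetric] pos_divide_le_eq)
  qed
  define N where "N = card C'"
  obtain u where u: "bij_betw u {..<N} C'"
    using ex_bij_betw_nat_finite[OF C'(1)] by (auto simp: N_def lessThan_atLeast0)
  have uC: "u j \<in> C'" if "j < N" for j using u that by (auto simp: bij_betw_def)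
  have uY: "set (u j) \<subseteq> Y" "length (u j) = n" if "j < N" for j using C(2) C'(2) uC[OF that] by auto
  then have uX: "set (u j) \<subseteq> X" if "j < N" for j using Y(3) that by blast
  have "is_DI_code X d W n N l1 l2 u (\<lambda>j. typ_test a (u j))"
    unfolding is_DI_code_def
  proof (intro conjI allI impI)
    fix j assume j: "j < N"
    show "set (u j) \<subseteq> X" by (rule uX[OF j])
    show "length (u j) = n" by (rule uY(2)[OF j])
    show "effect (d ^ n) (typ_test a (u j))" using typ_test_effect[OF uX[OF j], of a] uY(2)[OF j] by simp
    show "1 - l1 \<le> Re (mtrace (tensor_word W (u j) * typ_test a (u j)))"
      using typ_test_self[OF uX[OF j] a] uY(2)[OF j] e1 by simp
  next
    fix j k assume jk: "j < N" "k < N" "j \<noteq> k"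
    then have "u j \<noteq> u k" using u by (auto simp: bij_betw_def inj_on_def)
    then have ham: "hamming (u j) (u k) > r" using C(3) C'(2) uC jk by blast
    have len: "length (u j) = length (u k)" using uY(2) jk by simp
    define T where "T = Re (mtrace (tensor_word (\<lambda>x. msqrt (W x)) (u j) * tensor_word (\<lambda>x. msqrt (W x)) (u k)))"
    have "T \<le> exp (- (real (hamming (u j) (u k)) * \<delta>\<^sup>2 / 2))"
      unfolding T_def by (rule hs_overlap_le[OF W Y(3) uY(1)[OF jk(1)] uY(1)[OF jk(2)] len sep \<delta>])
    also have "\<dots> \<le> exp (- (real r * \<delta>\<^sup>2 / 2))"
      using ham by (simp add: mult_right_mono)
    finally have T: "T \<le> exp (- (real r * \<delta>\<^sup>2 / 2))" .
    have "Re (mtrace (tensor_word W (u j) * typ_test a (u k)))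
        \<le> 4 * real d * real n / a\<^sup>2 + exp ((entropy (u k) - entropy (u j)) / 2 + a) * T"
      using typ_test_cross[OF uX[OF jk(2)] uX[OF jk(1)] len a] uY(2)[OF jk(2)] by (simp add: T_def)
    also have "exp ((entropy (u k) - entropy (u j)) / 2 + a) * T
        \<le> exp (sqrt (real n) / 2 + a) * exp (- (real r * \<delta>\<^sup>2 / 2))"
    proof (cases "T \<ge> 0")
      case True
      then show ?thesis using window[OF uC[OF jk(2)] uC[OF jk(1)]] T by (intro mult_mono) auto
    next
      case False
      then have "exp ((entropy (u k) - entropy (u j)) / 2 + a) * T \<le> 0" by (simp add: mult_le_0_iff)
      also have "0 \<le> exp (sqrt (real n) / 2 + a) * exp (- (real r * \<delta>\<^sup>2 / 2))" by simp
      finally show ?thesis .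
    qed
    also have "\<dots> = exp (sqrt (real n) / 2 + a - real r * \<delta>\<^sup>2 / 2)" by (simp add: mult_exp_exp)
    finally show "Re (mtrace (tensor_word W (u j) * typ_test a (u k))) \<le> l2" using e2 by simp
  qed
  moreover have "card Y ^ n \<le> N * (n * d + 1) * (2 ^ n * card Y ^ r)"
  proof -
    have "card C \<le> N * (n * d + 1)" using k by (simp add: N_def C'_def)
    then show ?thesis using C(4) by (meson le_trans mult_le_mono1)
  qed
  ultimately show ?thesis by (rule that)
qed

end

lemma spectral_channel_exists:
  assumes W: "\<And>x. x \<in> X \<Longrightarrow> W x \<in> density d"
  obtains U p where "spectral_channel X d W U p"
proof -
  have "\<forall>x\<in>X. \<exists>Up. unitary_mat d (fst Up) \<and> W x = conj_diag d (fst Up) (snd Up)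
      \<and> (\<forall>i<d. snd Up i \<ge> 0) \<and> (\<Sum>i<d. snd Up i) = 1"
  proof
    fix x assume "x \<in> X"
    from density_spectral[OF W[OF this]] obtain V q where "unitary_mat d V" "W x = conj_diag d V q"
      "\<And>i. i < d \<Longrightarrow> q i \<ge> 0" "(\<Sum>i<d. q i) = 1" by metis
    then show "\<exists>Up. unitary_mat d (fst Up) \<and> W x = conj_diag d (fst Up) (snd Up)
      \<and> (\<forall>i<d. snd Up i \<ge> 0) \<and> (\<Sum>i<d. snd Up i) = 1"
      by (intro exI[of _ "(V, q)"]) simp
  qed
  from bchoice[OF this] obtain f where f: "\<forall>x\<in>X. unitary_mat d (fst (f x)) \<and> W x = conj_diag d (fst (f x)) (snd (f x))
      \<and> (\<forall>i<d. snd (f x) i \<ge> 0) \<and> (\<Sum>i<d. snd (f x) i) = 1" ..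
  have "spectral_channel X d W (\<lambda>x. fst (f x)) (\<lambda>x. snd (f x))"
    by unfold_locales (use f in auto)
  then show ?thesis by (rule that)
qed

text \<open>The packing consists of operators while codewords consist of letters: one preimage is
  chosen for each packing point, so that distinct letters of \<open>Y\<close> have separated
  roots.\<close>

lemma N_DI_ge:
  assumes W: "\<And>x. x \<in> X \<Longrightarrow> W x \<in> density d"
    and S: "finite S" "S \<noteq> {}" "S \<subseteq> msqrt ` W ` X" and n: "n > 0"
    and sep: "\<And>x y. x \<in> S \<Longrightarrow> y \<in> S \<Longrightarrow> x \<noteq> y \<Longrightarrow> hs_norm (x - y) \<ge> \<delta>" and \<delta>: "\<delta> \<ge> 0"
    and a: "a > 0" and e1: "4 * real d * real n / a\<^sup>2 \<le> l1"
    and e2: "4 * real d * real n / a\<^sup>2 + exp (sqrt (real n) / 2 + a - real r * \<delta>\<^sup>2 / 2) \<le> l2"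
  obtains N where "enat N \<le> N_DI X d W n l1 l2" "card S ^ n \<le> N * (n * d + 1) * (2 ^ n * card S ^ r)"
proof -
  have "S \<subseteq> (\<lambda>x. msqrt (W x)) ` X" using S(3) by (simp only: image_image)
  then obtain Y where Y: "Y \<subseteq> X" "inj_on (\<lambda>x. msqrt (W x)) Y" "S = (\<lambda>x. msqrt (W x)) ` Y"
    by (simp only: subset_image_inj) (elim exE conjE)
  have cY: "card Y = card S" unfolding Y(3) by (rule card_image[OF Y(2), symmetric])
  have fY: "finite Y" "Y \<noteq> {}" using finite_imageD[OF S(1)[unfolded Y(3)] Y(2)] S(2)[unfolded Y(3)] by auto
  have sepY: "hs_norm (msqrt (W x) - msqrt (W y)) \<ge> \<delta>" if "x \<in> Y" "y \<in> Y" "x \<noteq> y" for x y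
  proof (rule sep)
    show "msqrt (W x) \<in> S" "msqrt (W y) \<in> S" using that Y(3) by simp_all
    show "msqrt (W x) \<noteq> msqrt (W y)" using inj_onD[OF Y(2) _ that(1,2)] that(3) by blast
  qed
  obtain U p where sc: "spectral_channel X d W U p" by (rule spectral_channel_exists[OF W])
  obtain N u E where code: "is_DI_code X d W n N l1 l2 u E"
    and size: "card Y ^ n \<le> N * (n * d + 1) * (2 ^ n * card Y ^ r)"
    by (rule spectral_channel.DI_code_exists[OF sc W fY Y(1) n sepY \<delta> a e1 e2])
  have "enat N \<le> N_DI X d W n l1 l2"
    unfolding N_DI_def by (intro Sup_upper CollectI exI[of _ N] exI[of _ u] exI[of _ E] conjI refl code)
  then show ?thesis by (rule that[OF _ size[unfolded cY]])
qed

section \<open>Asymptotic rates\<close>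

abbreviation packing_ratio :: "complex mat set \<Rightarrow> real \<Rightarrow> ereal" where
  "packing_ratio F \<delta> \<equiv> (case packing_number \<delta> F of
     enat P \<Rightarrow> ereal (log 2 (real P) / (- log 2 \<delta>)) | \<infinity> \<Rightarrow> \<infinity>)"

text \<open>At \<open>N = 0\<close> the convention \<open>ln 0 = 0\<close> makes the logarithm
  0.\<close>

lemma log2_of_nat_nonneg: "log 2 (real N) \<ge> 0"
  by (cases "N = 0") (auto simp: log_def)

lemma DI_rate_le:
  assumes "N_DI X d W n l1 l2 \<le> enat (P ^ n)" "n \<ge> 2"
  shows "DI_rate X d W l1 l2 n \<le> ereal (log 2 (real P) / log 2 (real n))"
proof -
  obtain N where N: "N_DI X d W n l1 l2 = enat N" "N \<le> P ^ n"
    using assms(1) by (cases "N_DI X d W n l1 l2") auto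
  have pos: "log 2 (real n) > 0" using assms(2) by simp
  have "log 2 (real N) \<le> real n * log 2 (real P)"
  proof (cases "N = 0")
    case True
    have "0 \<le> real n * log 2 (real P)" by (intro mult_nonneg_nonneg log2_of_nat_nonneg) simp
    moreover have "log 2 (real N) = 0" by (simp add: True log_def)
    ultimately show ?thesis by simp
  next
    case False
    then have "P > 0" using N(2) assms(2) by (cases "P = 0") (auto simp: power_0_left)
    then have "log 2 (real N) \<le> log 2 (real (P ^ n))" using False N(2) by simp
    also have "\<dots> = real n * log 2 (real P)" using \<open>P > 0\<close> by (simp add: log_nat_power)
    finally show ?thesis .
  qed
  then have "log 2 (real N) / (real n * log 2 (real n)) \<le> real n * log 2 (real P) / (real n * log 2 (real n))"
    using pos by (intro divide_right_mono) auto
  then show ?thesis using assms(2) by (simp add: DI_rate_def N(1))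
qed

lemma DI_rate_ge:
  assumes "enat N \<le> N_DI X d W n l1 l2" "N > 0"
  shows "ereal (log 2 (real N) / (real n * log 2 (real n))) \<le> DI_rate X d W l1 l2 n"
proof (cases "N_DI X d W n l1 l2")
  case (enat M)
  have "real n * log 2 (real n) \<ge> 0" by (simp add: log2_of_nat_nonneg)
  then have "log 2 (real N) / (real n * log 2 (real n)) \<le> log 2 (real M) / (real n * log 2 (real n))"
    using assms enat by (intro divide_right_mono) auto
  then show ?thesis by (simp add: DI_rate_def enat)
qed (simp add: DI_rate_def)

lemma DI_rate_nonneg: "DI_rate X d W l1 l2 n \<ge> 0"
  by (cases "N_DI X d W n l1 l2") (auto simp: DI_rate_def log2_of_nat_nonneg intro!: divide_nonneg_nonneg mult_nonneg_nonneg)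

section \<open>The upper bound in the limit\<close>

text \<open>The denominator is asymptotic to \<open>- 2 * ln \<delta>\<close>, which produces the
  factor 1/2 of the upper bound. The subtracted 1 accounts for rounding the blocklength
  down.\<close>

lemma converse_asymptotics:
  fixes \<kappa> y z :: real
  assumes "\<kappa> > 0" "y / 2 < z"
  shows "eventually (\<lambda>\<delta>. y * (- ln \<delta>) / ln (\<kappa> / \<delta>\<^sup>2 - 1) < z) (at_right 0)"
proof -
  have "((\<lambda>\<delta>. y * (- ln \<delta>) / ln (\<kappa> / \<delta>\<^sup>2 - 1)) \<longlongrightarrow> y / 2) (at_right 0)"
    using assms(1) by real_asymp
  then show ?thesis using assms(2) by (rule order_tendstoD)
qed

text \<open>A small \<open>\<delta>\<close> with packing ratio below \<open>y\<close> would, at the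
  blocklength matched to it, push the rate below \<open>z\<close>. As the blocklength tends to
  infinity with \<open>\<delta> \<rightarrow> 0\<close>, this contradicts the assumed lower
  limit.\<close>

lemma dim_ge_of_liminf_gt:
  assumes W: "\<And>x. x \<in> X \<Longrightarrow> W x \<in> density d"
    and l: "l1 > 0" "l2 > 0" "l1 + l2 < 1"
    and z: "ereal z < liminf (DI_rate X d W l1 l2)" and y: "y / 2 < z"
  shows "ereal y \<le> lower_minkowski_dim (msqrt ` W ` X)"
proof -
  \<comment> \<open>The slack \<open>g\<close> is divided up: as \<open>l2 < 1\<close>, the choice
    \<open>t = g / 2\<close> costs at most \<open>g / 2\<close> in \<open>(1 + t) * l2\<close>, and
    \<open>\<kappa>\<close> is chosen so that the distance term costs at most \<open>g / 4\<close>.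
    The total stays below \<open>l2 + g = 1 - l1\<close>.\<close>
  define g where "g = 1 - l1 - l2"
  define t where "t = g / 2"
  define \<kappa> where "\<kappa> = g / (16 * (1 + 1 / t))"
  have g: "g > 0" using l by (simp add: g_def)
  then have t: "t > 0" by (simp add: t_def)
  have \<kappa>: "\<kappa> > 0" using g t by (simp add: \<kappa>_def add_pos_pos)
  \<comment> \<open>For small \<open>\<delta> > 0\<close>, the largest blocklength with
    \<open>n * \<delta>\<^sup>2 \<le> \<kappa>\<close>.\<close>
  define m where "m \<delta> = nat \<lfloor>\<kappa> / \<delta>\<^sup>2\<rfloor>" for \<delta> :: real
  have "filterlim (\<lambda>\<delta>. \<kappa> / \<delta>\<^sup>2) at_top (at_right 0)" using \<kappa> by real_asymp
  then have m_lim: "filterlim m sequentially (at_right 0)"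
    unfolding m_def by (rule filterlim_compose[OF filterlim_nat_sequentially filterlim_compose[OF filterlim_floor_sequentially]])
  have "eventually (\<lambda>n. ereal z < DI_rate X d W l1 l2 n) sequentially"
    using z by (rule less_LiminfD)
  then have ev1: "eventually (\<lambda>\<delta>. ereal z < DI_rate X d W l1 l2 (m \<delta>)) (at_right 0)"
    using m_lim by (rule eventually_compose_filterlim)
  \<comment> \<open>Ensures \<open>n \<ge> 2\<close> and
    \<open>\<kappa> / \<delta>\<^sup>2 - 1 > 1\<close>, so that the logarithms in both denominators
    are positive.\<close>
  have ev2: "eventually (\<lambda>\<delta>. \<kappa> / \<delta>\<^sup>2 > 3) (at_right 0)" using \<kappa> by real_asymp
  have ev3: "eventually (\<lambda>\<delta>::real. 2 * \<delta>\<^sup>2 \<le> 1) (at_right 0)" by real_asymp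
  have "eventually (\<lambda>\<delta>::real. \<delta> < 1) (at_right 0)" by real_asymp
  with eventually_at_right_less[of "0::real"]
  have ev4: "eventually (\<lambda>\<delta>::real. 0 < \<delta> \<and> \<delta> < 1) (at_right 0)" by eventually_elim simp
  have "eventually (\<lambda>\<delta>. ereal y \<le> packing_ratio (msqrt ` W ` X) \<delta>) (at_right 0)"
    using ev1 ev2 ev3 ev4 converse_asymptotics[OF \<kappa> y]
  proof eventually_elim
    case (elim \<delta>)
    show ?case
    proof (rule ccontr)
      assume neg: "\<not> ereal y \<le> packing_ratio (msqrt ` W ` X) \<delta>"
      then obtain P where P: "packing_number \<delta> (msqrt ` W ` X) = enat P"
        by (cases "packing_number \<delta> (msqrt ` W ` X)") auto
      have pos: "- log 2 \<delta> > 0" using elim(4) by simp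
      have "log 2 (real P) / (- log 2 \<delta>) < y" using neg P by simp
      then have "log 2 (real P) < y * (- log 2 \<delta>)" unfolding pos_divide_less_eq[OF pos] .
      then have "ln (real P) / ln 2 < (y * (- ln \<delta>)) / ln 2" by (simp add: log_def)
      from mult_strict_right_mono[OF this, of "ln 2"]
      have lnP: "ln (real P) < y * (- ln \<delta>)" by simp
      let ?n = "m \<delta>"
      have n2: "?n \<ge> 2" unfolding m_def using elim(2) by linarith
      have n_le: "real ?n \<le> \<kappa> / \<delta>\<^sup>2" unfolding m_def using elim(2) by linarith
      have n_ge: "\<kappa> / \<delta>\<^sup>2 - 1 \<le> real ?n" unfolding m_def using elim(2) by linarith
      have "real ?n * \<delta>\<^sup>2 \<le> \<kappa>" using n_le elim(4) by (simp add: pos_le_divide_eq)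
      then have "(1 + 1 / t) * (4 * real ?n * \<delta>\<^sup>2) \<le> (1 + 1 / t) * (4 * \<kappa>)"
        using t by (intro mult_left_mono) auto
      also have "\<dots> = g / 4"
      proof -
        have "1 + 1 / t > 0" using t by (simp add: add_pos_pos)
        moreover have "c * (4 * (g / (16 * c))) = g / 4" if "c > 0" for c using that by simp
        ultimately show ?thesis unfolding \<kappa>_def by blast
      qed
      finally have "(1 + t) * l2 + (1 + 1 / t) * (4 * real ?n * \<delta>\<^sup>2) \<le> (1 + t) * l2 + g / 4" by simp
      also have "\<dots> < 1 - l1"
      proof -
        have "t * l2 \<le> t * 1" using t l by (intro mult_left_mono) auto
        then have "(1 + t) * l2 \<le> l2 + g / 2" by (simp add: distrib_right t_def)
        moreover have "A + g / 4 < 1 - l1" if "A \<le> l2 + g / 2" for A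
        proof -
          have "1 - l1 = l2 + g" by (simp add: g_def)
          then show ?thesis using that g by linarith
        qed
        ultimately show ?thesis by blast
      qed
      finally have gap: "(1 + t) * l2 + (1 + 1 / t) * (4 * real ?n * \<delta>\<^sup>2) < 1 - l1" .
      have "DI_rate X d W l1 l2 ?n \<le> ereal (log 2 (real P) / log 2 (real ?n))"
        using N_DI_le_packing_number[OF W P _ elim(3) t gap] elim(4) n2 by (intro DI_rate_le) auto
      also have "log 2 (real P) / log 2 (real ?n) = ln (real P) / ln (real ?n)" by (simp add: log_def)
      also have "ln (real P) / ln (real ?n) \<le> y * (- ln \<delta>) / ln (real ?n)"
        using lnP n2 by (intro divide_right_mono) auto
      also have "y * (- ln \<delta>) / ln (real ?n) \<le> y * (- ln \<delta>) / ln (\<kappa> / \<delta>\<^sup>2 - 1)"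
      proof (rule divide_left_mono)
        show "ln (\<kappa> / \<delta>\<^sup>2 - 1) \<le> ln (real ?n)" using n_ge elim(2) by (subst ln_le_cancel_iff) auto
        \<comment> \<open>The numerator exceeds \<open>ln P \<ge> 0\<close>, so decreasing the
          denominator enlarges the quotient.\<close>
        have "ln (real P) \<ge> 0" by (cases "P = 0") auto
        then show "0 \<le> y * (- ln \<delta>)" using lnP by linarith
        show "0 < ln (real ?n) * ln (\<kappa> / \<delta>\<^sup>2 - 1)" using n2 elim(2) by (intro mult_pos_pos) auto
      qed
      also have "y * (- ln \<delta>) / ln (\<kappa> / \<delta>\<^sup>2 - 1) < z" by (rule elim(5))
      finally have "DI_rate X d W l1 l2 ?n < ereal z" by simp
      then show False using elim(1) by simp
    qed
  qed
  then show ?thesis unfolding lower_minkowski_dim_def by (rule Liminf_bounded)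
qed

text \<open>Strict room between \<open>w\<close> and an intermediate value \<open>z'\<close> absorbs
  the error in the limit of the rate bound; density of the order then removes it.\<close>

lemma liminf_DI_rate_le:
  assumes W: "\<And>x. x \<in> X \<Longrightarrow> W x \<in> density d"
    and l: "l1 > 0" "l2 > 0" "l1 + l2 < 1"
  shows "liminf (DI_rate X d W l1 l2) \<le> ereal (1 / 2) * lower_minkowski_dim (msqrt ` W ` X)"
proof (rule dense_le)
  fix w assume w: "w < liminf (DI_rate X d W l1 l2)"
  show "w \<le> ereal (1 / 2) * lower_minkowski_dim (msqrt ` W ` X)"
  proof (cases w)
    case (real w')
    obtain z' where z': "w < z'" "z' < liminf (DI_rate X d W l1 l2)" using dense[OF w] by blast
    then obtain z where z: "z' = ereal z" using real by (cases z') auto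
    have "ereal (2 * w') \<le> lower_minkowski_dim (msqrt ` W ` X)"
      by (rule dim_ge_of_liminf_gt[OF W l, where z = z]) (use z z' real in auto)
    then have "ereal (1 / 2) * ereal (2 * w') \<le> ereal (1 / 2) * lower_minkowski_dim (msqrt ` W ` X)"
      by (rule ereal_mult_left_mono) simp
    then show ?thesis using real by simp
  qed (use w in auto)
qed

section \<open>The lower bound in the limit\<close>

text \<open>A finite packing number is attained. If it is infinite, there are finite packings of
  every size bound, and one beyond \<open>2 powr (y * (- log 2 \<delta>))\<close> is taken.\<close>

lemma packing_with_log_card:
  assumes ratio: "ereal y < packing_ratio F \<delta>" and \<delta>: "0 < \<delta>" "\<delta> < 1" and y: "y > 0"
  obtains S where "finite S" "S \<noteq> {}" "S \<subseteq> F" "\<And>x z. x \<in> S \<Longrightarrow> z \<in> S \<Longrightarrow> x \<noteq> z \<Longrightarrow> hs_norm (x - z) \<ge> \<delta>"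
    "log 2 (real (card S)) \<ge> y * (- log 2 \<delta>)"
proof -
  have pos: "- log 2 \<delta> > 0" using \<delta> by simp
  have "\<exists>S. finite S \<and> S \<subseteq> F \<and> (\<forall>x\<in>S. \<forall>z\<in>S. x \<noteq> z \<longrightarrow> hs_norm (x - z) \<ge> \<delta>) \<and> log 2 (real (card S)) \<ge> y * (- log 2 \<delta>)"
  proof (cases "packing_number \<delta> F")
    case (enat P)
    obtain S where S: "finite S" "S \<subseteq> F" "\<And>x z. x \<in> S \<Longrightarrow> z \<in> S \<Longrightarrow> x \<noteq> z \<Longrightarrow> hs_norm (x - z) \<ge> \<delta>" "card S = P"
      "\<And>T. finite T \<Longrightarrow> T \<subseteq> F \<Longrightarrow> (\<And>x y. x \<in> T \<Longrightarrow> y \<in> T \<Longrightarrow> x \<noteq> y \<Longrightarrow> hs_norm (x - y) \<ge> \<delta>) \<Longrightarrow> card T \<le> P"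
      using packing_number_attained[OF enat] by metis
    have "y < log 2 (real P) / (- log 2 \<delta>)" using ratio enat by simp
    then have "y * (- log 2 \<delta>) < log 2 (real P)" using pos by (subst (asm) pos_less_divide_eq) auto
    then show ?thesis using S(1-4) by (intro exI[of _ S]) simp
  next
    case infinity
    define k where "k = nat \<lceil>2 powr (y * (- log 2 \<delta>))\<rceil>"
    have "enat k < packing_number \<delta> F" using infinity by simp
    then obtain S where S: "finite S" "S \<subseteq> F" "\<forall>x\<in>S. \<forall>z\<in>S. x \<noteq> z \<longrightarrow> hs_norm (x - z) \<ge> \<delta>" "k < card S"
      unfolding packing_number_def less_Sup_iff by (elim bexE CollectE exE conjE) simp
    have "2 powr (y * (- log 2 \<delta>)) \<le> real k" unfolding k_def by linarith
    then have "2 powr (y * (- log 2 \<delta>)) \<le> real (card S)" using S(4) by simp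
    then have "y * (- log 2 \<delta>) \<le> log 2 (real (card S))" using S(4) by (subst le_log_iff) auto
    then show ?thesis using S by (intro exI[of _ S]) simp
  qed
  then obtain S where S: "finite S" "S \<subseteq> F" "\<forall>x\<in>S. \<forall>z\<in>S. x \<noteq> z \<longrightarrow> hs_norm (x - z) \<ge> \<delta>"
    "log 2 (real (card S)) \<ge> y * (- log 2 \<delta>)" by metis
  have "y * (- log 2 \<delta>) > 0" by (rule mult_pos_pos[OF y pos])
  then have "S \<noteq> {}" using S(4) by (auto simp: log_def)
  show ?thesis by (rule that[OF S(1) \<open>S \<noteq> {}\<close> S(2) _ S(4)]) (use S(3) in blast)
qed

text \<open>Cancelling \<open>K ^ r\<close> leaves \<open>(n - r) * log K\<close> as the main term.
  The losses \<open>n\<close> and \<open>log (n * d + 1)\<close> disappear after division by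
  \<open>n * log n\<close>.\<close>

lemma log_code_size_ge:
  fixes K N n r d :: nat
  assumes size: "K ^ n \<le> N * (n * d + 1) * (2 ^ n * K ^ r)" and K: "K > 0" and r: "r \<le> n"
  shows "N > 0" "log 2 (real N) \<ge> real (n - r) * log 2 (real K) - real n - log 2 (real (n * d + 1))"
proof -
  show N: "N > 0" using size K by (cases "N = 0") auto
  have split: "K ^ n = K ^ (n - r) * K ^ r" unfolding power_add[symmetric] using r by simp
  have "K ^ (n - r) * K ^ r \<le> (N * (n * d + 1) * 2 ^ n) * K ^ r"
    using size unfolding split by (simp only: mult.assoc)
  then have "K ^ (n - r) \<le> N * (n * d + 1) * 2 ^ n" using K by simp
  then have "real (K ^ (n - r)) \<le> real (N * (n * d + 1) * 2 ^ n)" by (simp only: of_nat_le_iff)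
  then have "log 2 (real (K ^ (n - r))) \<le> log 2 (real (N * (n * d + 1) * 2 ^ n))"
    using K by (intro log_mono) auto
  also have "real (N * (n * d + 1) * 2 ^ n) = real N * real (n * d + 1) * 2 ^ n"
    by (simp only: of_nat_mult of_nat_power of_nat_numeral)
  also have "log 2 \<dots> = log 2 (real N) + log 2 (real (n * d + 1)) + log 2 (2 ^ n)"
  proof -
    have "log 2 (x * B * 2 ^ n) = log 2 x + log 2 B + log 2 (2 ^ n)" if "x > 0" "B > 0" for x B :: real
      using that by (simp add: log_mult_pos)
    then show ?thesis using N by (simp only: of_nat_0_less_iff zero_less_Suc Suc_eq_plus1[symmetric])
  qed
  finally have "log 2 (real (K ^ (n - r))) \<le> log 2 (real N) + log 2 (real (n * d + 1)) + real n"
    by simp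
  then show "log 2 (real N) \<ge> real (n - r) * log 2 (real K) - real n - log 2 (real (n * d + 1))"
    using log_nat_power[of "real K" 2 "n - r"] K by simp
qed

text \<open>The product \<open>n * \<delta>\<^sup>2\<close> equals
  \<open>sqrt n * n powr (s / 2)\<close>, so the extra power \<open>s / 2\<close> beats every
  multiple of \<open>sqrt n\<close>. The term \<open>s * n - 1\<close> is a lower bound for the
  rounded Hamming distance.\<close>

lemma direct_asymptotics:
  fixes s c e :: real
  assumes "0 < s" "s < 1" "e > 0" "c > 0"
  shows "eventually (\<lambda>n::nat. exp (sqrt (real n) / 2 + c * sqrt (real n) - (s * real n - 1) * (real n powr (- (1 - s) / 4))\<^sup>2 / 2) \<le> e) sequentially"
proof -
  have e1: "eventually (\<lambda>n::nat. exp (- sqrt (real n)) < e) sequentially"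
  proof -
    have "((\<lambda>n::nat. exp (- sqrt (real n))) \<longlongrightarrow> 0) sequentially" by real_asymp
    then show ?thesis using assms(3) by (rule order_tendstoD)
  qed
  have "filterlim (\<lambda>n::nat. real n powr (s / 2)) at_top sequentially" using assms(1) by real_asymp
  \<comment> \<open>The threshold is chosen so that half of the negative term covers
    \<open>(3 / 2 + c) * sqrt n\<close>: this cancels the positive terms and leaves
    \<open>- sqrt n\<close>.\<close>
  then have e2: "eventually (\<lambda>n::nat. real n powr (s / 2) \<ge> 4 * (3 / 2 + c) / s) sequentially"
    by (simp add: filterlim_at_top)
  have e3: "eventually (\<lambda>n::nat. real n \<ge> 2 / s) sequentially"
    using filterlim_real_sequentially by (simp add: filterlim_at_top)
  show ?thesis
    using e1 e2 e3 eventually_gt_at_top[of 0]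
  proof eventually_elim
    case (elim n)
    have n: "real n > 0" using elim(4) by simp
    have sq: "(real n powr (- (1 - s) / 4))\<^sup>2 = real n powr (- (1 - s) / 2)"
      using n by (simp add: power2_eq_square powr_add[symmetric])
    have "real n = real n powr 1" using n by simp
    then have "real n * real n powr (- (1 - s) / 2) = real n powr (1 + - (1 - s) / 2)"
      unfolding powr_add by simp
    also have "1 + - (1 - s) / 2 = 1 / 2 + s / 2" by (simp add: field_simps)
    also have "real n powr (1 / 2 + s / 2) = sqrt (real n) * real n powr (s / 2)"
      unfolding powr_add using n by (simp add: powr_half_sqrt)
    finally have prod: "real n * real n powr (- (1 - s) / 2) = sqrt (real n) * real n powr (s / 2)" .
    have "s * real n / 2 \<le> s * real n - 1" using elim(3) assms(1) by (simp add: pos_divide_le_eq mult.commute)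
    then have "s * real n / 2 * real n powr (- (1 - s) / 2) \<le> (s * real n - 1) * real n powr (- (1 - s) / 2)"
      by (rule mult_right_mono) simp
    moreover have "s * real n / 2 * real n powr (- (1 - s) / 2) = sqrt (real n) * (s / 2 * real n powr (s / 2))"
      using prod by (simp add: mult_ac)
    moreover have "sqrt (real n) * (2 * (3 / 2 + c)) \<le> sqrt (real n) * (s / 2 * real n powr (s / 2))"
      using elim(2) assms(1) by (intro mult_left_mono) (auto simp: pos_divide_le_eq mult.commute)
    ultimately have "sqrt (real n) * (2 * (3 / 2 + c)) \<le> (s * real n - 1) * real n powr (- (1 - s) / 2)"
      by linarith
    moreover have "sqrt (real n) / 2 + c * sqrt (real n) - A / 2 \<le> - sqrt (real n)"
      if "sqrt (real n) * (2 * (3 / 2 + c)) \<le> A" for A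
      using that by (simp add: algebra_simps)
    ultimately have "sqrt (real n) / 2 + c * sqrt (real n) - (s * real n - 1) * real n powr (- (1 - s) / 2) / 2
        \<le> - sqrt (real n)"
      by blast
    then have "exp (sqrt (real n) / 2 + c * sqrt (real n) - (s * real n - 1) * real n powr (- (1 - s) / 2) / 2)
        \<le> exp (- sqrt (real n))" by simp
    then show ?case unfolding sq using elim(1) by linarith
  qed
qed

lemma direct_rate_limit:
  fixes d :: nat and w :: real
  assumes "d > 0"
  shows "((\<lambda>n::nat. w - 1 / log 2 (real n) - log 2 (real n * real d + 1) / (real n * log 2 (real n))) \<longlongrightarrow> w) sequentially"
proof -
  define D where "D = real d"
  have "D > 0" using assms by (simp add: D_def)
  then show ?thesis unfolding D_def[symmetric] log_def by real_asymp
qed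

text \<open>Of the two factors \<open>1 - s\<close>, one comes from the scale exponent
  \<open>(1 - s) / 4\<close> and the other from the rate given up for a Hamming distance of about
  \<open>s * n\<close>.\<close>

lemma direct_liminf_ge:
  fixes y s :: real
  assumes W: "\<And>x. x \<in> X \<Longrightarrow> W x \<in> density d" and d: "d > 0"
    and l: "l1 > 0" "l2 > 0"
    and y: "0 < y" "ereal y < lower_minkowski_dim (msqrt ` W ` X)" and s: "0 < s" "s < 1"
  shows "ereal ((1 - s)\<^sup>2 / 4 * y) \<le> liminf (DI_rate X d W l1 l2)"
proof -
  define \<delta> where "\<delta> n = real n powr (- (1 - s) / 4)" for n :: nat
  \<comment> \<open>\<open>m\<close> is the budget for the Chebyshev term: it fits into
    \<open>l1\<close> and leaves half of \<open>l2\<close> to the exponential term. The constant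
    \<open>c\<close> makes \<open>4 * d * n / a\<^sup>2\<close> equal to \<open>m\<close> when
    \<open>a = c * sqrt n\<close>.\<close>
  define m where "m = min l1 (l2 / 2)"
  have m: "m > 0" "m \<le> l1" "m \<le> l2 / 2" using l by (auto simp: m_def)
  define c where "c = sqrt (4 * real d / m)"
  have c: "c > 0" "c\<^sup>2 = 4 * real d / m" using d m by (auto simp: c_def)
  have "((\<lambda>n. real n powr (- (1 - s) / 4)) \<longlongrightarrow> 0) sequentially"
    using s by (intro tendsto_neg_powr filterlim_real_sequentially) simp
  then have \<delta>_lim: "filterlim \<delta> (at_right 0) sequentially"
    unfolding \<delta>_def filterlim_at
    by (auto intro!: eventually_mono[OF eventually_gt_at_top[of 0]])
  have ev1: "eventually (\<lambda>n. ereal y < packing_ratio (msqrt ` W ` X) (\<delta> n)) sequentially"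
    using less_LiminfD[OF y(2)[unfolded lower_minkowski_dim_def]] \<delta>_lim by (rule eventually_compose_filterlim)
  have ev2: "eventually (\<lambda>n::nat. exp (sqrt (real n) / 2 + c * sqrt (real n) - (s * real n - 1) * (\<delta> n)\<^sup>2 / 2) \<le> l2 / 2) sequentially"
    unfolding \<delta>_def using direct_asymptotics[OF s _ c(1), of "l2 / 2"] l by simp
  let ?g = "\<lambda>n::nat. (1 - s)\<^sup>2 / 4 * y - 1 / log 2 (real n) - log 2 (real n * real d + 1) / (real n * log 2 (real n))"
  have "eventually (\<lambda>n. ereal (?g n) \<le> DI_rate X d W l1 l2 n) sequentially"
    using ev1 ev2 eventually_ge_at_top[of 2]
  proof eventually_elim
    case (elim n)
    have n: "real n > 1" "n > 0" using elim(3) by auto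
    have ln: "log 2 (real n) > 0" using n by simp
    have \<delta>: "0 < \<delta> n" "\<delta> n < 1" using n s by (auto simp: \<delta>_def powr_less_one)
    have log\<delta>: "- log 2 (\<delta> n) = (1 - s) / 4 * log 2 (real n)"
      using n by (simp add: \<delta>_def log_powr) (simp add: algebra_simps)
    obtain S where S: "finite S" "S \<noteq> {}" "S \<subseteq> msqrt ` W ` X"
      "\<And>x z. x \<in> S \<Longrightarrow> z \<in> S \<Longrightarrow> x \<noteq> z \<Longrightarrow> hs_norm (x - z) \<ge> \<delta> n"
      "log 2 (real (card S)) \<ge> y * (- log 2 (\<delta> n))"
      using packing_with_log_card[OF elim(1) \<delta> y(1)] by metis
    define a where "a = c * sqrt (real n)"
    \<comment> \<open>Linear in \<open>n\<close>, so that \<open>r * \<delta>\<^sup>2\<close> keeps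
      the order of \<open>n powr ((1 + s) / 2)\<close>, while only the fraction \<open>s\<close> of
      the rate is lost.\<close>
    define r where "r = nat \<lfloor>s * real n\<rfloor>"
    have sn: "0 \<le> s * real n" "s * real n \<le> real n" using s mult_right_mono[of s 1 "real n"] by auto
    have r: "real r \<le> s * real n" "s * real n - 1 \<le> real r" unfolding r_def using sn by linarith+
    have rn: "r \<le> n" using r(1) sn(2) by linarith
    have a: "a > 0" using c n by (simp add: a_def)
    have "a\<^sup>2 = 4 * real d / m * real n" using n c by (simp add: a_def power_mult_distrib)
    then have var: "4 * real d * real n / a\<^sup>2 = m" using d m n a by (simp add: field_simps)
    have "exp (sqrt (real n) / 2 + a - real r * (\<delta> n)\<^sup>2 / 2)
        \<le> exp (sqrt (real n) / 2 + c * sqrt (real n) - (s * real n - 1) * (\<delta> n)\<^sup>2 / 2)"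
      using mult_right_mono[OF r(2), of "(\<delta> n)\<^sup>2"] by (simp add: a_def)
    then have e2: "4 * real d * real n / a\<^sup>2 + exp (sqrt (real n) / 2 + a - real r * (\<delta> n)\<^sup>2 / 2) \<le> l2"
      using elim(2) m(3) unfolding var by linarith
    have e1: "4 * real d * real n / a\<^sup>2 \<le> l1" unfolding var by (rule m(2))
    obtain N where N: "enat N \<le> N_DI X d W n l1 l2"
      and size: "card S ^ n \<le> N * (n * d + 1) * (2 ^ n * card S ^ r)"
      using N_DI_ge[OF W S(1-3) n(2) S(4) less_imp_le[OF \<delta>(1)] a e1 e2] by metis
    have K: "card S > 0" using S by (simp add: card_gt_0_iff)
    note size' = log_code_size_ge[OF size K rn]
    have "(1 - s) * real n * (y * ((1 - s) / 4 * log 2 (real n))) \<le> real (n - r) * log 2 (real (card S))"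
    proof (rule mult_mono)
      show "(1 - s) * real n \<le> real (n - r)" using r(1) rn by (simp add: of_nat_diff left_diff_distrib)
      show "y * ((1 - s) / 4 * log 2 (real n)) \<le> log 2 (real (card S))" using S(5) unfolding log\<delta> .
      show "0 \<le> y * ((1 - s) / 4 * log 2 (real n))" using y s ln by simp
    qed simp
    then have "(1 - s) * real n * (y * ((1 - s) / 4 * log 2 (real n))) - real n - log 2 (real n * real d + 1) \<le> log 2 (real N)"
      using size'(2) by (simp add: add.commute)
    then have "((1 - s) * real n * (y * ((1 - s) / 4 * log 2 (real n))) - real n - log 2 (real n * real d + 1)) / (real n * log 2 (real n))
        \<le> log 2 (real N) / (real n * log 2 (real n))"
      using n ln by (intro divide_right_mono) auto
    moreover have "((1 - s) * real n * (y * ((1 - s) / 4 * L)) - real n - B) / (real n * L)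
        = (1 - s)\<^sup>2 / 4 * y - 1 / L - B / (real n * L)" if "L > 0" for L B
      using n that by (simp add: diff_divide_distrib power2_eq_square)
    ultimately have "?g n \<le> log 2 (real N) / (real n * log 2 (real n))" using ln by metis
    then have "ereal (?g n) \<le> ereal (log 2 (real N) / (real n * log 2 (real n)))" by simp
    also have "\<dots> \<le> DI_rate X d W l1 l2 n" by (rule DI_rate_ge[OF N size'(1)])
    finally show ?case .
  qed
  then have "liminf (\<lambda>n. ereal (?g n)) \<le> liminf (DI_rate X d W l1 l2)" by (rule Liminf_mono)
  moreover have "(\<lambda>n. ereal (?g n)) \<longlonglongrightarrow> ereal ((1 - s)\<^sup>2 / 4 * y)"
    by (rule tendsto_ereal) (rule direct_rate_limit[OF d])
  then have "liminf (\<lambda>n. ereal (?g n)) = ereal ((1 - s)\<^sup>2 / 4 * y)"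
    by (intro lim_imp_Liminf) auto
  ultimately show ?thesis by simp
qed

text \<open>The auxiliary parameter \<open>s\<close> tends to 0, which turns
  \<open>(1 - s)\<^sup>2 / 4\<close> into 1/4; values below the dimension are reached by
  density.\<close>

lemma liminf_DI_rate_ge:
  assumes W: "\<And>x. x \<in> X \<Longrightarrow> W x \<in> density d" and d: "d > 0"
    and l: "l1 > 0" "l2 > 0"
  shows "ereal (1 / 4) * lower_minkowski_dim (msqrt ` W ` X) \<le> liminf (DI_rate X d W l1 l2)"
proof (rule dense_le)
  let ?D = "lower_minkowski_dim (msqrt ` W ` X)" and ?L = "liminf (DI_rate X d W l1 l2)"
  fix w assume w: "w < ereal (1 / 4) * ?D"
  have L0: "0 \<le> ?L" by (rule Liminf_bounded) (simp add: DI_rate_nonneg)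
  show "w \<le> ?L"
  proof (cases w)
    case (real w')
    show ?thesis
    \<comment> \<open>The direct bound takes a positive \<open>y\<close>; nonpositive values are
      covered by nonnegativity of the rates.\<close>
    proof (cases "w' \<le> 0")
      case True
      then show ?thesis using L0 real by (metis ereal_less_eq(3) order_trans zero_ereal_def)
    next
      case False
      have "ereal (4 * w') < ?D" using w real by (cases ?D) auto
      then have "ereal ((1 - s)\<^sup>2 / 4 * (4 * w')) \<le> ?L" if "0 < s" "s < 1" for s
        using False that by (intro direct_liminf_ge[OF W d l]) auto
      then have "eventually (\<lambda>s. ereal ((1 - s)\<^sup>2 / 4 * (4 * w')) \<le> ?L) (at_right 0)"
        by (auto simp: eventually_at_right_field intro!: exI[of _ 1])
      moreover have "((\<lambda>s. ereal ((1 - s)\<^sup>2 / 4 * (4 * w'))) \<longlongrightarrow> ereal ((1 - 0)\<^sup>2 / 4 * (4 * w'))) (at_right 0)"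
        by (intro tendsto_ereal tendsto_intros) simp
      ultimately have "ereal ((1 - 0)\<^sup>2 / 4 * (4 * w')) \<le> ?L"
        by (intro tendsto_upperbound) auto
      then show ?thesis using real by simp
    qed
  qed (use w in auto)
qed

theorem theorem3:
  fixes M :: "'a measure" and W :: "'a \<Rightarrow> complex mat" and d :: nat
    and l1 l2 :: real
  assumes "d > 0"
    and "space M \<noteq> {}"
    and "\<forall>x \<in> space M. W x \<in> density d"
    and "\<forall>i<d. \<forall>j<d. (\<lambda>x. W x $$ (i, j)) \<in> borel_measurable M"
    and "l1 > 0" and "l2 > 0" and "l1 + l2 < 1"
  shows "ereal (1/4) * lower_minkowski_dim (msqrt ` W ` space M)
           \<le> C_DI_dot (space M) d W
         \<and> C_DI_dot (space M) d W \<le> liminf (DI_rate (space M) d W l1 l2)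
         \<and> liminf (DI_rate (space M) d W l1 l2)
           \<le> ereal (1/2) * lower_minkowski_dim (msqrt ` W ` space M)"
proof (intro conjI)
  have W: "W x \<in> density d" if "x \<in> space M" for x using assms(3) that by blast
  show "ereal (1/4) * lower_minkowski_dim (msqrt ` W ` space M) \<le> C_DI_dot (space M) d W"
    unfolding C_DI_dot_def
  proof (intro INF_greatest)
    \<comment> \<open>The direct bound holds for every pair of positive errors, including pairs with
      sum at least 1, and so passes to both infima.\<close>
    fix k1 k2 :: real assume "k1 \<in> {0<..}" "k2 \<in> {0<..}"
    then show "ereal (1/4) * lower_minkowski_dim (msqrt ` W ` space M) \<le> liminf (DI_rate (space M) d W k1 k2)"
      by (intro liminf_DI_rate_ge[OF W assms(1)]) auto
  qed
  \<comment> \<open>The given pair \<open>l1\<close>, \<open>l2\<close> is one of the pairs over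
    which the infimum runs.\<close>
  have "C_DI_dot (space M) d W \<le> (INF l2 \<in> {0<..}. liminf (DI_rate (space M) d W l1 l2))"
    unfolding C_DI_dot_def by (rule INF_lower) (use assms(5) in simp)
  also have "\<dots> \<le> liminf (DI_rate (space M) d W l1 l2)" by (rule INF_lower) (use assms(6) in simp)
  finally show "C_DI_dot (space M) d W \<le> liminf (DI_rate (space M) d W l1 l2)" .
  show "liminf (DI_rate (space M) d W l1 l2) \<le> ereal (1/2) * lower_minkowski_dim (msqrt ` W ` space M)"
    by (rule liminf_DI_rate_le[OF W assms(5-7)])
qed

end
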